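(* Let $\Bbbk$ be an algebraically closed field of characteristic $p>0$, and let $H=H({\bf d_s},{\bf b_s},{\bf c_{s,t}})$ be a 2-step iterated Hopf Ore extension as described in the context. Suppose that $H$ is not commutative, that is, ${\bf d_s}\ne{\bf 0}$. Let $Z=Z(H)=\Bbbk[X_1^p,X_2^p-d_0^{p-1}X_2]$. (1) The defining ideal of the non-Azumaya locus $\mathcal{NA}(H)$ in $Z$ is $\sqrt{\langle d_0^pX_1^p+d(X_1^p)^p\rangle}$. That is, $H_{\alpha,\beta}\cong M_p(\Bbbk)$ if and only if $d_0^p\alpha+d(\alpha)^p\ne0$. (2) Suppose that $d_0=0$. Let $\mathfrak m_{\alpha,\beta}\in\mathcal{NA}(H)$; that is, $d_0^p\alpha+d(\alpha)^p=0$, or equivalently $d(\alpha)=0$. Then $H_{\alpha,\beta}\cong\Bbbk[X,Y]/\langle X^p,Y^p\rangle$. Thus $H_{\alpha,\beta}$ has a unique simple module, of dimension 1. (3) Suppose that $d_0\ne0$. Let $\mathfrak m_{\alpha,\beta}\in\mathcal{NA}(H)$, so $d_0^p\alpha+d(\alpha)^p=0$. Then there are elements $u,w\in H_{\alpha,\beta}$ such that $H_{\alpha,\beta}=\Bbbk\langle u,w\rangle$, with relations $$u^p=0,\qquad wu-uw=u,\qquad w^p-w=\beta d_0^{-p}.$$ In particular, $H_{\alpha,\beta}$ has a single block of $p$ simple modules, each of dimension 1. (4) The non-Azumaya locus $\mathcal{NA}(H)$ is the disjoint union of $r$ copies of the affine line $\mathbb A^1(\Bbbk)$, where $r$ is the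 number of distinct roots of the equation $\sum_{s\ge0}d_s^px^{p^s}=0$.
   Context: Let ${\bf d_s}=\{d_s\}_{s\ge0}$, ${\bf b_s}=\{b_s\}_{s\ge0}$ and ${\bf c_{s,t}}=\{c_{s,t}\}_{0\le s<t}$ be sequences of scalars in $\Bbbk$ with only finitely many nonzero elements. $H({\bf d_s},{\bf b_s},{\bf c_{s,t}})$ denotes the Hopf algebra whose underlying algebra is the Ore extension $\Bbbk[X_1][X_2;\mathrm{Id},\delta]$, i.e. is generated by $X_1,X_2$ with the relation $X_2X_1-X_1X_2=\delta(X_1)=\sum_{s\ge0}d_sX_1^{p^s}$, with $\epsilon(X_1)=\epsilon(X_2)=0$, $\Delta(X_1)=X_1\otimes1+1\otimes X_1$ and $\Delta(X_2)=X_2\otimes1+1\otimes X_2+w_0$, where $$w_0=\sum_{s\ge0}b_s\Big(\sum_{i=1}^{p-1}\tfrac{(p-1)!}{i!(p-i)!}(X_1^{p^s})^i\otimes(X_1^{p^s})^{p-i}\Big)+\sum_{0\le s<t}c_{s,t}\big(X_1^{p^s}\otimes X_1^{p^t}-X_1^{p^t}\otimes X_1^{p^s}\big).$$ When $H$ is not commutative its center is the polynomial algebra $Z=\Bbbk[X_1^p,X_2^p-d_0^{p-1}X_2]$ and its PI-degree is $p$. For $(\alpha,\beta)\in\mathbb A^2(\Bbbk)$, $\mathfrak m_{\alpha,\beta}=\langle X_1^p-\alpha,\ X_2^p-d_0^{p-1}X_2-\beta\rangle$ is the corresponding maximal ideal of $Z$ and $H_{\alpha,\beta}:=H/\mathfrak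 m_{\alpha,\beta}H$. Define $d(x)=\sum_{s\ge1}d_sx^{p^{s-1}}$. The Azumaya locus $\mathcal A(H)$ is the set of maximal ideals $\mathfrak m$ of $Z$ with $H/\mathfrak mH\cong M_p(\Bbbk)$, and $\mathcal{NA}(H)=\mathrm{maxspec}(Z)\setminus\mathcal A(H)$, a proper closed subset. *)

theory Defs
  imports
    "HOL-Algebra.Ideal_Product"
    "HOL-Algebra.QuotRing"
    "HOL-Algebra.Module"
    "HOL-Computational_Algebra.Polynomial"
    "HOL-Library.Disjoint_Sets"
    "Jordan_Normal_Form.VS_Connect"
begin

section \<open>Algebras over a field\<close>

text \<open>
  A possibly noncommutative algebra over the field \<open>'k\<close> is given by a record of type
  \<open>('k, 'b) module\<close> (or an extension of it), all of whose fields are used.  The locale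
  \<^locale>\<open>algebra\<close> of HOL-Algebra is not used because it requires commutativity.
\<close>

definition alg_iso ::
  "('k, 'b, 'x) module_scheme \<Rightarrow> ('k, 'c, 'y) module_scheme \<Rightarrow> ('b \<Rightarrow> 'c) set" where
  "alg_iso A B =
     {\<phi> \<in> ring_iso A B. \<forall>a. \<forall>x\<in>carrier A. \<phi> (a \<odot>\<^bsub>A\<^esub> x) = a \<odot>\<^bsub>B\<^esub> \<phi> x}"

definition alg_isomorphic ::
  "('k, 'b, 'x) module_scheme \<Rightarrow> ('k, 'c, 'y) module_scheme \<Rightarrow> bool"  (infix \<open>\<cong>\<^sub>k\<close> 50) where
  "A \<cong>\<^sub>k B \<longleftrightarrow> alg_iso A B \<noteq> {}"

definition quot_alg :: "('k, 'b, 'x) module_scheme \<Rightarrow> 'b set \<Rightarrow> ('k, 'b set) module" where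
  "quot_alg A I =
     \<lparr>carrier = carrier (A Quot I), mult = mult (A Quot I), one = one (A Quot I),
      zero = zero (A Quot I), add = add (A Quot I),
      smult = (\<lambda>a X. \<Union>x\<in>X. I +>\<^bsub>A\<^esub> (a \<odot>\<^bsub>A\<^esub> x))\<rparr>"

definition alg_center :: "('b, 'x) ring_scheme \<Rightarrow> 'b set" where
  "alg_center A = {z \<in> carrier A. \<forall>x\<in>carrier A. z \<otimes>\<^bsub>A\<^esub> x = x \<otimes>\<^bsub>A\<^esub> z}"

definition center_alg :: "('b, 'x) ring_scheme \<Rightarrow> ('b, 'x) ring_scheme" where
  "center_alg A = A\<lparr>carrier := alg_center A\<rparr>"

definition alg_eval :: "('k::zero, 'b, 'x) module_scheme \<Rightarrow> 'k poly \<Rightarrow> 'b \<Rightarrow> 'b" where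
  "alg_eval A f x =
     (\<Oplus>\<^bsub>A\<^esub> i\<in>{..Polynomial.degree f}. Polynomial.coeff f i \<odot>\<^bsub>A\<^esub> (x [^]\<^bsub>A\<^esub> i))"

text \<open>The polynomial algebras \<open>k[t]\<close> and \<open>k[X,Y]\<close>, the latter realised as \<open>k[X][Y]\<close>.\<close>

definition poly_alg :: "('k::field, 'k poly) module" where
  "poly_alg = \<lparr>carrier = UNIV, mult = (*), one = 1, zero = 0, add = (+),
     smult = Polynomial.smult\<rparr>"

definition poly2_alg :: "('k::field, 'k poly poly) module" where
  "poly2_alg = \<lparr>carrier = UNIV, mult = (*), one = 1, zero = 0, add = (+),
     smult = (\<lambda>a. Polynomial.smult [:a:])\<rparr>"

definition varX :: "'k::field poly poly" where "varX = [:[:0, 1:]:]"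
definition varY :: "'k::field poly poly" where "varY = [:0, 1:]"

text \<open>The free algebra on the alphabet \<open>'x\<close>: finitely supported functions on words, with
  concatenation of words extended bilinearly.\<close>

definition free_alg :: "('k::field, 'x list \<Rightarrow> 'k) module" where
  "free_alg =
     \<lparr>carrier = {f. finite {w. f w \<noteq> 0}},
      mult = (\<lambda>f g w. \<Sum>i\<le>length w. f (take i w) * g (drop i w)),
      one = (\<lambda>w. if w = [] then 1 else 0),
      zero = (\<lambda>w. 0),
      add = (\<lambda>f g w. f w + g w),
      smult = (\<lambda>a f w. a * f w)\<rparr>"

definition free_gen :: "'x \<Rightarrow> 'x list \<Rightarrow> 'k::field" where
  "free_gen x = (\<lambda>w. if w = [x] then 1 else 0)"

text \<open>\<open>A\<close> is generated by the family \<open>g\<close>, with \<open>Rels\<close> a set of defining relators.\<close>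

definition presented_by ::
  "('k::field, 'b, 'z) module_scheme \<Rightarrow> ('x \<Rightarrow> 'b) \<Rightarrow> ('x list \<Rightarrow> 'k) set \<Rightarrow> bool" where
  "presented_by A g Rels \<longleftrightarrow>
     (\<exists>\<phi> \<in> alg_iso (quot_alg free_alg (Idl\<^bsub>free_alg\<^esub> Rels)) A.
        \<forall>x. \<phi> ((Idl\<^bsub>free_alg\<^esub> Rels) +>\<^bsub>free_alg\<^esub> free_gen x) = g x)"


section \<open>Left modules, simple modules and blocks\<close>

text \<open>As in \<^locale>\<open>module\<close>, the fields \<^const>\<open>mult\<close> and \<^const>\<open>one\<close> of the record \<open>M\<close>
  are irrelevant; unlike there, the ring \<open>A\<close> need not be commutative.\<close>

locale left_module = A?: ring A + M?: abelian_group M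
  for A :: "('b, 'x) ring_scheme" (structure)
    and M :: "('b, 'm, 'z) module_scheme" (structure) +
  assumes act_closed: "\<lbrakk>a \<in> carrier A; x \<in> carrier M\<rbrakk> \<Longrightarrow> a \<odot>\<^bsub>M\<^esub> x \<in> carrier M"
    and act_l_distr: "\<lbrakk>a \<in> carrier A; b \<in> carrier A; x \<in> carrier M\<rbrakk> \<Longrightarrow>
      (a \<oplus>\<^bsub>A\<^esub> b) \<odot>\<^bsub>M\<^esub> x = (a \<odot>\<^bsub>M\<^esub> x) \<oplus>\<^bsub>M\<^esub> (b \<odot>\<^bsub>M\<^esub> x)"
    and act_r_distr: "\<lbrakk>a \<in> carrier A; x \<in> carrier M; y \<in> carrier M\<rbrakk> \<Longrightarrow>
      a \<odot>\<^bsub>M\<^esub> (x \<oplus>\<^bsub>M\<^esub> y) = (a \<odot>\<^bsub>M\<^esub> x) \<oplus>\<^bsub>M\<^esub> (a \<odot>\<^bsub>M\<^esub> y)"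
    and act_assoc: "\<lbrakk>a \<in> carrier A; b \<in> carrier A; x \<in> carrier M\<rbrakk> \<Longrightarrow>
      (a \<otimes>\<^bsub>A\<^esub> b) \<odot>\<^bsub>M\<^esub> x = a \<odot>\<^bsub>M\<^esub> (b \<odot>\<^bsub>M\<^esub> x)"
    and act_one: "x \<in> carrier M \<Longrightarrow> \<one>\<^bsub>A\<^esub> \<odot>\<^bsub>M\<^esub> x = x"

definition left_submodule ::
  "('b, 'x) ring_scheme \<Rightarrow> ('b, 'm, 'z) module_scheme \<Rightarrow> 'm set \<Rightarrow> bool" where
  "left_submodule A M N \<longleftrightarrow>
     additive_subgroup N M \<and> (\<forall>a\<in>carrier A. \<forall>x\<in>N. a \<odot>\<^bsub>M\<^esub> x \<in> N)"

definition simple_module :: "('b, 'x) ring_scheme \<Rightarrow> ('b, 'm, 'z) module_scheme \<Rightarrow> bool" where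
  "simple_module A M \<longleftrightarrow>
     left_module A M \<and> carrier M \<noteq> {\<zero>\<^bsub>M\<^esub>} \<and>
     (\<forall>N. left_submodule A M N \<longrightarrow> N = {\<zero>\<^bsub>M\<^esub>} \<or> N = carrier M)"

definition module_isomorphic ::
  "('b, 'x) ring_scheme \<Rightarrow> ('b, 'm, 'y) module_scheme \<Rightarrow> ('b, 'n, 'z) module_scheme \<Rightarrow> bool" where
  "module_isomorphic A M N \<longleftrightarrow>
     (\<exists>f. bij_betw f (carrier M) (carrier N) \<and>
        (\<forall>x\<in>carrier M. \<forall>y\<in>carrier M. f (x \<oplus>\<^bsub>M\<^esub> y) = f x \<oplus>\<^bsub>N\<^esub> f y) \<and>
        (\<forall>a\<in>carrier A. \<forall>x\<in>carrier M. f (a \<odot>\<^bsub>M\<^esub> x) = a \<odot>\<^bsub>N\<^esub> f x))"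

text \<open>The underlying vector space of an \<open>A\<close>-module, via \<open>k \<rightarrow> A\<close>, \<open>a \<mapsto> a \<cdot> 1\<close>.\<close>

definition underlying_space ::
  "('k, 'b, 'x) module_scheme \<Rightarrow> ('b, 'm, 'z) module_scheme \<Rightarrow> ('k, 'm) module" where
  "underlying_space A M =
     \<lparr>carrier = carrier M, mult = mult M, one = one M, zero = zero M, add = add M,
      smult = (\<lambda>a x. (a \<odot>\<^bsub>A\<^esub> \<one>\<^bsub>A\<^esub>) \<odot>\<^bsub>M\<^esub> x)\<rparr>"

definition has_dim ::
  "('k::field, 'b, 'x) module_scheme \<Rightarrow> ('b, 'm, 'z) module_scheme \<Rightarrow> nat \<Rightarrow> bool" where
  "has_dim A M n \<longleftrightarrow>
     vectorspace.fin_dim class_ring (underlying_space A M) \<and>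
     vectorspace.dim class_ring (underlying_space A M) = n"

text \<open>Blocks of a finite-dimensional algebra are represented by the primitive central
  idempotents \<open>e\<close>; the block itself is \<open>A e\<close>, and a simple module belongs to it iff \<open>e\<close> acts
  on it as the identity.\<close>

definition central_idempotents :: "('b, 'x) ring_scheme \<Rightarrow> 'b set" where
  "central_idempotents A = {e \<in> alg_center A. e \<otimes>\<^bsub>A\<^esub> e = e}"

definition blocks :: "('b, 'x) ring_scheme \<Rightarrow> 'b set" where
  "blocks A = {e \<in> central_idempotents A. e \<noteq> \<zero>\<^bsub>A\<^esub> \<and>
     \<not> (\<exists>f\<in>central_idempotents A. \<exists>g\<in>central_idempotents A.
          f \<noteq> \<zero>\<^bsub>A\<^esub> \<and> g \<noteq> \<zero>\<^bsub>A\<^esub> \<and> f \<otimes>\<^bsub>A\<^esub> g = \<zero>\<^bsub>A\<^esub> \<and> e = f \<oplus>\<^bsub>A\<^esub> g)}"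

definition in_block :: "('b, 'm, 'z) module_scheme \<Rightarrow> 'b \<Rightarrow> bool" where
  "in_block M e \<longleftrightarrow> (\<forall>x\<in>carrier M. e \<odot>\<^bsub>M\<^esub> x = x)"


section \<open>Maximal spectra and the Azumaya locus\<close>

definition maxspec :: "('b, 'x) ring_scheme \<Rightarrow> 'b set set" where
  "maxspec R = {m. maximalideal m R}"

definition zero_locus :: "('b, 'x) ring_scheme \<Rightarrow> 'b set \<Rightarrow> 'b set set" where
  "zero_locus R I = {m \<in> maxspec R. I \<subseteq> m}"

definition zariski_closed :: "('b, 'x) ring_scheme \<Rightarrow> 'b set set \<Rightarrow> bool" where
  "zariski_closed R S \<longleftrightarrow> (\<exists>I. ideal I R \<and> S = zero_locus R I)"

definition vanishing_ideal :: "('b, 'x) ring_scheme \<Rightarrow> 'b set set \<Rightarrow> 'b set" where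
  "vanishing_ideal R S = {z \<in> carrier R. \<forall>m\<in>S. z \<in> m}"

text \<open>\<open>I\<close> is the defining (radical) ideal of the closed set \<open>S\<close>.\<close>

definition is_defining_ideal :: "('b, 'x) ring_scheme \<Rightarrow> 'b set set \<Rightarrow> 'b set \<Rightarrow> bool" where
  "is_defining_ideal R S I \<longleftrightarrow> S = zero_locus R I \<and> I = vanishing_ideal R S"

definition radical :: "('b, 'x) ring_scheme \<Rightarrow> 'b set \<Rightarrow> 'b set" where
  "radical R I = {z \<in> carrier R. \<exists>n::nat. n > 0 \<and> z [^]\<^bsub>R\<^esub> n \<in> I}"

text \<open>A closed subset of the maximal spectrum, with its reduced structure, is isomorphic to
  \<open>\<bbbA>\<^sup>1\<close> iff its coordinate ring is \<open>k[t]\<close>.\<close>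

definition is_affine_line :: "('k::field, 'b, 'x) module_scheme \<Rightarrow> 'b set set \<Rightarrow> bool" where
  "is_affine_line R S \<longleftrightarrow>
     zariski_closed R S \<and> quot_alg R (vanishing_ideal R S) \<cong>\<^sub>k (poly_alg :: ('k, 'k poly) module)"

text \<open>The fibre \<open>A / \<mm>A\<close> over an ideal \<open>\<mm>\<close> of the center.\<close>

definition fibre :: "('k, 'b, 'x) module_scheme \<Rightarrow> 'b set \<Rightarrow> ('k, 'b set) module" where
  "fibre A m = quot_alg A (m \<cdot>\<^bsub>A\<^esub> carrier A)"

text \<open>Here \<open>n\<close> is the PI-degree of \<open>A\<close>, and \<^term>\<open>module_mat TYPE('k::field) n n\<close> is the algebra
  \<open>M\<^sub>n(k)\<close>.\<close>

definition azumaya_locus :: "('k::field, 'b, 'x) module_scheme \<Rightarrow> nat \<Rightarrow> 'b set set" where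
  "azumaya_locus A n = {m \<in> maxspec (center_alg A). fibre A m \<cong>\<^sub>k module_mat TYPE('k::field) n n}"

definition non_azumaya_locus :: "('k::field, 'b, 'x) module_scheme \<Rightarrow> nat \<Rightarrow> 'b set set" where
  "non_azumaya_locus A n = maxspec (center_alg A) - azumaya_locus A n"


section \<open>The Hopf algebras \<open>H(d, b, c)\<close>\<close>

text \<open>
  The Ore extension \<open>k[X\<^sub>1][X\<^sub>2; Id, \<delta>]\<close>.  An element is a polynomial in \<open>X\<^sub>2\<close> with coefficients
  in \<open>k[X\<^sub>1]\<close> written on the left, and the product is the one determined by
  \<open>X\<^sub>2 f = f X\<^sub>2 + \<delta> f\<close>, that is \<open>X\<^sub>2\<^sup>n g = (\<Sum>i\<le>n. (n choose i) \<delta>\<^sup>i(g) X\<^sub>2\<^sup>n\<^sup>-\<^sup>i)\<close>.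
\<close>

definition ore_mult ::
  "('k::field poly \<Rightarrow> 'k poly) \<Rightarrow> 'k poly poly \<Rightarrow> 'k poly poly \<Rightarrow> 'k poly poly" where
  "ore_mult \<delta> P Q =
     (\<Sum>n\<le>Polynomial.degree P. \<Sum>m\<le>Polynomial.degree Q. \<Sum>i\<le>n.
        Polynomial.monom
          (of_nat (n choose i) * Polynomial.coeff P n * (\<delta> ^^ i) (Polynomial.coeff Q m))
          (n - i + m))"

definition ore_ext :: "('k::field poly \<Rightarrow> 'k poly) \<Rightarrow> ('k, 'k poly poly) module" where
  "ore_ext \<delta> =
     \<lparr>carrier = UNIV, mult = ore_mult \<delta>, one = 1, zero = 0, add = (+),
      smult = (\<lambda>a. Polynomial.smult [:a:])\<rparr>"

definition X1 :: "'k::field poly poly" where "X1 = [:[:0, 1:]:]"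
definition X2 :: "'k::field poly poly" where "X2 = [:0, 1:]"

text \<open>The derivation of \<open>k[X\<^sub>1]\<close> with \<open>\<delta>(X\<^sub>1) = \<Sum>s\<ge>0. d\<^sub>s X\<^sub>1^(p^s)\<close>.\<close>

definition ore_deriv :: "nat \<Rightarrow> (nat \<Rightarrow> 'k::field) \<Rightarrow> 'k poly \<Rightarrow> 'k poly" where
  "ore_deriv p d f = (\<Sum>s | d s \<noteq> 0. Polynomial.monom (d s) (p ^ s)) * pderiv f"

text \<open>
  Since the monomials \<open>X\<^sub>1\<^sup>i X\<^sub>2\<^sup>j\<close> form a basis of \<open>A = ore_ext \<delta>\<close>, the algebra \<open>A \<otimes> A\<close> is
  realised by finitely supported coefficient families with respect to the product basis
  \<open>X\<^sub>1\<^sup>i X\<^sub>2\<^sup>j \<otimes> X\<^sub>1\<^sup>k X\<^sub>2\<^sup>l\<close>, indexed by \<open>((i, j), (k, l))\<close>.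
\<close>

type_synonym 'k tensor_sq = "(nat \<times> nat) \<times> (nat \<times> nat) \<Rightarrow> 'k"

definition pbw :: "nat \<times> nat \<Rightarrow> 'k::field poly poly" where
  "pbw = (\<lambda>(i, j). Polynomial.monom (Polynomial.monom 1 i) j)"

definition pbw_coeff :: "'k::field poly poly \<Rightarrow> nat \<times> nat \<Rightarrow> 'k" where
  "pbw_coeff P = (\<lambda>(i, j). Polynomial.coeff (Polynomial.coeff P j) i)"

definition tensor :: "'k::field poly poly \<Rightarrow> 'k poly poly \<Rightarrow> 'k tensor_sq"
    (infix \<open>\<otimes>\<^sub>t\<close> 70) where
  "P \<otimes>\<^sub>t Q = (\<lambda>(u, v). pbw_coeff P u * pbw_coeff Q v)"

definition tensor_square ::
  "('k::field, 'k poly poly, 'x) module_scheme \<Rightarrow> ('k, 'k tensor_sq) module" where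
  "tensor_square A =
     \<lparr>carrier = {F. finite {uv. F uv \<noteq> 0}},
      mult = (\<lambda>F G st. \<Sum>(u, v) | F (u, v) \<noteq> 0. \<Sum>(u', v') | G (u', v') \<noteq> 0.
                F (u, v) * G (u', v') *
                ((pbw u \<otimes>\<^bsub>A\<^esub> pbw u') \<otimes>\<^sub>t (pbw v \<otimes>\<^bsub>A\<^esub> pbw v')) st),
      one = 1 \<otimes>\<^sub>t 1,
      zero = (\<lambda>_. 0),
      add = (\<lambda>F G st. F st + G st),
      smult = (\<lambda>a F st. a * F st)\<rparr>"

text \<open>The element \<open>w\<^sub>0\<close> of \<open>A \<otimes> A\<close>; the binomial-type coefficient
  \<open>(p - 1)! / (i! (p - i)!)\<close> is an integer for prime \<open>p\<close> and \<open>0 < i < p\<close>.\<close>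

definition w0 :: "('k::field, 'k poly poly, 'x) module_scheme \<Rightarrow> nat \<Rightarrow>
    (nat \<Rightarrow> 'k) \<Rightarrow> (nat \<Rightarrow> nat \<Rightarrow> 'k) \<Rightarrow> 'k tensor_sq" where
  "w0 A p b c =
     (let T = tensor_square A; x = (\<lambda>s. X1 [^]\<^bsub>A\<^esub> (p ^ s)) in
        (\<Oplus>\<^bsub>T\<^esub> s\<in>{s. b s \<noteq> 0}. b s \<odot>\<^bsub>T\<^esub>
           (\<Oplus>\<^bsub>T\<^esub> i\<in>{1..p - 1}. of_nat (fact (p - 1) div (fact i * fact (p - i))) \<odot>\<^bsub>T\<^esub>
              ((x s [^]\<^bsub>A\<^esub> i) \<otimes>\<^sub>t (x s [^]\<^bsub>A\<^esub> (p - i)))))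
        \<oplus>\<^bsub>T\<^esub>
        finsum T (\<lambda>(s, t). c s t \<odot>\<^bsub>T\<^esub> ((x s \<otimes>\<^sub>t x t) \<ominus>\<^bsub>T\<^esub> (x t \<otimes>\<^sub>t x s)))
          {(s, t). s < t \<and> c s t \<noteq> 0})"

record ('k, 'b, 'bb) hopf_data = "('k, 'b) module" +
  counit :: "'b \<Rightarrow> 'k"
  comult :: "'b \<Rightarrow> 'bb"

text \<open>Counit and comultiplication are given on the basis \<open>X\<^sub>1\<^sup>i X\<^sub>2\<^sup>j\<close> by the multiplicative
  extension of their values on \<open>X\<^sub>1\<close> and \<open>X\<^sub>2\<close>; in particular the counit takes the constant
  coefficient.  The antipode is determined by these data.\<close>

definition hopf_ore :: "nat \<Rightarrow> (nat \<Rightarrow> 'k::field) \<Rightarrow> (nat \<Rightarrow> 'k) \<Rightarrow> (nat \<Rightarrow> nat \<Rightarrow> 'k) \<Rightarrow>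
    ('k, 'k poly poly, 'k tensor_sq) hopf_data" where
  "hopf_ore p d b c =
     (let A = ore_ext (ore_deriv p d);
          T = tensor_square A;
          D1 = (X1 \<otimes>\<^sub>t 1) \<oplus>\<^bsub>T\<^esub> (1 \<otimes>\<^sub>t X1);
          D2 = (X2 \<otimes>\<^sub>t 1) \<oplus>\<^bsub>T\<^esub> (1 \<otimes>\<^sub>t X2) \<oplus>\<^bsub>T\<^esub> w0 A p b c
      in \<lparr>carrier = carrier A, mult = mult A, one = one A, zero = zero A, add = add A,
          smult = smult A,
          counit = (\<lambda>P. pbw_coeff P (0, 0)),
          comult = (\<lambda>P. finsum T
             (\<lambda>(i, j). pbw_coeff P (i, j) \<odot>\<^bsub>T\<^esub> ((D1 [^]\<^bsub>T\<^esub> i) \<otimes>\<^bsub>T\<^esub> (D2 [^]\<^bsub>T\<^esub> j)))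
             {ij. pbw_coeff P ij \<noteq> 0})\<rparr>)"

lemma hopf_ore_relation:
  fixes d b :: "nat \<Rightarrow> 'k::field" and c :: "nat \<Rightarrow> nat \<Rightarrow> 'k" and p :: nat
  defines "H \<equiv> hopf_ore p d b c"
  shows "X2 \<otimes>\<^bsub>H\<^esub> X1 = X1 \<otimes>\<^bsub>H\<^esub> X2 \<oplus>\<^bsub>H\<^esub> [:\<Sum>s | d s \<noteq> 0. Polynomial.monom (d s) (p ^ s):]"
  by (simp add: H_def hopf_ore_def Let_def ore_ext_def ore_mult_def X1_def X2_def
      ore_deriv_def pderiv_pCons numeral_eq_Suc monom_0 monom_Suc)

text \<open>The generators \<open>X\<^sub>1\<^sup>p\<close> and \<open>X\<^sub>2\<^sup>p - d\<^sub>0\<^sup>p\<^sup>-\<^sup>1 X\<^sub>2\<close> of the center, and the ideal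
  \<open>\<mm>\<^sub>\<alpha>\<^sub>,\<^sub>\<beta>\<close> of the center.\<close>

definition z1 :: "('k::field, 'k poly poly, 'x) module_scheme \<Rightarrow> nat \<Rightarrow> 'k poly poly" where
  "z1 A p = X1 [^]\<^bsub>A\<^esub> p"

definition z2 :: "('k::field, 'k poly poly, 'x) module_scheme \<Rightarrow> nat \<Rightarrow> (nat \<Rightarrow> 'k) \<Rightarrow>
    'k poly poly" where
  "z2 A p d = (X2 [^]\<^bsub>A\<^esub> p) \<ominus>\<^bsub>A\<^esub> (d 0 ^ (p - 1) \<odot>\<^bsub>A\<^esub> X2)"

definition point_ideal :: "('k::field, 'k poly poly, 'x) module_scheme \<Rightarrow> nat \<Rightarrow> (nat \<Rightarrow> 'k) \<Rightarrow>
    'k \<Rightarrow> 'k \<Rightarrow> 'k poly poly set" where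
  "point_ideal A p d \<alpha> \<beta> =
     Idl\<^bsub>center_alg A\<^esub>
       {z1 A p \<ominus>\<^bsub>A\<^esub> (\<alpha> \<odot>\<^bsub>A\<^esub> \<one>\<^bsub>A\<^esub>), z2 A p d \<ominus>\<^bsub>A\<^esub> (\<beta> \<odot>\<^bsub>A\<^esub> \<one>\<^bsub>A\<^esub>)}"

text \<open>The polynomial \<open>d(x) = \<Sum>s\<ge>1. d\<^sub>s x^(p^(s-1))\<close>.\<close>

definition d_poly :: "nat \<Rightarrow> (nat \<Rightarrow> 'k::field) \<Rightarrow> 'k poly" where
  "d_poly p d = (\<Sum>s | 1 \<le> s \<and> d s \<noteq> 0. Polynomial.monom (d s) (p ^ (s - 1)))"

datatype uw = U | W

end

theory Submission
  imports Defs
begin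

text \<open>
  Left multiplication by elements of \<open>k[X\<^sub>1]\<close> and right multiplication by elements of \<open>k[X\<^sub>2]\<close> are
  the commutative ones on the underlying space \<open>k[X, Y]\<close>. Hence the center is the commutative
  subring generated by \<open>X\<^sup>p\<close> and \<open>Y\<^sup>p - d\<^sub>0\<^sup>p\<^sup>-\<^sup>1 Y\<close>, and the ideal \<open>\<mm>H\<close> of a point \<open>(\<alpha>, \<beta>)\<close> coincides
  with the ideal \<open>(X\<^sup>p - \<alpha>, Y\<^sup>p - d\<^sub>0\<^sup>p\<^sup>-\<^sup>1 Y - \<beta>)\<close> of \<open>k[X, Y]\<close>.

  Write \<open>D = \<delta>(X\<^sub>1)\<close> and \<open>\<alpha> = a\<^sup>p\<close>. In the fibre \<open>x = X\<^sub>1 - a\<close> is nilpotent and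
  \<open>X\<^sub>2 x - x X\<^sub>2 = d\<^sub>0 x + D(a)\<close>, while \<open>D(a)\<^sup>p = d\<^sub>0\<^sup>p \<alpha> + d(\<alpha>)\<^sup>p\<close>. If \<open>D(a) \<noteq> 0\<close>, the fibre acts
  faithfully and densely on its right module generated by one vector killed by \<open>x\<close>, which has dimension \<open>p\<close>.
  If \<open>D(a) = 0\<close>, then \<open>x\<close> generates a nilpotent ideal modulo which the fibre is the commutative
  algebra \<open>k[Y] / (Y\<^sup>p - d\<^sub>0\<^sup>p\<^sup>-\<^sup>1 Y - \<beta>)\<close>, so all simple modules are characters, given by the
  roots of this polynomial.
\<close>

section \<open>Ore multiplication by a derivation\<close>

text \<open>The difficulty is to compute in a noncommutative quotient with no basis theorem at hand.
  Because the ideal of a point is also an ideal for the commutative product, two divisions with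
  remainder give normal forms of X-degree and Y-degree below p, and comparing degrees makes them
  unique. Every nonvanishing argument rests on this. The commutator with X_1 is D times a difference
  quotient in Y with step d_0; by Frobenius it vanishes on Y^p - d_0^{p-1} Y, which is where this
  central element comes from. D is d_0 X plus a polynomial in X^p, so it is affine in x in the
  fibre. If D(a) \<noteq> 0, then x^i sends Y^i to i! D(a)^i, and i! is invertible because i < p;
  this gives both injectivity and density. If D(a) = 0, then f = x^{p-1} is nonzero in the fibre
  while f h f = 0 for all h, which no matrix algebra allows. For d_0 \<noteq> 0 such a fibre has
  only one block because its center is k, by the commutator argument that also determines the center
  of H.\<close>

lemma poly_smult_sum_right: "Polynomial.smult c (sum F A) = (\<Sum>i\<in>A. Polynomial.smult c (F i))"
  by (induction A rule: infinite_finite_induct) (auto simp: smult_add_right)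

locale poly_derivation =
  fixes \<delta> :: "'k::field poly \<Rightarrow> 'k poly"
  assumes der_add: "\<delta> (f + g) = \<delta> f + \<delta> g"
    and der_mult: "\<delta> (f * g) = \<delta> f * g + f * \<delta> g"
begin

lemma der_0 [simp]: "\<delta> 0 = 0"
  using der_add[of 0 0] by (metis add.right_neutral add_left_cancel)

lemma der_1 [simp]: "\<delta> 1 = 0"
  using der_mult[of 1 1] by (metis add.right_neutral add_left_cancel mult.left_neutral mult.right_neutral)

text \<open>Left multiplication by X_2, read off from X_2 f Y^m = f Y^{m+1} + \<delta>(f)
  Y^m.\<close>

definition shift :: "'k poly poly \<Rightarrow> 'k poly poly" where
  "shift Q = pCons 0 Q + map_poly \<delta> Q"

abbreviation ore (infixl \<open>\<star>\<close> 70) where "P \<star> Q \<equiv> ore_mult \<delta> P Q"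

lemma coeff_map_der [simp]: "coeff (map_poly \<delta> Q) n = \<delta> (coeff Q n)"
  by (simp add: coeff_map_poly)

lemma map_der_add: "map_poly \<delta> (P + Q) = map_poly \<delta> P + map_poly \<delta> Q"
  by (rule poly_eqI) (simp add: der_add)

lemma map_der_smult:
  "map_poly \<delta> (Polynomial.smult f Q) = Polynomial.smult f (map_poly \<delta> Q) + Polynomial.smult (\<delta> f) Q"
  by (rule poly_eqI) (simp add: der_mult add.commute)

lemma map_der_pCons [simp]: "map_poly \<delta> (pCons f Q) = pCons (\<delta> f) (map_poly \<delta> Q)"
  by (rule poly_eqI) (simp add: coeff_pCons split: nat.splits)

lemma map_der_1 [simp]: "map_poly \<delta> 1 = 0"
  by (rule poly_eqI) (simp add: coeff_1)

lemma map_der_0 [simp]: "map_poly \<delta> 0 = 0"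
  by (rule poly_eqI) simp

lemma map_der_monom: "map_poly \<delta> (monom g m) = monom (\<delta> g) m"
  by (rule poly_eqI) simp

lemma shift_0 [simp]: "shift 0 = 0"
  by (simp add: shift_def)

lemma shift_add: "shift (P + Q) = shift P + shift Q"
  by (simp add: shift_def map_der_add)

lemma shift_pow_0 [simp]: "(shift ^^ n) 0 = 0"
  by (induction n) auto

lemma shift_pow_add: "(shift ^^ n) (P + Q) = (shift ^^ n) P + (shift ^^ n) Q"
  by (induction n) (auto simp: shift_add)

lemma shift_sum: "shift (sum f A) = (\<Sum>i\<in>A. shift (f i))"
  by (induction A rule: infinite_finite_induct) (auto simp: shift_add)

lemma shift_pow_sum: "(shift ^^ n) (sum f A) = (\<Sum>i\<in>A. (shift ^^ n) (f i))"
  by (induction A rule: infinite_finite_induct) (auto simp: shift_pow_add)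

lemma shift_smult:
  "shift (Polynomial.smult f Q) = Polynomial.smult f (shift Q) + Polynomial.smult (\<delta> f) Q"
  by (simp add: shift_def map_der_smult smult_add_right smult_pCons)

lemma shift_monom:
  "shift (monom g m) = monom g (Suc m) + monom (\<delta> g) m"
  by (simp add: shift_def map_der_monom monom_Suc)

lemma der_of_nat_mult: "\<delta> (of_nat n * f) = of_nat n * \<delta> f"
  by (induction n) (simp_all add: der_add distrib_right)

text \<open>The Leibniz formula for X_2^n g. It identifies the triple sum defining
  \<open>ore_mult\<close> with iterated left multiplication by X_2; the induction step is Pascal's
  rule.\<close>

lemma shift_pow_monom:
  "(shift ^^ n) (monom g m) =
     (\<Sum>i\<le>n. monom (of_nat (n choose i) * (\<delta> ^^ i) g) (n - i + m))"
proof (induction n)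
  case 0
  then show ?case by simp
next
  case (Suc n)
  let ?a = "\<lambda>i k. monom (of_nat k * (\<delta> ^^ i) g) (Suc n - i + m)"
  have "(shift ^^ Suc n) (monom g m) =
      (\<Sum>i\<le>n. shift (monom (of_nat (n choose i) * (\<delta> ^^ i) g) (n - i + m)))"
    by (simp add: Suc shift_sum)
  also have "\<dots> = (\<Sum>i\<le>n. ?a i (n choose i)) + (\<Sum>i\<le>n. ?a (Suc i) (n choose i))"
    by (simp add: shift_monom sum.distrib der_of_nat_mult Suc_diff_le)
  \<comment> \<open>The added term has coefficient n choose (n + 1) = 0; the longer range lets the
    index 0 be split off so that both sums align.\<close>
  also have "(\<Sum>i\<le>n. ?a i (n choose i)) = (\<Sum>i\<le>Suc n. ?a i (n choose i))"
    by (simp add: binomial_eq_0)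
  also have "\<dots> = ?a 0 1 + (\<Sum>i\<le>n. ?a (Suc i) (n choose Suc i))"
    by (subst sum.atMost_Suc_shift) simp
  also have "\<dots> + (\<Sum>i\<le>n. ?a (Suc i) (n choose i)) =
      ?a 0 1 + (\<Sum>i\<le>n. ?a (Suc i) (Suc n choose Suc i))"
    by (simp add: sum.distrib[symmetric] add_monom distrib_right add.assoc)
      (simp add: add.commute)
  also have "\<dots> = (\<Sum>i\<le>Suc n. ?a i (Suc n choose i))"
    by (subst sum.atMost_Suc_shift) simp
  finally show ?case .
qed

text \<open>The product is P with \<open>shift\<close> substituted for Y, applied to Q. This
  replaces the combinatorial sum by an operator calculus.\<close>

lemma ore_mult_altdef:
  "P \<star> Q = (\<Sum>n\<le>degree P. Polynomial.smult (coeff P n) ((shift ^^ n) Q))"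
proof -
  have "Polynomial.smult (coeff P n) ((shift ^^ n) Q) =
     (\<Sum>m\<le>degree Q. \<Sum>i\<le>n.
        monom
          (of_nat (n choose i) * coeff P n * (\<delta> ^^ i) (coeff Q m))
          (n - i + m))" for n
  proof -
    have "(shift ^^ n) Q = (shift ^^ n) (\<Sum>m\<le>degree Q. monom (coeff Q m) m)"
      by (simp add: poly_as_sum_of_monoms)
    then show ?thesis
      by (simp add: shift_pow_sum shift_pow_monom poly_smult_sum_right smult_monom mult_ac)
  qed
  then show ?thesis
    unfolding ore_mult_def by simp
qed

lemma ore_0_left [simp]: "0 \<star> Q = 0"
  by (simp add: ore_mult_altdef)

text \<open>Horner form of the product; it is the recursion behind the inductions on the left
  factor.\<close>

lemma ore_pCons: "pCons f P \<star> Q = Polynomial.smult f Q + P \<star> shift Q"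
proof (cases "P = 0")
  case True
  then show ?thesis by (simp add: ore_mult_altdef)
next
  case False
  then show ?thesis
    by (simp add: ore_mult_altdef sum.atMost_Suc_shift funpow_swap1 del: sum.atMost_Suc)
qed

lemma ore_0_right [simp]: "P \<star> 0 = 0"
  by (induction P) (simp_all add: ore_pCons)

lemma ore_add_left: "(P + P') \<star> Q = P \<star> Q + P' \<star> Q"
  by (induction P P' arbitrary: Q rule: poly_induct2) (simp_all add: ore_pCons smult_add_left)

lemma ore_add_right: "P \<star> (Q + Q') = P \<star> Q + P \<star> Q'"
  by (induction P arbitrary: Q Q') (simp_all add: ore_pCons smult_add_right shift_add)

lemma ore_minus_left: "(- P) \<star> Q = - (P \<star> Q)"
  using ore_add_left[of P "- P" Q] by (simp add: eq_neg_iff_add_eq_0 add.commute)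

lemma ore_minus_right: "P \<star> (- Q) = - (P \<star> Q)"
  using ore_add_right[of P Q "- Q"] by (simp add: eq_neg_iff_add_eq_0 add.commute)

lemma ore_diff_left: "(P - P') \<star> Q = P \<star> Q - P' \<star> Q"
  using ore_add_left[of P "- P'" Q] by (simp add: ore_minus_left)

lemma ore_diff_right: "P \<star> (Q - Q') = P \<star> Q - P \<star> Q'"
  using ore_add_right[of P Q "- Q'"] by (simp add: ore_minus_right)

lemma ore_sum_left: "sum F A \<star> Q = (\<Sum>i\<in>A. F i \<star> Q)"
  by (induction A rule: infinite_finite_induct) (auto simp: ore_add_left)

lemma ore_smult_left: "Polynomial.smult f P \<star> Q = Polynomial.smult f (P \<star> Q)"
  by (induction P arbitrary: Q) (simp_all add: ore_pCons smult_add_right smult_pCons)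

lemma ore_const_left [simp]: "[:f:] \<star> Q = Polynomial.smult f Q"
  by (simp add: ore_pCons)

lemma ore_X1_left: "X1 \<star> Q = Polynomial.smult [:0, 1:] Q"
  by (simp add: X1_def)

lemma ore_X2_left: "X2 \<star> Q = shift Q"
  by (simp add: X2_def ore_pCons)

text \<open>Associativity for the left factor X_2. The general case follows from it by induction on
  the Horner form.\<close>

lemma shift_ore: "shift (P \<star> Q) = shift P \<star> Q"
proof (induction P arbitrary: Q)
  case 0
  then show ?case by simp
next
  case (pCons f P)
  then show ?case
    by (simp add: ore_pCons shift_add shift_smult shift_def[of "pCons f P"] map_der_pCons ore_add_left)
      (simp add: shift_def ore_add_left ore_pCons)
qed

lemma ore_assoc: "(P \<star> Q) \<star> R = P \<star> (Q \<star> R)"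
  by (induction P arbitrary: Q R) (simp_all add: ore_pCons ore_add_left ore_smult_left shift_ore)

text \<open>If \<delta> kills the coefficients of Q, then \<open>shift\<close> acts on Q as
  multiplication by Y, so no correction terms ever arise.\<close>

lemma ore_eq_mult:
  assumes "map_poly \<delta> Q = 0"
  shows "P \<star> Q = P * Q"
  using assms
proof (induction P arbitrary: Q)
  case (pCons f P)
  have "shift Q = pCons 0 Q" "map_poly \<delta> (pCons 0 Q) = 0"
    using pCons.prems by (simp_all add: shift_def)
  then show ?case
    using pCons.IH[of "pCons 0 Q"] by (simp add: ore_pCons)
qed simp

lemma ore_1_right [simp]: "P \<star> 1 = P"
  by (subst ore_eq_mult) simp_all

lemma ore_1_left [simp]: "1 \<star> P = P"
  by (simp add: one_pCons[where ?'a = "'k poly"])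

lemma ring_oreI:
  fixes A :: "('k poly poly, 'x) ring_scheme"
  assumes "carrier A = UNIV" "mult A = ore_mult \<delta>" "one A = 1" "zero A = 0" "add A = (+)"
  shows "ring A"
proof (rule ringI)
  show "abelian_group A"
  proof (rule abelian_groupI)
    fix x assume "x \<in> carrier A"
    then show "\<exists>y\<in>carrier A. y \<oplus>\<^bsub>A\<^esub> x = \<zero>\<^bsub>A\<^esub>"
      by (intro bexI[of _ "- x"]) (auto simp: assms)
  qed (auto simp: assms algebra_simps)
  show "Group.monoid A"
    by (rule monoidI) (auto simp: assms ore_assoc)
qed (auto simp: assms ore_add_left ore_add_right)

lemma ore_X2_right: "P \<star> X2 = pCons 0 P"
  by (simp add: X2_def ore_eq_mult mult.commute[of P])

text \<open>The elements commuting with Z are closed under sums and products, and X_1, X_2 and the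
  scalars generate the algebra.\<close>

lemma ore_central:
  assumes "Z \<star> X1 = X1 \<star> Z" and "Z \<star> X2 = X2 \<star> Z" and "\<And>c. \<delta> [:c:] = 0"
  shows "Z \<star> P = P \<star> Z"
proof -
  have const: "Z \<star> [:f:] = [:f:] \<star> Z" for f
  proof (induction f)
    case 0
    then show ?case by simp
  next
    case (pCons a f)
    have "map_poly \<delta> [:[:a:]:] = 0"
      by (simp add: assms(3))
    then have "Z \<star> [:[:a:]:] = [:[:a:]:] \<star> Z"
      by (simp add: ore_eq_mult)
    moreover have "Z \<star> (X1 \<star> [:f:]) = X1 \<star> [:f:] \<star> Z"
      by (simp only: ore_assoc[symmetric] assms(1)) (simp only: ore_assoc pCons)
    moreover have "[:pCons a f:] = [:[:a:]:] + X1 \<star> [:f:]"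
      by (simp add: ore_X1_left)
    ultimately show ?case
      by (simp only: ore_add_left ore_add_right)
  qed
  show ?thesis
  proof (induction P)
    case 0
    then show ?case by simp
  next
    case (pCons f P)
    have eq: "pCons f P = [:f:] + P \<star> X2"
      by (simp add: ore_X2_right)
    have "Z \<star> (P \<star> X2) = P \<star> X2 \<star> Z"
      by (simp only: ore_assoc[symmetric] pCons) (simp only: ore_assoc assms(2))
    then show ?case
      by (simp only: eq ore_add_left ore_add_right const)
  qed
qed

end

section \<open>The Ore extension of the theorem\<close>

lemma coeff_map_poly_const [simp]: "coeff (map_poly (\<lambda>c. [:c:]) q) n = [:coeff q n:]"
  by (simp add: coeff_map_poly)

lemma map_poly_hom_add:
  assumes "h 0 = 0" "\<And>x y. h (x + y) = h x + h y"
  shows "map_poly h (P + Q) = map_poly h P + map_poly h Q"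
  by (rule poly_eqI) (simp add: coeff_map_poly assms)

lemma map_poly_hom_smult:
  assumes "h 0 = 0" "\<And>x y. h (x * y) = h x * h y"
  shows "map_poly h (Polynomial.smult c P) = Polynomial.smult (h c) (map_poly h P)"
  by (rule poly_eqI) (simp add: coeff_map_poly assms)

lemma map_poly_hom_mult:
  fixes h :: "'a::comm_ring_1 \<Rightarrow> 'b::comm_ring_1"
  assumes "h 0 = 0" "\<And>x y. h (x + y) = h x + h y" "\<And>x y. h (x * y) = h x * h y"
  shows "map_poly h (P * Q) = map_poly h P * map_poly h Q"
proof (induction P)
  case (pCons a P)
  have "map_poly h (pCons a R) = pCons (h a) (map_poly h R)" for a R
    by (rule poly_eqI) (simp add: coeff_map_poly assms(1) coeff_pCons split: nat.splits)
  then show ?case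
    by (simp add: mult_pCons_left map_poly_hom_add[OF assms(1,2)] map_poly_hom_smult[OF assms(1,3)] pCons assms(1))
qed simp

definition embY :: "'k::field poly \<Rightarrow> 'k poly poly" where
  "embY q = map_poly (\<lambda>c. [:c:]) q"

lemma coeff_embY [simp]: "coeff (embY q) n = [:coeff q n:]"
  by (simp add: embY_def)

lemma embY_add: "embY (q + r) = embY q + embY r"
  and embY_diff: "embY (q - r) = embY q - embY r"
  and embY_smult: "embY (Polynomial.smult c q) = Polynomial.smult [:c:] (embY q)"
  and embY_0 [simp]: "embY 0 = 0"
  and embY_1 [simp]: "embY 1 = 1"
  by (rule poly_eqI; simp add: coeff_1)+

lemma embY_mult: "embY (q * r) = embY q * embY r"
  unfolding embY_def by (rule map_poly_hom_mult) auto

lemma embY_pCons: "embY (pCons c q) = pCons [:c:] (embY q)"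
  by (rule poly_eqI) (simp add: coeff_pCons split: nat.splits)

lemma embY_monom: "embY (monom c n) = monom [:c:] n"
  by (rule poly_eqI) simp

lemma embY_sum: "embY (sum f A) = (\<Sum>i\<in>A. embY (f i))"
  by (induction A rule: infinite_finite_induct) (auto simp: embY_add)

lemma degree_embY [simp]: "degree (embY q) = degree q"
  unfolding embY_def by (rule degree_map_poly) auto

lemma embY_eq_0_iff [simp]: "embY q = 0 \<longleftrightarrow> q = 0"
  unfolding embY_def by (rule map_poly_eq_0_iff) auto

lemma poly_embY [simp]: "poly (embY q) [:\<rho>:] = [:poly q \<rho>:]"
  by (induction q) (simp_all add: embY_pCons)

text \<open>Used in two ways: as evaluation at a point of maxspec in the two central coordinates,
  and, at a root a of D, as a character of the Ore extension itself.\<close>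

definition eval_xy :: "'k::field \<Rightarrow> 'k \<Rightarrow> 'k poly poly \<Rightarrow> 'k" where
  "eval_xy a \<rho> P = poly (poly P [:\<rho>:]) a"

lemma eval_xy_add [simp]: "eval_xy a \<rho> (P + Q) = eval_xy a \<rho> P + eval_xy a \<rho> Q"
  and eval_xy_diff [simp]: "eval_xy a \<rho> (P - Q) = eval_xy a \<rho> P - eval_xy a \<rho> Q"
  and eval_xy_mult [simp]: "eval_xy a \<rho> (P * Q) = eval_xy a \<rho> P * eval_xy a \<rho> Q"
  and eval_xy_smult [simp]: "eval_xy a \<rho> (Polynomial.smult f Q) = poly f a * eval_xy a \<rho> Q"
  and eval_xy_0 [simp]: "eval_xy a \<rho> 0 = 0"
  and eval_xy_1 [simp]: "eval_xy a \<rho> 1 = 1"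
  and eval_xy_embY [simp]: "eval_xy a \<rho> (embY q) = poly q \<rho>"
  and eval_xy_const [simp]: "eval_xy a \<rho> [:f:] = poly f a"
  by (simp_all add: eval_xy_def)

text \<open>Only the algebra fields of a record scheme are constrained, so the extended record
  \<open>hopf_ore\<close> is an instance as it stands.\<close>

locale ore_hopf =
  fixes H :: "('k::alg_closed_field, 'k poly poly, 'x) module_scheme" (structure)
    and p :: nat and d :: "nat \<Rightarrow> 'k"
  assumes carrier_H [simp]: "carrier H = UNIV"
    and mult_H [simp]: "mult H = ore_mult (ore_deriv p d)"
    and one_H [simp]: "one H = 1"
    and zero_H [simp]: "zero H = 0"
    and add_H [simp]: "add H = (+)"
    and smult_H [simp]: "Module.smult H = (\<lambda>a. Polynomial.smult [:a:])"
    and char_p: "CHAR('k) = p" and p_pos: "p > 0"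
    and finite_d: "finite {s. d s \<noteq> 0}" and d_nz: "\<exists>s. d s \<noteq> 0"
begin

section \<open>Characteristic p and the polynomial D\<close>

lemma prime_p: "prime p"
  using prime_CHAR_semidom[where ?'a = 'k] char_p p_pos by simp

lemma p_ge_2: "p \<ge> 2"
  using prime_p by (rule prime_ge_2_nat)

lemma of_nat_eq_0_iff_p: "of_nat n = (0::'k) \<longleftrightarrow> p dvd n"
  by (simp add: of_nat_eq_0_iff_char_dvd char_p)

lemma of_nat_p [simp]: "of_nat p = (0::'k)"
  by (simp add: of_nat_eq_0_iff_p)

lemma frobenius_add: "(x + y) ^ p = x ^ p + (y::'k) ^ p"
  by (rule freshmans_dream[where ?'a = 'k]) (simp_all only: char_p prime_p)

lemma char_poly_p: "CHAR('k poly) = p"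
proof (rule CHAR_eqI)
  show "of_nat p = (0 :: 'k poly)"
    by (simp add: of_nat_poly)
  show "p dvd n" if "of_nat n = (0 :: 'k poly)" for n
    using that by (simp add: of_nat_poly of_nat_eq_0_iff_p)
qed

lemma frobenius_poly_add: "(f + g) ^ p = f ^ p + (g::'k poly) ^ p"
  by (rule freshmans_dream[where ?'a = "'k poly"]) (simp_all only: char_poly_p prime_p)

lemma minus_one_power_p: "(- 1) ^ p = (- 1 :: 'k)"
  using minus_power_prime_CHAR[of p "1::'k"] by (simp add: char_p prime_p)

lemma linear_power_p: "[:- a, 1:] ^ p = monom 1 p - [:(a::'k) ^ p:]"
proof -
  have "[:- a, 1:] = [:0, 1:] + - [:a:]"
    by simp
  also have "\<dots> ^ p = [:0, 1:] ^ p + (- [:a:]) ^ p"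
    by (rule frobenius_poly_add)
  also have "(- [:a:]) ^ p = - [:a ^ p:]"
    using minus_power_prime_CHAR[of p a, OF char_p[symmetric] prime_p] by (simp add: poly_const_pow)
  finally show ?thesis
    by (simp add: monom_altdef)
qed

definition dp :: "'k poly" where "dp = d_poly p d"
text \<open>This is \<delta>(X_1), by \<open>D_eq\<close>. Separating the term s = 0 shows that its
  derivative is the constant d_0 and that all other terms depend on X^p only.\<close>

definition D :: "'k poly" where "D = [:0, d 0:] + dp \<circ>\<^sub>p monom 1 p"

lemma pcompose_monom_monom: "monom c i \<circ>\<^sub>p monom 1 n = monom (c::'k) (n * i)"
  by (induction i) (simp_all add: monom_0 monom_Suc[of c] pcompose_pCons mult_monom add.commute)

lemma D_eq: "(\<Sum>s | d s \<noteq> 0. monom (d s) (p ^ s)) = D"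
proof -
  have fin: "finite {s. 1 \<le> s \<and> d s \<noteq> 0}"
    by (rule finite_subset[OF _ finite_d]) auto
  have "(\<Sum>s | d s \<noteq> 0. monom (d s) (p ^ s)) = (\<Sum>s\<in>insert 0 {s. 1 \<le> s \<and> d s \<noteq> 0}. monom (d s) (p ^ s))"
    by (rule sum.mono_neutral_left) (use fin in \<open>auto simp: Suc_le_eq\<close>)
  also have "\<dots> = monom (d 0) 1 + (\<Sum>s | 1 \<le> s \<and> d s \<noteq> 0. monom (d s) (p ^ s))"
    using fin by simp
  also have "(\<Sum>s | 1 \<le> s \<and> d s \<noteq> 0. monom (d s) (p ^ s)) = dp \<circ>\<^sub>p monom 1 p"
    unfolding dp_def d_poly_def pcompose_sum
    by (rule sum.cong) (auto simp: pcompose_monom_monom simp flip: power_Suc)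
  finally show ?thesis
    by (simp add: D_def monom_altdef)
qed

text \<open>The exponents p^s are distinct, so no cancellation occurs between the terms.\<close>

lemma D_nz: "D \<noteq> 0"
proof -
  obtain t where t: "d t \<noteq> 0" using d_nz by auto
  have "coeff D (p ^ t) = (\<Sum>s | d s \<noteq> 0. if s = t then d s else 0)"
    unfolding D_eq[symmetric] coeff_sum using p_ge_2 by (intro sum.cong) auto
  also have "\<dots> = d t"
    using finite_d t by simp
  finally show ?thesis using t by auto
qed

lemma poly_D: "poly D x = d 0 * x + poly dp (x ^ p)"
  by (simp add: D_def poly_pcompose poly_monom mult.commute)

lemma pderiv_pcompose_p: "pderiv (f \<circ>\<^sub>p monom (1::'k) p) = 0"
  by (simp add: pderiv_pcompose pderiv_monom)

lemma pderiv_D: "pderiv D = [:d 0:]"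
  by (simp add: D_def pderiv_add pderiv_pcompose_p pderiv_pCons)

lemma ore_deriv_eq: "ore_deriv p d f = D * pderiv f"
  by (simp add: ore_deriv_def D_eq)

sublocale poly_derivation "ore_deriv p d"
  by standard (simp_all add: ore_deriv_eq pderiv_add pderiv_mult algebra_simps)

lemma ring_H: "ring H"
  by (rule ring_oreI) simp_all

sublocale ring H by (rule ring_H)

lemma a_inv_H [simp]: "\<ominus> x = - x"
  by (rule minus_equality) auto

lemma a_minus_H [simp]: "x \<ominus> y = x - y"
  by (simp add: a_minus_def)

abbreviation ore_times (infixl \<open>\<star>\<close> 70) where "P \<star> Q \<equiv> ore_mult (ore_deriv p d) P Q"

lemma der_const [simp]: "ore_deriv p d [:c:] = 0"
  by (simp add: ore_deriv_eq)

lemma ore_embY_right [simp]: "P \<star> embY q = P * embY q"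
  by (rule ore_eq_mult) (rule poly_eqI, simp)

section \<open>Commutators in the Ore extension\<close>

lemma ore_const_right:
  assumes "pderiv f = 0"
  shows "P \<star> [:f:] = Polynomial.smult f P"
  using assms by (simp add: ore_eq_mult ore_deriv_eq)

text \<open>Every correction term carries a factor D. Hence evaluation at a root of D is
  multiplicative, and a quotient in which D vanishes is commutative.\<close>

lemma ore_eq_mult_mod: "\<exists>R. P \<star> Q = P * Q + Polynomial.smult D R"
proof (induction P arbitrary: Q)
  case (pCons f P)
  have "map_poly (ore_deriv p d) Q = Polynomial.smult D (map_poly pderiv Q)"
    by (rule poly_eqI) (simp add: ore_deriv_eq coeff_map_poly)
  then have sh: "shift Q = pCons 0 Q + Polynomial.smult D (map_poly pderiv Q)"
    by (simp add: shift_def)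
  obtain R where "P \<star> shift Q = P * shift Q + Polynomial.smult D R"
    using pCons.IH by blast
  then have "pCons f P \<star> Q = pCons f P * Q + Polynomial.smult D (P * map_poly pderiv Q + R)"
    by (simp add: ore_pCons sh algebra_simps smult_add_right)
  then show ?case by blast
qed (auto intro: exI[of _ 0])

text \<open>The difference quotient ((Y + d_0)^n - Y^n) / d_0, which becomes n Y^{n-1} for d_0 = 0;
  the recursion covers both cases without dividing. The step d_0 comes from X_2 D = D (X_2 +
  d_0).\<close>

primrec commX1_monom :: "nat \<Rightarrow> 'k poly" where
  "commX1_monom 0 = 0"
| "commX1_monom (Suc n) = monom 1 n + [:d 0, 1:] * commX1_monom n"

text \<open>The k[X]-linear extension, so that [P, X_1] = D \<open>commX1 P\<close>.\<close>

definition commX1 :: "'k poly poly \<Rightarrow> 'k poly poly" where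
  "commX1 P = (\<Sum>n\<le>degree P. Polynomial.smult (coeff P n) (embY (commX1_monom n)))"

lemma monom_ore_X1:
  "monom 1 n \<star> X1 = monom [:0, 1:] n + Polynomial.smult D (embY (commX1_monom n))"
proof (induction n)
  case 0
  then show ?case by (simp add: monom_0 X1_def)
next
  case (Suc n)
  have "monom 1 (Suc n) = X2 \<star> monom (1::'k poly) n"
    by (simp add: ore_X2_left shift_monom)
  then have "monom 1 (Suc n) \<star> X1 = shift (monom 1 n \<star> X1)"
    by (simp add: shift_ore ore_X2_left)
  also have "\<dots> = monom [:0, 1:] (Suc n) + monom D n + Polynomial.smult D (shift (embY (commX1_monom n)))
      + Polynomial.smult (Polynomial.smult (d 0) D) (embY (commX1_monom n))"
    by (simp add: Suc shift_add shift_monom shift_smult ore_deriv_eq pderiv_D pderiv_pCons)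
  also have "shift (embY (commX1_monom n)) = pCons 0 (embY (commX1_monom n))"
  proof -
    have "map_poly (ore_deriv p d) (embY (commX1_monom n)) = 0"
      by (rule poly_eqI) simp
    then show ?thesis by (simp add: shift_def)
  qed
  finally show ?case
    by (simp add: embY_add embY_mult embY_pCons embY_monom embY_smult smult_add_right smult_monom
        algebra_simps one_pCons[symmetric])
qed

lemma ore_X1_right: "P \<star> X1 = Polynomial.smult [:0, 1:] P + Polynomial.smult D (commX1 P)"
proof -
  have "P = (\<Sum>n\<le>degree P. Polynomial.smult (coeff P n) (monom 1 n))"
    by (simp add: smult_monom poly_as_sum_of_monoms)
  then have "P \<star> X1 =
      (\<Sum>n\<le>degree P. Polynomial.smult (coeff P n) (monom 1 n)) \<star> X1"
    by simp
  also have "\<dots> = (\<Sum>n\<le>degree P. Polynomial.smult (coeff P n) (monom [:0, 1:] n))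
      + Polynomial.smult D (commX1 P)"
    by (simp add: ore_sum_left ore_smult_left monom_ore_X1 commX1_def sum.distrib smult_add_right
        poly_smult_sum_right mult.commute)
  also have "(\<Sum>n\<le>degree P. Polynomial.smult (coeff P n) (monom [:0, 1:] n)) =
      Polynomial.smult [:0, 1:] (\<Sum>n\<le>degree P. monom (coeff P n) n)"
    by (simp add: poly_smult_sum_right smult_monom mult.commute)
  finally show ?thesis by (simp add: poly_as_sum_of_monoms)
qed

text \<open>In top degree \<open>commX1\<close> behaves like d/dY, which is what detects
  divisibility of degrees by p. For n = 0 the truncated n - 1 is harmless, since
  \<open>commX1_monom 0\<close> is 0.\<close>

lemma degree_commX1_monom: "degree (commX1_monom n) \<le> n - 1" and coeff_commX1_monom: "coeff (commX1_monom n) (n - 1) = of_nat n"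
proof -
  have *: "degree (commX1_monom (Suc n)) \<le> n \<and> coeff (commX1_monom (Suc n)) n = of_nat (Suc n)" for n
  proof (induction n)
    case (Suc n)
    have "degree (monom (1::'k) (Suc n) + [:d 0, 1:] * commX1_monom (Suc n)) \<le> Suc n"
      using Suc degree_mult_le[of "[:d 0, 1:]" "commX1_monom (Suc n)"]
      by (intro degree_add_le) (auto simp: degree_monom_eq)
    moreover have "coeff (commX1_monom (Suc n)) (Suc n) = 0"
      using Suc by (intro coeff_eq_0) linarith
    ultimately show ?case
      using Suc by (simp add: add.commute)
  qed simp
  show "degree (commX1_monom n) \<le> n - 1" "coeff (commX1_monom n) (n - 1) = of_nat n"
    using *[of "n - 1"] by (cases n; simp)+
qed

lemma coeff_commX1_eq_0:
  assumes "n \<ge> degree P"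
  shows "coeff (commX1 P) n = 0"
proof -
  have "Polynomial.smult (coeff (commX1_monom m) n) (coeff P m) = 0" if "m \<le> degree P" for m
  proof (cases "m = 0")
    case False
    then have "coeff (commX1_monom m) n = 0"
      using that assms degree_commX1_monom[of m] by (intro coeff_eq_0) linarith
    then show ?thesis by simp
  qed simp
  then show ?thesis
    by (auto simp: commX1_def coeff_sum intro!: sum.neutral)
qed

lemma coeff_commX1:
  assumes "degree P = Suc n"
  shows "coeff (commX1 P) n = of_nat (Suc n) * lead_coeff P"
proof -
  have *: "coeff P m * [:coeff (commX1_monom m) n:] = 0" if "m \<le> n" for m
  proof (cases "m = 0")
    case False
    then have "coeff (commX1_monom m) n = 0"
      using that degree_commX1_monom[of m] by (intro coeff_eq_0) linarith
    then show ?thesis by simp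
  qed simp
  have "(\<Sum>m\<le>n. Polynomial.smult (coeff (commX1_monom m) n) (coeff P m)) = 0"
    using * by (intro sum.neutral) simp
  moreover have "coeff (commX1_monom (Suc n)) n = of_nat (Suc n)"
    using coeff_commX1_monom[of "Suc n"] by simp
  ultimately show ?thesis
    by (simp add: commX1_def coeff_sum assms of_nat_poly mult.commute del: of_nat_Suc commX1_monom.simps)
qed

lemma commX1_embY: "commX1 (embY q) = embY (\<Sum>n\<le>degree q. Polynomial.smult (coeff q n) (commX1_monom n))"
  by (simp add: commX1_def embY_sum embY_smult)

text \<open>An additive polynomial invariant under Y \<mapsto> Y + d_0; the difference quotient of
  step d_0 therefore kills it.\<close>

definition Q0 :: "'k poly" where "Q0 = monom 1 p - monom (d 0 ^ (p - 1)) 1"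
definition Q :: "'k \<Rightarrow> 'k poly" where "Q \<beta> = Q0 - [:\<beta>:]"

lemma degree_Q0: "degree Q0 = p" and monic_Q0: "lead_coeff Q0 = 1"
proof -
  have "degree (- monom (d 0 ^ (p - 1)) 1) < degree (monom (1::'k) p)"
    using degree_monom_le[of "d 0 ^ (p - 1)" 1] p_ge_2 by (simp add: degree_monom_eq)
  then show *: "degree Q0 = p"
    unfolding Q0_def diff_conv_add_uminus by (subst degree_add_eq_left) (simp_all add: degree_monom_eq)
  show "lead_coeff Q0 = 1"
    unfolding * using p_ge_2 by (simp add: Q0_def)
qed

lemma degree_Q: "degree (Q \<beta>) = p" and monic_Q: "lead_coeff (Q \<beta>) = 1"
proof -
  show *: "degree (Q \<beta>) = p"
    unfolding Q_def diff_conv_add_uminus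
    by (subst degree_add_eq_left) (use degree_Q0 p_pos in auto)
  show "lead_coeff (Q \<beta>) = 1"
    unfolding * using p_pos monic_Q0 by (simp add: Q_def degree_Q0 coeff_pCons split: nat.splits)
qed

text \<open>By Frobenius ((Y + d_0)^p - Y^p) / d_0 = d_0^{p-1}. The case d_0 = 0 is separate because
  the closed form divides by d_0; there both sides vanish, as p \<ge> 2.\<close>

lemma commX1_monom_p: "commX1_monom p = [:d 0 ^ (p - 1):]"
proof (cases "d 0 = 0")
  case True
  have "commX1_monom (Suc n) = monom (of_nat (Suc n)) n" for n
  proof (induction n)
    case (Suc n)
    have "commX1_monom (Suc (Suc n)) = monom 1 (Suc n) + [:d 0, 1:] * commX1_monom (Suc n)"
      by simp
    also have "\<dots> = monom (of_nat (Suc (Suc n))) (Suc n)"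
      unfolding Suc using True by (simp add: add_monom flip: monom_Suc)
    finally show ?case .
  qed (simp add: monom_0 one_pCons)
  from this[of "p - 1"] show ?thesis
    using True p_ge_2 by (simp add: power_0_left)
next
  case False
  have "Polynomial.smult (d 0) (commX1_monom n) = [:d 0, 1:] ^ n - monom 1 n" for n
  proof (induction n)
    case (Suc n)
    have "Polynomial.smult (d 0) (commX1_monom (Suc n)) =
        [:d 0:] * monom 1 n + [:d 0, 1:] * Polynomial.smult (d 0) (commX1_monom n)"
      by (simp add: smult_add_right smult_monom)
    also have "\<dots> = [:d 0, 1:] ^ Suc n - ([:d 0, 1:] - [:d 0:]) * monom 1 n"
      unfolding Suc by (simp only: power_Suc algebra_simps)
    also have "([:d 0, 1:] - [:d 0:]) * monom 1 n = monom 1 (Suc n)"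
      by (simp add: monom_Suc)
    finally show ?case .
  qed (simp add: monom_0)
  \<comment> \<open>The identity (-1)^p = -1 also covers p = 2, where -1 = 1.\<close>
  moreover have "[:d 0, 1:] ^ p - monom 1 p = [:d 0 ^ p:]"
    using linear_power_p[of "- d 0"] by (simp add: minus_one_power_p power_minus[of "d 0" p])
  ultimately have "Polynomial.smult (d 0) (commX1_monom p) = Polynomial.smult (d 0) [:d 0 ^ (p - 1):]"
    using p_pos by (simp add: power_eq_if)
  with False show ?thesis
    by (metis smult_eq_iff)
qed

text \<open>The commutator with X_1 is D times d_0^{p-1} - d_0^{p-1}, the contributions of Y^p and
  of d_0^{p-1} Y. X_2 commutes with polynomials in X_2.\<close>

lemma embY_Q0_central: "embY Q0 \<star> P = P \<star> embY Q0"
proof (rule ore_central)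
  have "commX1 (embY Q0) = 0"
  proof -
    have "(\<Sum>n\<le>degree Q0. Polynomial.smult (coeff Q0 n) (commX1_monom n)) =
        (\<Sum>n\<in>{1, p}. Polynomial.smult (coeff Q0 n) (commX1_monom n))"
      unfolding degree_Q0 using p_ge_2
      by (intro sum.mono_neutral_right) (auto simp: Q0_def)
    also have "\<dots> = 0"
      using p_ge_2 by (auto simp: Q0_def commX1_monom_p numeral_eq_Suc monom_0)
    finally show ?thesis
      by (simp add: commX1_embY)
  qed
  then show "embY Q0 \<star> X1 = X1 \<star> embY Q0"
    by (simp add: ore_X1_right ore_X1_left del: ore_embY_right)
  have "map_poly (ore_deriv p d) (embY Q0) = 0"
    by (rule poly_eqI) simp
  then show "embY Q0 \<star> X2 = X2 \<star> embY Q0"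
    by (simp add: ore_X2_left ore_X2_right shift_def del: ore_embY_right)
qed simp

lemma embY_Q_central: "embY (Q \<beta>) \<star> P = P * embY (Q \<beta>)"
proof -
  have "embY (Q \<beta>) = embY Q0 - [:[:\<beta>:]:]"
    by (simp add: Q_def embY_diff embY_pCons)
  then show ?thesis
    by (simp only: ore_diff_left embY_Q0_central ore_embY_right right_diff_distrib)
      simp
qed

end

section \<open>The center\<close>

context ore_hopf
begin

text \<open>The substitution X \<mapsto> X^p leaves coefficients alone, so it is k-linear, unlike
  the p-th power map. Its image k[X^p] is the kernel of d/dX.\<close>

definition frob :: "'k poly \<Rightarrow> 'k poly" where "frob f = f \<circ>\<^sub>p monom 1 p"

lemma frob_add: "frob (f + g) = frob f + frob g"
  and frob_mult: "frob (f * g) = frob f * frob g"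
  and frob_0 [simp]: "frob 0 = 0"
  and frob_1 [simp]: "frob 1 = 1"
  and frob_const [simp]: "frob [:c:] = [:c:]"
  by (simp_all add: frob_def pcompose_add pcompose_mult pcompose_1)

lemma pderiv_frob [simp]: "pderiv (frob f) = 0"
  by (simp add: frob_def pderiv_pcompose_p)

lemma frob_X: "frob [:0, 1:] = monom 1 p"
  by (simp add: frob_def pcompose_pCons)

lemma frob_sum: "frob (sum f A) = (\<Sum>i\<in>A. frob (f i))"
  by (induction A rule: infinite_finite_induct) (auto simp: frob_add)

lemma frob_eq_0_iff [simp]: "frob f = 0 \<longleftrightarrow> f = 0"
  unfolding frob_def using p_pos by (intro pcompose_eq_0_iff) (simp add: degree_monom_eq)

text \<open>A nonzero coefficient at X^i forces i = 0 in k, hence p divides i.\<close>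

lemma pderiv_eq_0_imp_frob:
  assumes "pderiv f = 0"
  shows "\<exists>g. f = frob g"
proof -
  have "monom (coeff f i) i = frob (monom (coeff f i) (i div p))" for i
  proof (cases "i = 0 \<or> coeff f i = 0")
    case True
    then show ?thesis by (auto simp: monom_0)
  next
    case False
    then obtain j where j: "i = Suc j" by (cases i) auto
    have "coeff (pderiv f) j = of_nat i * coeff f i"
      by (simp add: coeff_pderiv j)
    then have "p dvd i"
      using False assms of_nat_eq_0_iff_p[of i] by simp
    then show ?thesis
      by (simp add: frob_def pcompose_monom_monom)
  qed
  then have "f = (\<Sum>i\<le>degree f. frob (monom (coeff f i) (i div p)))"
    by (simp add: poly_as_sum_of_monoms flip: \<open>\<And>i. monom (coeff f i) i = _\<close>)
  then show ?thesis
    by (metis frob_sum)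
qed

text \<open>The isomorphism from \<open>k[X, Y]\<close> onto the center. It can be written with commutative
  substitutions because elements whose coefficients are killed by \<open>\<delta>\<close> multiply commutatively from
  the right.\<close>

definition center_emb :: "'k poly poly \<Rightarrow> 'k poly poly" where
  "center_emb G = map_poly frob G \<circ>\<^sub>p embY Q0"

lemma center_emb_add: "center_emb (F + G) = center_emb F + center_emb G"
  by (simp add: center_emb_def map_poly_hom_add frob_add pcompose_add)

lemma center_emb_mult: "center_emb (F * G) = center_emb F * center_emb G"
  by (simp add: center_emb_def map_poly_hom_mult frob_add frob_mult pcompose_mult)

lemma center_emb_0 [simp]: "center_emb 0 = 0"
  by (simp add: center_emb_def)

lemma center_emb_const [simp]: "center_emb [:f:] = [:frob f:]"
  by (cases "f = 0") (simp_all add: center_emb_def map_poly_pCons)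

lemma center_emb_1 [simp]: "center_emb 1 = 1"
  using center_emb_const[of 1] by (simp add: one_pCons)

lemma center_emb_minus: "center_emb (- F) = - center_emb F"
  using center_emb_add[of F "- F"] by (simp add: eq_neg_iff_add_eq_0 add.commute)

lemma center_emb_diff: "center_emb (F - G) = center_emb F - center_emb G"
  using center_emb_add[of F "- G"] by (simp add: center_emb_minus)

lemma center_emb_pow: "center_emb (F ^ n) = center_emb F ^ n"
  by (induction n) (simp_all add: center_emb_mult)

lemma center_emb_smult_const: "center_emb (Polynomial.smult [:c:] F) = Polynomial.smult [:c:] (center_emb F)"
  using center_emb_mult[of "[:[:c:]:]" F] by simp

lemma center_emb_embY: "center_emb (embY q) = embY (q \<circ>\<^sub>p Q0)"
proof (induction q)
  case (pCons a q)
  have "center_emb (pCons [:a:] (embY q)) = [:[:a:]:] + embY Q0 * center_emb (embY q)"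
    by (simp add: center_emb_def map_poly_pCons pcompose_pCons)
  with pCons show ?case
    by (simp add: embY_pCons pcompose_pCons embY_add embY_mult)
qed simp

lemma center_emb_pCons: "center_emb (pCons f G) = [:frob f:] + embY Q0 * center_emb G"
  by (simp add: center_emb_def map_poly_pCons pcompose_pCons)

text \<open>Algebraic independence of the two generators: X \<mapsto> X^p and Y \<mapsto>
  \<open>Q0\<close> are substitutions of polynomials of positive degree and so are
  injective.\<close>

lemma center_emb_eq_0_iff [simp]: "center_emb G = 0 \<longleftrightarrow> G = 0"
proof -
  have "map_poly frob G \<circ>\<^sub>p embY Q0 = 0 \<longleftrightarrow> map_poly frob G = 0"
    using p_pos by (intro pcompose_eq_0_iff) (simp add: degree_Q0)
  then show ?thesis
    by (simp add: center_emb_def map_poly_eq_0_iff)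
qed

lemma center_emb_eq_iff [simp]: "center_emb F = center_emb G \<longleftrightarrow> F = G"
  using center_emb_eq_0_iff[of "F - G"] by (simp add: center_emb_diff)

lemma center_emb_central_left: "center_emb G \<star> P = P * center_emb G"
proof (induction G arbitrary: P)
  case (pCons f G)
  have "center_emb (pCons f G) \<star> P = Polynomial.smult (frob f) P + (center_emb G \<star> embY Q0) \<star> P"
    by (simp add: center_emb_pCons ore_add_left mult.commute)
  also have "(center_emb G \<star> embY Q0) \<star> P = P * center_emb G * embY Q0"
    by (simp only: ore_assoc embY_Q0_central) (simp add: pCons ore_assoc[symmetric] mult.assoc)
  finally show ?case
    by (simp add: center_emb_pCons algebra_simps)
qed simp

lemma center_emb_central_right: "P \<star> center_emb G = P * center_emb G"
proof (induction G arbitrary: P)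
  case (pCons f G)
  have "P \<star> (embY Q0 * center_emb G) = P \<star> (embY Q0 \<star> center_emb G)"
    by (simp only: pCons)
  also have "\<dots> = P * embY Q0 * center_emb G"
    by (subst ore_assoc[symmetric]) (simp only: pCons ore_embY_right)
  finally have "P \<star> (embY Q0 * center_emb G) = P * embY Q0 * center_emb G" .
  then show ?case
    by (simp add: center_emb_pCons ore_add_right ore_const_right algebra_simps)
qed simp

lemma alg_center_iff: "P \<in> alg_center H \<longleftrightarrow> (\<forall>R. P \<star> R = R \<star> P)"
  by (simp add: alg_center_def)

lemma center_emb_in_center: "center_emb G \<in> alg_center H"
  by (simp add: alg_center_iff center_emb_central_left center_emb_central_right)

text \<open>Commuting with X_2 puts all coefficients into k[X^p]. Commuting with X_1 makes n times
  the leading coefficient vanish, so p divides the Y-degree n. The leading term is then that of a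
  central element, and subtracting it lowers the degree.\<close>

lemma center_imp_center_emb:
  assumes "P \<in> alg_center H"
  shows "\<exists>G. P = center_emb G"
  using assms
proof (induction "degree P" arbitrary: P rule: less_induct)
  case less
  have comm: "P \<star> R = R \<star> P" for R
    using less.prems by (simp add: alg_center_iff)
  have pd: "pderiv (coeff P n) = 0" for n
  proof -
    have "P \<star> X2 = X2 \<star> P"
      by (rule comm)
    then have "pCons 0 P = shift P"
      by (simp add: ore_X2_left ore_X2_right)
    then have "map_poly (ore_deriv p d) P = 0"
      by (simp add: shift_def)
    then have "ore_deriv p d (coeff P n) = 0"
      by (metis coeff_map_der coeff_0)
    then show ?thesis
      using D_nz by (simp add: ore_deriv_eq)
  qed
  have c0: "commX1 P = 0"
    using comm[of X1] D_nz by (simp add: ore_X1_right ore_X1_left)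
  define n where "n = degree P"
  obtain g where g: "lead_coeff P = frob g"
    using pd pderiv_eq_0_imp_frob by blast
  show ?case
  proof (cases "n = 0")
    case True
    then have "P = [:lead_coeff P:]"
      using degree_0_id[of P] by (simp add: n_def)
    then show ?thesis
      using g by (intro exI[of _ "[:g:]"]) simp
  next
    case False
    then obtain m where m: "degree P = Suc m" by (cases n) (auto simp: n_def)
    have "of_nat (Suc m) * lead_coeff P = 0"
      using coeff_commX1[OF m] c0 by simp
    moreover have "lead_coeff P \<noteq> 0"
      using m by (metis degree_0 leading_coeff_0_iff nat.distinct(1))
    ultimately have "of_nat n = (0::'k)"
      using m by (simp add: of_nat_poly n_def del: of_nat_Suc)
    then obtain j where j: "n = p * j"
      using of_nat_eq_0_iff_p by blast
    \<comment> \<open>\<open>center_emb (monom g j)\<close> is \<open>frob g\<close> times the monic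
      polynomial Q0^j of degree p j = n, so it cancels the leading term of P.\<close>
    define R where "R = P - center_emb (monom g j)"
    have mon: "center_emb (monom g j) = Polynomial.smult (frob g) (embY Q0 ^ j)"
    proof -
      have "center_emb (monom g j) = center_emb [:g:] * center_emb (embY [:0, 1:]) ^ j"
        by (simp only: center_emb_mult[symmetric] center_emb_pow[symmetric])
          (simp add: embY_pCons monom_altdef one_pCons[symmetric])
      then show ?thesis
        by (simp add: center_emb_embY pcompose_pCons)
    qed
    have lc: "lead_coeff (embY Q0 ^ j) = 1"
      using monic_Q0 by (simp add: lead_coeff_power one_pCons[symmetric])
    have deg: "degree (embY Q0 ^ j) = n"
      using p_pos degree_Q0 by (subst degree_power_eq) (auto simp: j)
    have "degree R < n"
    proof -
      have "degree R \<le> n"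
        unfolding R_def mon using deg by (intro degree_diff_le) (auto simp: n_def intro: order.trans[OF degree_smult_le])
      moreover have "coeff R n = 0"
        using lc deg g by (simp add: R_def mon n_def)
      ultimately show ?thesis
        using False by (metis eq_zero_or_degree_less degree_0 gr0I)
    qed
    moreover have "R \<in> alg_center H"
      using comm center_emb_central_left center_emb_central_right
      by (simp add: alg_center_iff R_def ore_diff_left ore_diff_right)
    ultimately obtain G where "R = center_emb G"
      using less.hyps by (auto simp: n_def)
    then have "P = center_emb (G + monom g j)"
      by (simp add: R_def center_emb_add diff_eq_eq)
    then show ?thesis by blast
  qed
qed

lemma center_eq_range: "alg_center H = range center_emb"
  using center_imp_center_emb center_emb_in_center by blast

section \<open>Noncommutativity and the named generators of the center\<close>

lemma H_noncommutative: "X2 \<star> X1 \<noteq> X1 \<star> X2"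
  using D_nz by (simp add: ore_X2_left ore_X2_right X1_def shift_def ore_deriv_eq pderiv_pCons)

lemma pow_const_H: "[:f:] [^] (n::nat) = [:f ^ n:]"
  by (induction n) (simp_all add: one_pCons mult.commute)

lemma pow_X2_H: "X2 [^] (n::nat) = monom 1 n"
  by (induction n) (simp_all add: ore_X2_right monom_Suc)

lemma z1_eq: "z1 H p = [:monom 1 p:]"
  by (simp add: z1_def X1_def pow_const_H monom_altdef)

lemma embY_monom_1: "embY (monom c 1) = Polynomial.smult [:c:] X2"
  by (rule poly_eqI) (auto simp: X2_def coeff_pCons split: nat.splits)

lemma z2_eq: "z2 H p d = embY Q0"
  by (simp add: z2_def pow_X2_H Q0_def embY_diff embY_monom_1[simplified] embY_monom[of _ p]
      one_pCons[symmetric])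

lemma center_emb_varX: "center_emb varX = z1 H p"
  by (simp add: varX_def z1_eq frob_X)

lemma center_emb_varY: "center_emb varY = z2 H p d"
  by (simp add: varY_def z2_eq center_emb_pCons)

end

section \<open>Maximal ideals of the affine plane\<close>

text \<open>f splits into linear factors and primeness selects one of them. The map h allows the
  same argument for polynomials in X and for polynomials in Y.\<close>

lemma linear_factor_in_prime:
  fixes f :: "'k::alg_closed_field poly"
  assumes "f \<noteq> 0" and M_mult: "\<And>F G. F * G \<in> M \<Longrightarrow> F \<in> M \<or> G \<in> M"
    and unit: "\<And>c. c \<noteq> 0 \<Longrightarrow> h [:c:] \<notin> M"
    and h: "\<And>u v. h (u * v) = h u * h v"
    and "h f \<in> (M :: 'b::comm_ring_1 set)"
  shows "\<exists>a. h [:- a, 1:] \<in> M"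
  using assms(1,5)
proof (induction "degree f" arbitrary: f)
  case 0
  then obtain c where "f = [:c:]" "c \<noteq> 0"
    by (metis degree_0_id pCons_0_0)
  with unit 0 show ?case by auto
next
  case (Suc n)
  then obtain a where "poly f a = 0"
    using alg_closed_imp_poly_has_root[of f] by auto
  then obtain g where g: "f = [:- a, 1:] * g"
    by (metis dvdE poly_eq_0_iff_dvd)
  with Suc have "g \<noteq> 0" "degree g = n"
    by (auto simp: degree_mult_eq simp del: mult_pCons_left)
  moreover have "h [:- a, 1:] \<in> M \<or> h g \<in> M"
    using Suc.prems(2) M_mult unfolding g h by blast
  ultimately show ?case
    using Suc.hyps(1) by auto
qed

text \<open>Euclid's argument: over a finite field, 1 plus the product of all X - a has no
  root.\<close>

lemma infinite_alg_closed: "infinite (UNIV :: 'k::alg_closed_field set)"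
proof
  assume fin: "finite (UNIV :: 'k set)"
  define f :: "'k poly" where "f = (\<Prod>a\<in>UNIV. [:- a, 1:]) + 1"
  have lc: "degree (\<Prod>a\<in>UNIV. [:- a, 1 :: 'k:]) = card (UNIV :: 'k set)"
    by (subst degree_prod_sum_eq) (auto simp: fin)
  moreover have "card (UNIV :: 'k set) > 0"
    using fin by (simp add: card_gt_0_iff)
  ultimately have "degree f > 0"
    unfolding f_def by (subst degree_add_eq_left) auto
  then obtain x where "poly f x = 0"
    using alg_closed_imp_poly_has_root by blast
  moreover have "poly (\<Prod>a\<in>UNIV. [:- a, 1 :: 'k:]) x = 0"
    using fin by (auto simp: poly_prod prod_zero_iff)
  ultimately show False
    by (simp add: f_def)
qed

lemma exists_poly_nonzero:
  fixes f :: "'k::alg_closed_field poly"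
  assumes "f \<noteq> 0"
  shows "\<exists>t. poly f t \<noteq> 0"
  using poly_roots_finite[OF assms] infinite_alg_closed[where ?'k = 'k]
  by (metis (mono_tags, lifting) UNIV_eq_I mem_Collect_eq)

text \<open>A nonzero element \<open>F\<close> of \<open>M\<close> of minimal degree in \<open>Y\<close> has degree \<open>0\<close>: otherwise some \<open>X - t\<close>
  that does not divide its leading coefficient would be invertible modulo \<open>M\<close>, and reducing the
  inverse modulo \<open>F\<close> gives a contradiction.\<close>

lemma nullstellensatz_xy:
  fixes M :: "'k::alg_closed_field poly poly set"
  assumes add: "\<And>F G. F \<in> M \<Longrightarrow> G \<in> M \<Longrightarrow> F + G \<in> M"
    and mult: "\<And>F G. F \<in> M \<Longrightarrow> G * F \<in> M"
    and one: "1 \<notin> M"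
    and inverse: "\<And>F. F \<notin> M \<Longrightarrow> \<exists>G. G * F - 1 \<in> M"
  shows "\<exists>\<alpha> \<beta>. [:[:- \<alpha>, 1:]:] \<in> M \<and> [:[:- \<beta>:], 1:] \<in> M"
proof -
  have diff: "F - G \<in> M" if "F \<in> M" "G \<in> M" for F G
    using add[OF that(1) mult[OF that(2), of "- 1"]] by simp
  have zero: "0 \<in> M"
    using mult[of _ 0] inverse one by fastforce
  have const: "[:[:c:]:] \<notin> M" if "c \<noteq> 0" for c
    using mult[of "[:[:c:]:]" "[:[:1 / c:]:]"] one that by (auto simp: one_pCons)
  have prime: "F \<in> M \<or> G \<in> M" if FG: "F * G \<in> M" for F G
  proof (rule ccontr)
    assume "\<not> ?thesis"
    then obtain F' where "F' * F - 1 \<in> M" "G \<notin> M"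
      using inverse by blast
    moreover have "G = F' * (F * G) - G * (F' * F - 1)"
      by (simp add: algebra_simps)
    ultimately show False
      using diff mult FG by metis
  qed
  \<comment> \<open>If M were zero, Y would be a unit of k[X, Y].\<close>
  have "\<exists>F. F \<in> M \<and> F \<noteq> 0"
  proof (rule ccontr)
    assume "\<not> ?thesis"
    then have *: "F \<in> M \<Longrightarrow> F = 0" for F by blast
    have "X2 \<notin> M" using *[of X2] by (auto simp: X2_def)
    then obtain G where "G * X2 - 1 \<in> M"
      using inverse by blast
    then have "G * X2 = 1" using * by fastforce
    moreover have "coeff (G * X2) 0 = 0"
      by (simp add: X2_def coeff_mult_0)
    ultimately show False by simp
  qed
  then obtain F where F: "F \<in> M" "F \<noteq> 0" and min: "\<And>G. G \<in> M \<Longrightarrow> G \<noteq> 0 \<Longrightarrow> degree F \<le> degree G"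
    using ex_has_least_nat[of "\<lambda>F. F \<in> M \<and> F \<noteq> 0" _ degree] by metis
  have deg: "degree F = 0"
  proof (rule ccontr)
    assume pos: "degree F \<noteq> 0"
    obtain t where t: "poly (lead_coeff F) t \<noteq> 0"
      using exists_poly_nonzero[of "lead_coeff F"] F by auto
    have "[:[:- t, 1:]:] \<notin> M"
      using min[of "[:[:- t, 1:]:]"] pos by auto
    then obtain G where G: "G * [:[:- t, 1:]:] - 1 \<in> M"
      using inverse by blast
    obtain A R where AR: "pseudo_divmod G F = (A, R)"
      by fastforce
    define a where "a = lead_coeff F ^ (Suc (degree G) - degree F)"
    have eq: "Polynomial.smult a G = F * A + R" and R: "R = 0 \<or> degree R < degree F"
      using pseudo_divmod[OF F(2) AR] by (simp_all add: a_def)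
    \<comment> \<open>Multiplying the inverse relation by a, the power of the leading coefficient
      used in pseudo-division, allows a G to be replaced by its remainder R. The result has Y-degree
      below that of F and so must vanish; evaluating at t then gives a(t) = 0.\<close>
    have "[:a:] * (G * [:[:- t, 1:]:] - 1) - (A * [:[:- t, 1:]:]) * F \<in> M"
      using diff mult G F(1) by blast
    also have "[:a:] * (G * [:[:- t, 1:]:] - 1) - (A * [:[:- t, 1:]:]) * F
        = (Polynomial.smult a G - F * A) * [:[:- t, 1:]:] - [:a:]"
      by (simp add: algebra_simps smult_diff_right)
    also have "\<dots> = Polynomial.smult [:- t, 1:] R - [:a:]"
      by (simp add: eq)
    finally have mem: "Polynomial.smult [:- t, 1:] R - [:a:] \<in> M" .
    have "degree (Polynomial.smult [:- t, 1:] R - [:a:]) < degree F"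
      using R pos by (intro degree_diff_less) auto
    then have "Polynomial.smult [:- t, 1:] R = [:a:]"
      using min[OF mem] by fastforce
    then have "[:- t, 1:] * coeff R 0 = a"
      by (metis coeff_pCons_0 coeff_smult)
    then have "poly a t = 0"
      by (metis mult_zero_left poly_mult poly_eq_0_iff_dvd dvd_refl)
    then show False
      using t by (simp add: a_def poly_power)
  qed
  have "\<exists>\<alpha>. [:[:- \<alpha>, 1:]:] \<in> M"
    by (rule linear_factor_in_prime[where f = "coeff F 0" and h = "\<lambda>f. [:f:]"])
      (use prime const F degree_0_id[OF deg] in auto)
  then obtain \<alpha> where \<alpha>: "[:[:- \<alpha>, 1:]:] \<in> M" by blast
  \<comment> \<open>Modulo X - \<alpha> everything is a polynomial in Y, so the remaining argument
    is in one variable.\<close>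
  have red: "\<exists>q. F - embY q \<in> M" for F
  proof (induction F)
    case 0
    then show ?case using zero by (intro exI[of _ 0]) simp
  next
    case (pCons f F)
    then obtain q where q: "F - embY q \<in> M" by blast
    obtain g where g: "f - [:poly f \<alpha>:] = [:- \<alpha>, 1:] * g"
      by (metis poly_eq_0_iff_dvd dvdE poly_diff poly_pCons poly_0 mult_zero_right add_0_right right_minus_eq)
    have "pCons f F - embY (pCons (poly f \<alpha>) q) = [:f - [:poly f \<alpha>:]:] + X2 * (F - embY q)"
      by (simp add: X2_def embY_pCons)
    also have "\<dots> = [:g:] * [:[:- \<alpha>, 1:]:] + X2 * (F - embY q)"
      by (simp add: g mult.commute del: mult_pCons_left mult_pCons_right)
         (simp add: mult.commute)
    finally show ?case
      using add[OF mult[OF \<alpha>, of "[:g:]"] mult[OF q, of X2]] by metis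
  qed
  \<comment> \<open>If Y is not in M, its inverse is represented by some q in k[Y], and q Y - 1 is a
    nonzero element of M.\<close>
  have "\<exists>q. q \<noteq> 0 \<and> embY q \<in> M"
  proof (cases "X2 \<in> M")
    case True
    then show ?thesis
      by (intro exI[of _ "[:0, 1:]"]) (simp add: X2_def embY_pCons one_pCons[symmetric])
  next
    case False
    then obtain G where G: "G * X2 - 1 \<in> M"
      using inverse by blast
    obtain q where q: "G - embY q \<in> M" using red by blast
    have "embY (q * [:0, 1:] - 1) = (G * X2 - 1) - X2 * (G - embY q)"
      by (simp add: X2_def embY_diff embY_mult embY_pCons one_pCons[symmetric] algebra_simps)
    then have "embY (q * [:0, 1:] - 1) \<in> M"
      using diff[OF G mult[OF q, of X2]] by simp
    moreover have "q * [:0, 1:] - 1 \<noteq> 0"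
    proof
      assume "q * [:0, 1:] - 1 = 0"
      then have "coeff (q * [:0, 1:]) 0 = coeff 1 0" by simp
      then show False by (simp add: coeff_mult_0)
    qed
    ultimately show ?thesis by blast
  qed
  then obtain q where "q \<noteq> 0" "embY q \<in> M" by blast
  then have "\<exists>\<beta>. embY [:- \<beta>, 1:] \<in> M"
    by (intro linear_factor_in_prime[where f = q and h = embY])
      (use prime const in \<open>auto simp: embY_mult embY_pCons\<close>)
  with \<alpha> show ?thesis
    by (auto simp: embY_pCons one_pCons[symmetric])
qed

section \<open>Quotients of algebras\<close>

text \<open>Transports the ring axioms between record types, as needed for \<open>quot_alg\<close>
  and \<open>module_mat\<close>, which copy the fields of other ring records.\<close>

lemma ring_cong:
  assumes "ring R" "carrier S = carrier R" "mult S = mult R" "one S = one R"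
    "zero S = zero R" "add S = add R"
  shows "ring S"
proof -
  interpret ring R by fact
  show ?thesis
  proof (rule ringI)
    show "abelian_group S"
    proof (rule abelian_groupI)
      fix x assume "x \<in> carrier S"
      then show "\<exists>y\<in>carrier S. y \<oplus>\<^bsub>S\<^esub> x = \<zero>\<^bsub>S\<^esub>"
        using assms(2-) by (intro bexI[of _ "\<ominus>\<^bsub>R\<^esub> x"]) (auto simp: l_neg)
    qed (use assms(2-) in \<open>auto simp: a_ac\<close>)
    show "Group.monoid S"
      by (rule monoidI) (use assms(2-) in \<open>auto simp: m_assoc\<close>)
  qed (use assms(2-) in \<open>auto simp: l_distr r_distr\<close>)
qed

locale kalg = ring A for A :: "('k::field, 'b, 'x) module_scheme" (structure) +
  assumes smult_closed [simp]: "x \<in> carrier A \<Longrightarrow> a \<odot> x \<in> carrier A"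
    and smult_r_distr: "x \<in> carrier A \<Longrightarrow> y \<in> carrier A \<Longrightarrow> a \<odot> (x \<oplus> y) = a \<odot> x \<oplus> a \<odot> y"
    and smult_mult_left: "x \<in> carrier A \<Longrightarrow> y \<in> carrier A \<Longrightarrow> (a \<odot> x) \<otimes> y = a \<odot> (x \<otimes> y)"
begin

text \<open>Since a x = (a 1) x, scalar multiplication is multiplication by a ring element.\<close>

lemma smult_ideal: "ideal I A \<Longrightarrow> x \<in> I \<Longrightarrow> a \<odot> x \<in> I"
  using smult_mult_left[of \<one> x a] ideal.I_l_closed[of I A x "a \<odot> \<one>"] ideal.Icarr[of I A x] by simp

lemma carrier_quot_alg: "carrier (quot_alg A I) = {I +> x |x. x \<in> carrier A}"
  by (auto simp: quot_alg_def FactRing_def A_RCOSETS_defs a_r_coset_def)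

lemma coset_eq_iff:
  assumes "ideal I A" "x \<in> carrier A" "y \<in> carrier A"
  shows "I +> x = I +> y \<longleftrightarrow> x \<ominus> y \<in> I"
  using quotient_eq_iff_same_a_r_cos[OF assms] by auto

context
  fixes I assumes I: "ideal I A"
begin

interpretation ideal I A by (fact I)

lemma quot_alg_mult:
  "x \<in> carrier A \<Longrightarrow> y \<in> carrier A \<Longrightarrow> (I +> x) \<otimes>\<^bsub>quot_alg A I\<^esub> (I +> y) = I +> (x \<otimes> y)"
  by (simp add: quot_alg_def FactRing_def rcoset_mult_add)

lemma quot_alg_add:
  "x \<in> carrier A \<Longrightarrow> y \<in> carrier A \<Longrightarrow> (I +> x) \<oplus>\<^bsub>quot_alg A I\<^esub> (I +> y) = I +> (x \<oplus> y)"
  by (simp add: quot_alg_def FactRing_def a_rcos_sum)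

lemma quot_alg_one: "\<one>\<^bsub>quot_alg A I\<^esub> = I +> \<one>"
  by (simp add: quot_alg_def FactRing_def)

lemma quot_alg_zero: "\<zero>\<^bsub>quot_alg A I\<^esub> = I +> \<zero>"
  by (simp add: quot_alg_def FactRing_def a_r_coset_def r_coset_def)

lemma ring_quot_alg: "ring (quot_alg A I)"
  by (rule ring_cong[OF quotient_is_ring]) (simp_all add: quot_alg_def)

text \<open>All cosets in the union that defines the scalar action are equal.\<close>

lemma quot_alg_smult:
  assumes x: "x \<in> carrier A"
  shows "a \<odot>\<^bsub>quot_alg A I\<^esub> (I +> x) = I +> (a \<odot> x)"
proof -
  have "I +> (a \<odot> y) = I +> (a \<odot> x)" if y: "y \<in> I +> x" for y
  proof -
    obtain i where i: "i \<in> I" "y = i \<oplus> x"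
      using y by (auto simp: a_r_coset_def')
    then have "a \<odot> y = a \<odot> i \<oplus> a \<odot> x"
      using x smult_r_distr Icarr by simp
    moreover have "a \<odot> i \<in> I"
      using i I by (simp add: smult_ideal)
    ultimately show ?thesis
      using x i by (subst coset_eq_iff[OF I]) (auto simp: Icarr a_minus_def a_assoc r_neg)
  qed
  then have "(\<Union>y\<in>I +> x. I +> (a \<odot> y)) = (\<Union>y\<in>I +> x. I +> (a \<odot> x))"
    by (intro SUP_cong) blast+
  moreover have "I +> x \<noteq> {}"
    using a_rcos_self[OF x] by blast
  ultimately show ?thesis
    by (simp add: quot_alg_def)
qed

end

lemma kalg_quot_alg:
  assumes I: "ideal I A"
  shows "kalg (quot_alg A I)"
proof -
  interpret Q: ring "quot_alg A I" using ring_quot_alg[OF I] .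
  show ?thesis
  proof
    fix a X assume "X \<in> carrier (quot_alg A I)"
    then obtain x where x: "x \<in> carrier A" "X = I +> x"
      unfolding carrier_quot_alg by blast
    then have "a \<odot>\<^bsub>quot_alg A I\<^esub> X = I +> (a \<odot> x)"
      by (simp only: quot_alg_smult[OF I])
    with smult_closed[OF x(1), of a] show "a \<odot>\<^bsub>quot_alg A I\<^esub> X \<in> carrier (quot_alg A I)"
      unfolding carrier_quot_alg by blast
    fix Y assume "Y \<in> carrier (quot_alg A I)"
    then obtain y where y: "y \<in> carrier A" "Y = I +> y"
      unfolding carrier_quot_alg by blast
    show "a \<odot>\<^bsub>quot_alg A I\<^esub> (X \<oplus>\<^bsub>quot_alg A I\<^esub> Y) =
        a \<odot>\<^bsub>quot_alg A I\<^esub> X \<oplus>\<^bsub>quot_alg A I\<^esub> a \<odot>\<^bsub>quot_alg A I\<^esub> Y"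
      using x y by (simp only: quot_alg_smult[OF I] quot_alg_add[OF I] a_closed smult_closed smult_r_distr)
    show "a \<odot>\<^bsub>quot_alg A I\<^esub> X \<otimes>\<^bsub>quot_alg A I\<^esub> Y =
        a \<odot>\<^bsub>quot_alg A I\<^esub> (X \<otimes>\<^bsub>quot_alg A I\<^esub> Y)"
      using x y by (simp only: quot_alg_smult[OF I] quot_alg_mult[OF I] m_closed smult_closed smult_mult_left)
  qed
qed

text \<open>The common source of the isomorphisms with the matrix algebra, the truncated polynomial
  algebra, the presented algebra and k[t]. The ideal is given by a membership test, so that each
  application supplies its own description of the kernel.\<close>

lemma first_isomorphism:
  fixes B :: "('k, 'c, 'y) module_scheme"
  assumes B: "ring B" and h: "h \<in> Ring.ring_hom A B" "h ` carrier A = carrier B"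
    and sm: "\<And>a x. x \<in> carrier A \<Longrightarrow> h (a \<odot> x) = a \<odot>\<^bsub>B\<^esub> h x"
    and I: "\<And>x. x \<in> carrier A \<Longrightarrow> h x = \<zero>\<^bsub>B\<^esub> \<longleftrightarrow> x \<in> I" "I \<subseteq> carrier A"
  shows "ideal I A" "\<exists>\<phi>\<in>alg_iso (quot_alg A I) B. \<forall>x\<in>carrier A. \<phi> (I +> x) = h x"
proof -
  interpret hom: ring_hom_ring A B h
    by (rule ring_hom_ringI2[OF ring_axioms B h(1)])
  have ker: "a_kernel A B h = I"
    unfolding a_kernel_def' using I by blast
  show ideal: "ideal I A"
    using hom.kernel_is_ideal ker by simp
  define \<phi> where "\<phi> = (\<lambda>X. the_elem (h ` X))"
  have val: "\<phi> (I +> x) = h x" if "x \<in> carrier A" for x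
    using hom.the_elem_simp[OF that] ker by (simp add: \<phi>_def)
  have "\<phi> \<in> ring_iso (A Quot I) B"
    using hom.FactRing_iso_set[OF h(2)] ker by (simp add: \<phi>_def)
  then have iso: "\<phi> \<in> ring_iso (quot_alg A I) B"
    by (simp add: ring_iso_def Ring.ring_hom_def quot_alg_def)
  have smult: "\<phi> (a \<odot>\<^bsub>quot_alg A I\<^esub> X) = a \<odot>\<^bsub>B\<^esub> \<phi> X"
    if X: "X \<in> carrier (quot_alg A I)" for a X
  proof -
    obtain x where x: "x \<in> carrier A" "X = I +> x"
      using X unfolding carrier_quot_alg by blast
    then show ?thesis
      by (simp only: quot_alg_smult[OF ideal] val smult_closed sm)
  qed
  have "\<phi> \<in> alg_iso (quot_alg A I) B"
    unfolding alg_iso_def using iso smult by blast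
  then show "\<exists>\<phi>\<in>alg_iso (quot_alg A I) B. \<forall>x\<in>carrier A. \<phi> (I +> x) = h x"
    using val by blast
qed

end

lemma kalg_poly2: "kalg (poly2_alg :: ('k::field, 'k poly poly) module)"
proof -
  interpret ring "poly2_alg :: ('k::field, 'k poly poly) module"
  proof (rule ringI)
    show "abelian_group (poly2_alg :: ('k::field, 'k poly poly) module)"
      by (rule abelian_groupI)
        (auto simp: poly2_alg_def add_ac intro: exI[of _ "- x" for x] add.left_inverse)
    show "Group.monoid (poly2_alg :: ('k::field, 'k poly poly) module)"
      by (rule monoidI) (auto simp: poly2_alg_def mult_ac)
  qed (auto simp: poly2_alg_def algebra_simps)
  show ?thesis
    by unfold_locales (auto simp: poly2_alg_def smult_add_right)
qed

definition poly_ideal :: "'a::comm_ring_1 set \<Rightarrow> bool" where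
  "poly_ideal J \<longleftrightarrow> 0 \<in> J \<and> (\<forall>F\<in>J. \<forall>G\<in>J. F + G \<in> J) \<and> (\<forall>F\<in>J. \<forall>G. G * F \<in> J)"

lemma poly_ideal_minus: "poly_ideal J \<Longrightarrow> F \<in> J \<Longrightarrow> - F \<in> J"
  unfolding poly_ideal_def by (metis mult_minus1)

lemma poly_ideal_diff: "poly_ideal J \<Longrightarrow> F \<in> J \<Longrightarrow> G \<in> J \<Longrightarrow> F - G \<in> J"
  using poly_ideal_minus[of J G] unfolding poly_ideal_def by (metis diff_conv_add_uminus)

lemma poly_ideal_span:
  fixes F G :: "'a::comm_ring_1"
  shows "poly_ideal {A * F + B * G |A B. True}"
proof -
  have add: "(A * F + B * G) + (A' * F + B' * G) = (A + A') * F + (B + B') * G" for A B A' B'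
    by (simp add: algebra_simps)
  have mult: "C * (A * F + B * G) = (C * A) * F + (C * B) * G" for A B C
    by (simp add: algebra_simps)
  have "0 = 0 * F + 0 * G" by simp
  then show ?thesis
    unfolding poly_ideal_def mem_Collect_eq Ball_def using add mult by blast
qed

text \<open>Expansion at the point: X - \<alpha> and Y - \<beta> generate the kernel of evaluation.
  Dividing by Y - \<beta> and then dividing the constant coefficient by X - \<alpha> gives the
  cofactors.\<close>

lemma eval_xy_decomp: "\<exists>A B. G = [:[:eval_xy \<alpha> \<beta> G:]:] + A * [:[:- \<alpha>, 1:]:] + B * embY [:- \<beta>, 1:]"
proof -
  have root: "\<exists>g. f = [:poly f c:] + [:- c, 1:] * g" for f :: "'c::comm_ring_1 poly" and c
  proof -
    have "poly (f - [:poly f c:]) c = 0" by simp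
    then obtain g where "f - [:poly f c:] = [:- c, 1:] * g"
      by (metis poly_eq_0_iff_dvd dvdE)
    then show ?thesis
      by (metis add.commute diff_add_cancel)
  qed
  obtain B where B: "G = [:poly G [:\<beta>:]:] + [:- [:\<beta>:], 1:] * B"
    using root by blast
  obtain g where g: "poly G [:\<beta>:] = [:eval_xy \<alpha> \<beta> G:] + [:- \<alpha>, 1:] * g"
    unfolding eval_xy_def using root by blast
  have "[:poly G [:\<beta>:]:] = [:[:eval_xy \<alpha> \<beta> G:]:] + [:g:] * [:[:- \<alpha>, 1:]:]"
    by (subst g) (simp add: mult.commute)
  with B show ?thesis
    by (intro exI[of _ "[:g:]"] exI[of _ B]) (simp add: embY_pCons one_pCons[symmetric] mult.commute)
qed

section \<open>Points of the center and their fibres\<close>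

context ore_hopf
begin

section \<open>The center as k[X, Y] and its maximal spectrum\<close>

abbreviation "Z \<equiv> center_alg H"

lemma Z_simps [simp]:
  "carrier Z = range center_emb" "mult Z = ore_mult (ore_deriv p d)" "one Z = 1" "zero Z = 0" "add Z = (+)"
  "Module.smult Z = (\<lambda>a. Polynomial.smult [:a:])"
  by (simp_all add: center_alg_def center_eq_range)

lemma center_emb_ore: "center_emb F \<star> center_emb G = center_emb (F * G)"
  by (simp add: center_emb_central_right center_emb_mult)

lemma cring_Z: "cring Z"
proof (rule cringI)
  show "abelian_group Z"
  proof (rule abelian_groupI)
    fix x assume "x \<in> carrier Z"
    then obtain F where "x = center_emb F" by auto
    then show "\<exists>y\<in>carrier Z. y \<oplus>\<^bsub>Z\<^esub> x = \<zero>\<^bsub>Z\<^esub>"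
      by (intro bexI[of _ "center_emb (- F)"]) (auto simp flip: center_emb_add)
  next
    show "\<zero>\<^bsub>Z\<^esub> \<in> carrier Z"
      by (metis Z_simps(1,4) center_emb_0 rangeI)
  qed (auto simp: add_ac simp flip: center_emb_add)
  show "Group.comm_monoid Z"
  proof (rule comm_monoidI)
    show "\<one>\<^bsub>Z\<^esub> \<in> carrier Z"
      by (metis Z_simps(1,3) center_emb_1 rangeI)
  qed (auto simp: center_emb_ore mult_ac ore_assoc)
qed (auto simp: ore_add_left)

sublocale Z: cring Z by (rule cring_Z)

lemma a_inv_Z: "\<ominus>\<^bsub>Z\<^esub> center_emb F = center_emb (- F)"
  by (rule Z.minus_equality) (auto simp flip: center_emb_add)

lemma pow_Z: "center_emb F [^]\<^bsub>Z\<^esub> (n::nat) = center_emb (F ^ n)"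
  by (induction n) (simp_all add: center_emb_ore mult.commute)

lemma pow_H: "center_emb F [^] (n::nat) = center_emb (F ^ n)"
  by (induction n) (simp_all add: center_emb_ore mult.commute)

lemma center_emb_alg_iso: "center_emb \<in> alg_iso poly2_alg Z"
  by (auto simp: alg_iso_def ring_iso_def Ring.ring_hom_def poly2_alg_def center_emb_add center_emb_ore center_emb_smult_const
      bij_betw_def inj_on_def)

text \<open>Moves questions about ideals of the center to k[X, Y], where type-class algebra is
  available.\<close>

lemma ideal_Z_iff: "ideal I Z \<longleftrightarrow> (\<exists>J. poly_ideal J \<and> I = center_emb ` J)"
proof
  assume "ideal I Z"
  then interpret ideal I Z .
  let ?J = "{F. center_emb F \<in> I}"
  have "I = center_emb ` ?J"
    using a_subset by (auto simp: image_iff)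
  moreover have "poly_ideal ?J"
    unfolding poly_ideal_def
    using zero_closed a_closed I_l_closed by (auto simp: center_emb_add simp flip: center_emb_ore)
  ultimately show "\<exists>J. poly_ideal J \<and> I = center_emb ` J" by blast
next
  assume "\<exists>J. poly_ideal J \<and> I = center_emb ` J"
  then obtain J where J: "poly_ideal J" and I: "I = center_emb ` J" by blast
  show "ideal I Z"
  proof (rule idealI)
    show "ring Z" by (rule Z.ring_axioms)
    show "subgroup I (add_monoid Z)"
    proof
      show "\<one>\<^bsub>add_monoid Z\<^esub> \<in> I"
        using J center_emb_0 by (force simp: I poly_ideal_def image_iff)
      fix x assume "x \<in> I"
      then obtain F where F: "F \<in> J" "x = center_emb F" using I by blast
      have "inv\<^bsub>add_monoid Z\<^esub> x = center_emb (- F)"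
        using a_inv_Z[of F] F by (simp add: a_inv_def)
      then show "inv\<^bsub>add_monoid Z\<^esub> x \<in> I"
        using J F by (simp add: I poly_ideal_minus)
    qed (use J in \<open>auto simp: I poly_ideal_def simp flip: center_emb_add\<close>)
  qed (use J in \<open>auto simp: I poly_ideal_def center_emb_ore mult.commute\<close>)
qed

text \<open>The ideal \<mm> of the point in the form of a kernel of evaluation, which makes
  membership decidable by computing a value; \<open>point_ideal_eq\<close> gives the agreement with
  the generated ideal.\<close>

definition pt :: "'k \<Rightarrow> 'k \<Rightarrow> 'k poly poly set" where
  "pt \<alpha> \<beta> = center_emb ` {G. eval_xy \<alpha> \<beta> G = 0}"

lemma center_emb_in_pt [simp]: "center_emb G \<in> pt \<alpha> \<beta> \<longleftrightarrow> eval_xy \<alpha> \<beta> G = 0"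
  by (auto simp: pt_def)

text \<open>An element outside the ideal is congruent modulo it to a nonzero constant, so any
  strictly larger ideal contains 1.\<close>

lemma maximal_pt: "maximalideal (pt \<alpha> \<beta>) Z"
proof (rule maximalidealI)
  show "ideal (pt \<alpha> \<beta>) Z"
    unfolding ideal_Z_iff pt_def by (rule exI, rule conjI, rule _ refl) (auto simp: poly_ideal_def)
  show "carrier Z \<noteq> pt \<alpha> \<beta>"
    using center_emb_in_pt[of 1 \<alpha> \<beta>] by (auto simp del: center_emb_in_pt center_emb_1)
  fix K assume "ideal K Z" and sub: "pt \<alpha> \<beta> \<subseteq> K"
  then obtain J where J: "poly_ideal J" and K: "K = center_emb ` J"
    using ideal_Z_iff by blast
  show "K = pt \<alpha> \<beta> \<or> K = carrier Z"
  proof (rule disjCI)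
    assume "K \<noteq> carrier Z"
    then have one: "1 \<notin> J"
      using J K unfolding poly_ideal_def by force
    have "eval_xy \<alpha> \<beta> G = 0" if "G \<in> J" for G
    proof (rule ccontr)
      let ?c = "eval_xy \<alpha> \<beta> G"
      assume c: "?c \<noteq> 0"
      have "center_emb (G - [:[:?c:]:]) \<in> K"
        by (rule subsetD[OF sub]) simp
      then have "G - [:[:?c:]:] \<in> J"
        using K by auto
      then have "G - (G - [:[:?c:]:]) \<in> J"
        using J that poly_ideal_diff by blast
      moreover have "G - (G - [:[:?c:]:]) = [:[:?c:]:]"
        by simp
      ultimately have "[:[:1 / ?c:]:] * [:[:?c:]:] \<in> J"
        using J unfolding poly_ideal_def by metis
      with c one show False by (simp add: one_pCons[symmetric])
    qed
    then show "K = pt \<alpha> \<beta>"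
      using sub by (auto simp: K)
  qed
qed

text \<open>Maximality supplies inverses modulo M, which is the hypothesis of
  \<open>nullstellensatz_xy\<close>. The ideal of the resulting point is contained in m, and its own
  maximality gives equality.\<close>

lemma maximal_imp_pt:
  assumes "maximalideal m Z"
  shows "\<exists>\<alpha> \<beta>. m = pt \<alpha> \<beta>"
proof -
  interpret maximalideal m Z by fact
  obtain M where M: "poly_ideal M" and m: "m = center_emb ` M"
    using is_ideal ideal_Z_iff by blast
  have one: "1 \<notin> M"
  proof
    assume "1 \<in> M"
    then have "G \<in> M" for G
      using M unfolding poly_ideal_def by (metis mult.right_neutral)
    then show False
      using I_notcarr by (auto simp: m)
  qed
  have "\<exists>\<alpha> \<beta>. [:[:- \<alpha>, 1:]:] \<in> M \<and> [:[:- \<beta>:], 1:] \<in> M"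
  proof (rule nullstellensatz_xy[OF _ _ one])
    fix F assume F: "F \<notin> M"
    \<comment> \<open>The ideal generated by M and F; it must contain 1, and the cofactor of F is
      the inverse sought.\<close>
    let ?J = "{G. \<exists>A. G - A * F \<in> M}"
    have J: "poly_ideal ?J"
      unfolding poly_ideal_def
    proof (intro conjI ballI allI)
      show "0 \<in> ?J"
        using M by (auto simp: poly_ideal_def intro: exI[of _ 0])
      fix G G' assume "G \<in> ?J" "G' \<in> ?J"
      then obtain A A' where AA: "G - A * F \<in> M" "G' - A' * F \<in> M" by blast
      then have "(G - A * F) + (G' - A' * F) \<in> M"
        using M unfolding poly_ideal_def by blast
      then show "G + G' \<in> ?J"
        by (intro CollectI exI[of _ "A + A'"]) (simp add: algebra_simps)
    next
      fix G B assume "G \<in> ?J"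
      then obtain A where "G - A * F \<in> M" by blast
      then have "B * (G - A * F) \<in> M"
        using M unfolding poly_ideal_def by blast
      then show "B * G \<in> ?J"
        by (intro CollectI exI[of _ "B * A"]) (simp add: algebra_simps)
    qed
    have "center_emb ` ?J = m \<or> center_emb ` ?J = carrier Z"
    proof (rule I_maximal)
      show "ideal (center_emb ` ?J) Z"
        using J ideal_Z_iff by blast
      show "m \<subseteq> center_emb ` ?J"
        unfolding m by (rule image_mono) (auto intro: exI[of _ 0])
    qed auto
    moreover have "F \<in> ?J"
      using M by (auto simp: poly_ideal_def intro: exI[of _ 1])
    then have "center_emb F \<in> center_emb ` ?J" by (rule imageI)
    moreover have "center_emb F \<notin> m"
      using F by (auto simp: m)
    ultimately have "center_emb ` ?J = carrier Z"
      by blast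
    then have "1 \<in> ?J"
      by (metis (no_types, lifting) Z_simps(1) center_emb_eq_iff image_iff rangeI)
    then obtain A where "1 - A * F \<in> M" by blast
    then show "\<exists>G. G * F - 1 \<in> M"
      using poly_ideal_minus[OF M] by fastforce
  qed (use M in \<open>auto simp: poly_ideal_def\<close>)
  then obtain \<alpha> \<beta> where ab: "[:[:- \<alpha>, 1:]:] \<in> M" "embY [:- \<beta>, 1:] \<in> M"
    by (auto simp: embY_pCons one_pCons[symmetric])
  have "{G. eval_xy \<alpha> \<beta> G = 0} \<subseteq> M"
  proof
    fix G assume "G \<in> {G. eval_xy \<alpha> \<beta> G = 0}"
    then obtain A B where "G = A * [:[:- \<alpha>, 1:]:] + B * embY [:- \<beta>, 1:]"
      using eval_xy_decomp[of G \<alpha> \<beta>] by auto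
    then show "G \<in> M"
      using M ab unfolding poly_ideal_def by blast
  qed
  then have "pt \<alpha> \<beta> \<subseteq> m"
    by (auto simp: pt_def m)
  then have "m = pt \<alpha> \<beta> \<or> m = carrier Z"
    using is_ideal a_subset maximalideal.I_maximal[OF maximal_pt] by blast
  then show ?thesis
    using I_notcarr by blast
qed

lemma maxspec_Z: "maxspec Z = {pt \<alpha> \<beta> |\<alpha> \<beta>. True}"
  using maximal_pt maximal_imp_pt by (auto simp: maxspec_def)

lemma Idl_Z_span: "Idl\<^bsub>Z\<^esub> {center_emb F, center_emb G} = center_emb ` {A * F + B * G |A B. True}"
proof
  have "ideal (center_emb ` {A * F + B * G |A B. True}) Z"
    using poly_ideal_span ideal_Z_iff by blast
  moreover have "F \<in> {A * F + B * G |A B. True}" "G \<in> {A * F + B * G |A B. True}"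
    by (auto intro: exI[of _ 0] exI[of _ 1])
  ultimately show "Idl\<^bsub>Z\<^esub> {center_emb F, center_emb G} \<subseteq> center_emb ` {A * F + B * G |A B. True}"
    by (intro Z.genideal_minimal) auto
  have "ideal (Idl\<^bsub>Z\<^esub> {center_emb F, center_emb G}) Z"
    by (rule Z.genideal_ideal) auto
  then obtain J where J: "poly_ideal J" "Idl\<^bsub>Z\<^esub> {center_emb F, center_emb G} = center_emb ` J"
    using ideal_Z_iff by blast
  moreover have "{center_emb F, center_emb G} \<subseteq> Idl\<^bsub>Z\<^esub> {center_emb F, center_emb G}"
    by (rule Z.genideal_self) auto
  ultimately have "F \<in> J" "G \<in> J"
    by auto
  with J have "{A * F + B * G |A B. True} \<subseteq> J"
    unfolding poly_ideal_def by blast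
  then show "center_emb ` {A * F + B * G |A B. True} \<subseteq> Idl\<^bsub>Z\<^esub> {center_emb F, center_emb G}"
    unfolding J(2) by (rule image_mono)
qed

section \<open>The ideal of a point and the fibre over it\<close>

lemma z1_minus: "z1 H p \<ominus> (\<alpha> \<odot> \<one>) = center_emb [:[:- \<alpha>, 1:]:]"
  by (simp add: z1_eq frob_def pcompose_pCons)

lemma center_emb_embY_linear: "center_emb (embY [:- \<beta>, 1:]) = embY (Q \<beta>)"
proof -
  have "[:- \<beta>, 1:] \<circ>\<^sub>p Q0 = Q \<beta>"
    by (rule poly_eqI) (simp add: pcompose_pCons Q_def coeff_pCons split: nat.splits)
  then show ?thesis
    by (simp only: center_emb_embY)
qed

lemma z2_minus: "z2 H p d \<ominus> (\<beta> \<odot> \<one>) = center_emb (embY [:- \<beta>, 1:])"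
  unfolding center_emb_embY_linear by (simp add: z2_eq Q_def embY_diff embY_pCons)

lemma point_ideal_eq: "point_ideal H p d \<alpha> \<beta> = pt \<alpha> \<beta>"
proof -
  have "{A * [:[:- \<alpha>, 1:]:] + B * embY [:- \<beta>, 1:] |A B. True} = {G. eval_xy \<alpha> \<beta> G = 0}"
  proof (intro equalityI subsetI CollectI)
    fix G assume "G \<in> {G. eval_xy \<alpha> \<beta> G = 0}"
    then have "eval_xy \<alpha> \<beta> G = 0" by simp
    then show "\<exists>A B. G = A * [:[:- \<alpha>, 1:]:] + B * embY [:- \<beta>, 1:] \<and> True"
      using eval_xy_decomp[of G \<alpha> \<beta>] by simp
  next
    fix G assume "G \<in> {A * [:[:- \<alpha>, 1:]:] + B * embY [:- \<beta>, 1:] |A B. True}"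
    then obtain A B where "G = A * [:[:- \<alpha>, 1:]:] + B * embY [:- \<beta>, 1:]" by blast
    then show "eval_xy \<alpha> \<beta> G = 0"
      by (simp only: eval_xy_add eval_xy_mult eval_xy_const eval_xy_embY) simp
  qed
  then show ?thesis
    unfolding point_ideal_def z1_minus z2_minus Idl_Z_span pt_def by simp
qed

definition fib_ideal :: "'k \<Rightarrow> 'k \<Rightarrow> 'k poly poly set" where
  "fib_ideal \<alpha> \<beta> = {A * [:monom 1 p - [:\<alpha>:]:] + B * embY (Q \<beta>) |A B. True}"

lemma poly_ideal_fib: "poly_ideal (fib_ideal \<alpha> \<beta>)"
  unfolding fib_ideal_def by (rule poly_ideal_span)

lemma fib_ideal_I [intro]:
  "A * [:monom 1 p - [:\<alpha>:]:] \<in> fib_ideal \<alpha> \<beta>" "B * embY (Q \<beta>) \<in> fib_ideal \<alpha> \<beta>"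
  unfolding fib_ideal_def by (rule CollectI, rule exI[of _ A], rule exI[of _ 0], simp)
    (rule CollectI, rule exI[of _ 0], rule exI[of _ B], simp)

lemma fib_ideal_add: "F \<in> fib_ideal \<alpha> \<beta> \<Longrightarrow> G \<in> fib_ideal \<alpha> \<beta> \<Longrightarrow> F + G \<in> fib_ideal \<alpha> \<beta>"
  and fib_ideal_0 [simp]: "0 \<in> fib_ideal \<alpha> \<beta>"
  using poly_ideal_fib[of \<alpha> \<beta>] by (auto simp: poly_ideal_def)

lemmas fib_ideal_diff = poly_ideal_diff[OF poly_ideal_fib]
lemmas fib_ideal_minus = poly_ideal_minus[OF poly_ideal_fib]

lemma const_p_ore: "[:monom 1 p - [:\<alpha>:]:] \<star> P = P * [:monom 1 p - [:\<alpha>:]:]"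
  and ore_const_p: "P \<star> [:monom 1 p - [:\<alpha>:]:] = P * [:monom 1 p - [:\<alpha>:]:]"
  by (simp_all add: mult.commute[of P] ore_const_right pderiv_diff pderiv_monom)

text \<open>Commutative multiples of the two generators are their Ore multiples from the right, so P
  only acts on the cofactors. For the right-hand version the central generators are first moved past
  P.\<close>

lemma fib_ideal_ore_left:
  assumes "F \<in> fib_ideal \<alpha> \<beta>"
  shows "P \<star> F \<in> fib_ideal \<alpha> \<beta>"
proof -
  obtain A B where F: "F = A * [:monom 1 p - [:\<alpha>:]:] + B * embY (Q \<beta>)"
    using assms by (auto simp: fib_ideal_def)
  have "P \<star> F = P \<star> (A \<star> [:monom 1 p - [:\<alpha>:]:]) + P \<star> (B \<star> embY (Q \<beta>))"
    by (simp only: F ore_add_right ore_const_p ore_embY_right)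
  also have "\<dots> = (P \<star> A) * [:monom 1 p - [:\<alpha>:]:] + (P \<star> B) * embY (Q \<beta>)"
    by (simp only: ore_assoc[symmetric]) (simp only: ore_const_p ore_embY_right)
  finally show ?thesis
    by (simp only: fib_ideal_add fib_ideal_I)
qed

lemma fib_ideal_ore_right:
  assumes "F \<in> fib_ideal \<alpha> \<beta>"
  shows "F \<star> P \<in> fib_ideal \<alpha> \<beta>"
proof -
  obtain A B where F: "F = A * [:monom 1 p - [:\<alpha>:]:] + B * embY (Q \<beta>)"
    using assms by (auto simp: fib_ideal_def)
  have "F \<star> P = (A \<star> [:monom 1 p - [:\<alpha>:]:]) \<star> P + (B \<star> embY (Q \<beta>)) \<star> P"
    by (simp only: F ore_add_left ore_const_p ore_embY_right)
  also have "\<dots> = A \<star> (P \<star> [:monom 1 p - [:\<alpha>:]:]) + B \<star> (P \<star> embY (Q \<beta>))"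
    by (simp only: ore_assoc const_p_ore embY_Q_central) (simp only: ore_const_p ore_embY_right)
  also have "\<dots> = (A \<star> P) * [:monom 1 p - [:\<alpha>:]:] + (B \<star> P) * embY (Q \<beta>)"
    by (simp only: ore_assoc[symmetric]) (simp only: ore_const_p ore_embY_right)
  finally show ?thesis
    by (simp only: fib_ideal_add fib_ideal_I)
qed

lemma ideal_fib: "ideal (fib_ideal \<alpha> \<beta>) H"
proof (rule idealI)
  show "ring H" by (rule ring_H)
  show "subgroup (fib_ideal \<alpha> \<beta>) (add_monoid H)"
  proof
    fix x assume "x \<in> fib_ideal \<alpha> \<beta>"
    then show "inv\<^bsub>add_monoid H\<^esub> x \<in> fib_ideal \<alpha> \<beta>"
      using a_inv_H[of x] by (simp add: a_inv_def fib_ideal_minus del: a_inv_H)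
  qed (auto intro: fib_ideal_add)
qed (auto intro: fib_ideal_ore_left fib_ideal_ore_right)

lemma kalg_H: "kalg H"
  by unfold_locales (auto simp: ore_smult_left smult_add_right)

sublocale kalg H by (rule kalg_H)

text \<open>\<open>center_emb\<close> sends X - \<alpha> and Y - \<beta> to X^p - \<alpha> and
  \<open>Q \<beta>\<close>; a central generator times A is the commutative multiple by A.\<close>

lemma pt_prod: "ideal_prod H (pt \<alpha> \<beta>) (carrier H) = fib_ideal \<alpha> \<beta>"
proof
  have frob_lin: "frob [:- \<alpha>, 1:] = monom 1 p - [:\<alpha>:]"
    by (simp add: frob_def pcompose_pCons)
  show "ideal_prod H (pt \<alpha> \<beta>) (carrier H) \<subseteq> fib_ideal \<alpha> \<beta>"
  proof
    fix x assume "x \<in> ideal_prod H (pt \<alpha> \<beta>) (carrier H)"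
    then show "x \<in> fib_ideal \<alpha> \<beta>"
    proof induction
      case (prod i j)
      then obtain G where G: "i = center_emb G" "eval_xy \<alpha> \<beta> G = 0"
        by (auto simp: pt_def)
      then obtain A B where "G = A * [:[:- \<alpha>, 1:]:] + B * embY [:- \<beta>, 1:]"
        using eval_xy_decomp[of G \<alpha> \<beta>] by auto
      then have "i = center_emb A * [:monom 1 p - [:\<alpha>:]:] + center_emb B * embY (Q \<beta>)"
        by (simp only: G center_emb_add center_emb_mult center_emb_embY_linear center_emb_const frob_lin)
      then have "i \<in> fib_ideal \<alpha> \<beta>"
        by (simp only: fib_ideal_add fib_ideal_I)
      then show ?case
        by (auto intro: fib_ideal_ore_right)
    qed (auto intro: fib_ideal_add)
  qed
  show "fib_ideal \<alpha> \<beta> \<subseteq> ideal_prod H (pt \<alpha> \<beta>) (carrier H)"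
  proof
    fix x assume "x \<in> fib_ideal \<alpha> \<beta>"
    then obtain A B where x: "x = A * [:monom 1 p - [:\<alpha>:]:] + B * embY (Q \<beta>)"
      by (auto simp: fib_ideal_def)
    have "center_emb [:[:- \<alpha>, 1:]:] \<otimes> A \<in> ideal_prod H (pt \<alpha> \<beta>) (carrier H)"
      by (rule ideal_prod.prod) (simp_all only: center_emb_in_pt, simp_all)
    moreover have "center_emb (embY [:- \<beta>, 1:]) \<otimes> B \<in> ideal_prod H (pt \<alpha> \<beta>) (carrier H)"
      by (rule ideal_prod.prod) (simp_all only: center_emb_in_pt, simp_all)
    ultimately have "center_emb [:[:- \<alpha>, 1:]:] \<otimes> A \<oplus> center_emb (embY [:- \<beta>, 1:]) \<otimes> B
        \<in> ideal_prod H (pt \<alpha> \<beta>) (carrier H)"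
      by (rule ideal_prod.sum)
    also have "center_emb [:[:- \<alpha>, 1:]:] \<otimes> A \<oplus> center_emb (embY [:- \<beta>, 1:]) \<otimes> B = x"
      by (simp only: center_emb_const frob_lin center_emb_embY_linear mult_H add_H const_p_ore embY_Q_central x)
    finally show "x \<in> ideal_prod H (pt \<alpha> \<beta>) (carrier H)" .
  qed
qed

lemma fibre_eq: "fibre H (point_ideal H p d \<alpha> \<beta>) = quot_alg H (fib_ideal \<alpha> \<beta>)"
  "fibre H (pt \<alpha> \<beta>) = quot_alg H (fib_ideal \<alpha> \<beta>)"
  by (simp_all only: fibre_def point_ideal_eq pt_prod)

end

section \<open>The Azumaya locus\<close>

lemma ring_module_mat: "ring (module_mat TYPE('a::comm_ring_1) n n)"
  by (rule ring_cong[OF ring_mat[of n "()"]])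
    (simp_all add: ring_mat_def module_mat_def)

text \<open>A matrix algebra is a prime ring: with B the matrix unit at (j, i), the entry of N B N
  at (i, j) is the square of that of N.\<close>

lemma mat_prime:
  fixes N :: "'a::field mat"
  assumes N: "N \<in> carrier_mat n n" and nz: "N \<noteq> 0\<^sub>m n n"
  shows "\<exists>B\<in>carrier_mat n n. N * B * N \<noteq> 0\<^sub>m n n"
proof -
  obtain i j where ij: "i < n" "j < n" "N $$ (i, j) \<noteq> 0"
  proof (rule ccontr)
    assume "\<not> thesis"
    with that have "N = 0\<^sub>m n n"
      using N by (intro eq_matI) auto
    with nz show False by simp
  qed
  define B where "B = mat n n (\<lambda>(r, s). if r = j \<and> s = i then 1 else (0::'a))"
  have B: "B \<in> carrier_mat n n" by (simp add: B_def)
  have "(N * B) $$ (i, k) = (if k = i then N $$ (i, j) else 0)" if "k < n" for k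
  proof -
    have "(N * B) $$ (i, k) = (\<Sum>r\<in>{0..<n}. N $$ (i, r) * (if r = j \<and> k = i then 1 else 0))"
      using N B ij that by (simp add: scalar_prod_def B_def)
    also have "\<dots> = (\<Sum>r\<in>{0..<n}. if r = j then (if k = i then N $$ (i, j) else 0) else 0)"
      by (intro sum.cong) auto
    finally show ?thesis using ij by simp
  qed
  moreover define M where "M = N * B"
  ultimately have Mi: "M $$ (i, k) = (if k = i then N $$ (i, j) else 0)" if "k < n" for k
    using that by simp
  have M: "M \<in> carrier_mat n n" using N B by (simp add: M_def)
  have "(M * N) $$ (i, j) = (\<Sum>k\<in>{0..<n}. (if k = i then N $$ (i, j) else 0) * N $$ (k, j))"
    using N M ij by (simp add: scalar_prod_def Mi)
  also have "\<dots> = (\<Sum>k\<in>{0..<n}. if k = i then N $$ (i, j) * N $$ (i, j) else 0)"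
    by (intro sum.cong) auto
  also have "\<dots> \<noteq> 0" using ij by simp
  finally have "N * B * N \<noteq> 0\<^sub>m n n" using ij by (auto simp: M_def)
  with B show ?thesis by blast
qed

lemma degree_map_poly_le: "f 0 = 0 \<Longrightarrow> degree (map_poly f P) \<le> degree P"
  by (rule degree_le) (simp add: coeff_map_poly coeff_eq_0)

section \<open>Normal forms in a fibre\<close>

context ore_hopf
begin

definition nf :: "'k poly poly \<Rightarrow> bool" where
  "nf R \<longleftrightarrow> degree R < p \<and> (\<forall>j. degree (coeff R j) < p)"

lemma degree_pm: "degree (monom 1 p - [:\<alpha>::'k:]) = p"
  unfolding diff_conv_add_uminus using p_pos by (subst degree_add_eq_left) (auto simp: degree_monom_eq)

lemma map_mod_decomp:
  "(P :: 'k poly poly) = map_poly (\<lambda>f. f mod m) P + map_poly (\<lambda>f. f div m) P * [:m:]"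
  by (rule poly_eqI) (simp add: coeff_map_poly)

lemma degree_mod_pm: "degree (f mod (monom 1 p - [:\<alpha>::'k:])) < p"
  using degree_mod_less[of "monom 1 p - [:\<alpha>:]" f] degree_pm[of \<alpha>] p_pos by fastforce

lemma nf_exists: "\<exists>R. nf R \<and> P - R \<in> fib_ideal \<alpha> \<beta>"
proof -
  define m where "m = monom 1 p - [:\<alpha>:]"
  have Qnz: "embY (Q \<beta>) \<noteq> 0"
    using degree_Q[of \<beta>] p_pos by auto
  obtain A R where AR: "pseudo_divmod P (embY (Q \<beta>)) = (A, R)" by fastforce
  \<comment> \<open>Monicity makes pseudo-division a genuine division with remainder in Y; the
    coefficients are reduced modulo X^p - \<alpha> afterwards.\<close>
  have "lead_coeff (embY (Q \<beta>)) = 1"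
    using monic_Q[of \<beta>] by (simp add: one_pCons[symmetric])
  then have eq: "P = embY (Q \<beta>) * A + R" and R: "R = 0 \<or> degree R < p"
    using pseudo_divmod[OF Qnz AR] degree_Q by simp_all
  define S where "S = map_poly (\<lambda>f. f mod m) R"
  have "P - S = map_poly (\<lambda>f. f div m) R * [:m:] + A * embY (Q \<beta>)"
    unfolding eq S_def by (subst (1) map_mod_decomp[of R m]) (simp add: mult.commute)
  then have "P - S \<in> fib_ideal \<alpha> \<beta>"
    unfolding m_def by (simp only: fib_ideal_add fib_ideal_I)
  moreover have "degree S < p"
    using R p_pos degree_map_poly_le[of "\<lambda>f. f mod m" R] by (auto simp: S_def)
  then have "nf S"
    by (simp add: nf_def S_def coeff_map_poly m_def degree_mod_pm)
  ultimately show ?thesis by blast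
qed

text \<open>The cofactor of \<open>Q \<beta>\<close> is first reduced modulo X^p - \<alpha>, which
  keeps all X-degrees of its product below p. Then the multiple of X^p - \<alpha> must vanish by
  X-degree, and the multiple of \<open>Q \<beta>\<close> by Y-degree.\<close>

lemma nf_unique:
  assumes "R \<in> fib_ideal \<alpha> \<beta>" "nf R"
  shows "R = 0"
proof -
  define m where "m = monom 1 p - [:\<alpha>:]"
  obtain A B where R: "R = A * [:m:] + B * embY (Q \<beta>)"
    using assms(1) by (auto simp: fib_ideal_def m_def)
  define B1 where "B1 = map_poly (\<lambda>f. f mod m) B"
  define A1 where "A1 = A + map_poly (\<lambda>f. f div m) B * embY (Q \<beta>)"
  have R1: "R = A1 * [:m:] + B1 * embY (Q \<beta>)"
    unfolding R A1_def B1_def by (subst map_mod_decomp[of B m]) (simp add: algebra_simps)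
  have "A1 = 0"
  proof (rule poly_eqI)
    fix n
    have "degree (coeff B1 i * [:coeff (Q \<beta>) j:]) < p" for i j
      using degree_mod_pm[of "coeff B i" \<alpha>]
      by (auto simp: B1_def coeff_map_poly m_def mult.commute intro: le_less_trans[OF degree_smult_le])
    then have "degree (coeff (B1 * embY (Q \<beta>)) n) < p"
      unfolding coeff_mult coeff_embY using p_pos by (intro degree_sum_less)
    moreover have "degree (coeff R n) < p"
      using assms(2) by (simp add: nf_def)
    ultimately have "degree (coeff R n - coeff (B1 * embY (Q \<beta>)) n) < p"
      by (intro degree_diff_less)
    also have "coeff R n - coeff (B1 * embY (Q \<beta>)) n = coeff A1 n * m"
      unfolding R1 by (simp add: mult.commute)
    finally have "degree (coeff A1 n * m) < p" .
    then show "coeff A1 n = coeff 0 n"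
    proof -
      have "m \<noteq> 0"
        using degree_pm[of \<alpha>] p_pos by (auto simp: m_def)
      then show ?thesis
        using \<open>degree (coeff A1 n * m) < p\<close> degree_pm[of \<alpha>]
        by (cases "coeff A1 n = 0") (auto simp: degree_mult_eq m_def)
    qed
  qed
  then have RB: "R = B1 * embY (Q \<beta>)" using R1 by simp
  moreover have "B1 = 0"
  proof (rule ccontr)
    assume "B1 \<noteq> 0"
    moreover have "embY (Q \<beta>) \<noteq> 0"
      using degree_Q[of \<beta>] p_pos by auto
    ultimately have "degree R = degree B1 + p"
      using RB by (simp add: degree_mult_eq degree_Q)
    then show False using assms(2) by (simp add: nf_def)
  qed
  ultimately show ?thesis using RB by simp
qed

section \<open>The representation of dimension p\<close>

definition evX :: "'k \<Rightarrow> 'k poly poly \<Rightarrow> 'k poly" where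
  "evX a P = map_poly (\<lambda>f. poly f a) P"

lemma coeff_evX [simp]: "coeff (evX a P) n = poly (coeff P n) a"
  by (simp add: evX_def coeff_map_poly)

lemma evX_add: "evX a (P + R) = evX a P + evX a R"
  and evX_diff: "evX a (P - R) = evX a P - evX a R"
  and evX_smult: "evX a (Polynomial.smult f P) = Polynomial.smult (poly f a) (evX a P)"
  and evX_embY [simp]: "evX a (embY q) = q"
  and evX_0 [simp]: "evX a 0 = 0"
  by (rule poly_eqI; simp)+

lemma evX_mult: "evX a (P * R) = evX a P * evX a R"
  unfolding evX_def by (rule map_poly_hom_mult) auto

lemma evX_eq_0_imp: "evX a P = 0 \<Longrightarrow> \<exists>S. P = Polynomial.smult [:- a, 1:] S"
proof -
  assume "evX a P = 0"
  then have "poly (coeff P n) a = 0" for n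
    by (metis coeff_0 coeff_evX)
  then have "coeff P n = [:- a, 1:] * (coeff P n div [:- a, 1:])" for n
    by (metis poly_eq_0_iff_dvd dvd_mult_div_cancel)
  then have "P = Polynomial.smult [:- a, 1:] (map_poly (\<lambda>f. f div [:- a, 1:]) P)"
    by (intro poly_eqI) (simp only: coeff_smult coeff_map_poly div_0)
  then show ?thesis by blast
qed

text \<open>The right module \<open>H / (X\<^sub>1 - a) H\<close>, identified with \<open>k[Y]\<close>. Its reduction modulo the
  central polynomial \<open>Q \<beta>\<close> is a representation of dimension \<open>p\<close>.\<close>

definition act :: "'k \<Rightarrow> 'k poly \<Rightarrow> 'k poly poly \<Rightarrow> 'k poly" where
  "act a v P = evX a (embY v \<star> P)"

text \<open>Well-definedness of the action: the kernel of \<open>evX a\<close> is (X_1 - a) H, which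
  is a right ideal.\<close>

lemma act_evX: "act a (evX a R) P = evX a (R \<star> P)"
proof -
  have "evX a (R - embY (evX a R)) = 0"
    by (simp add: evX_diff)
  then obtain S where "R - embY (evX a R) = Polynomial.smult [:- a, 1:] S"
    using evX_eq_0_imp by blast
  then have "evX a ((R - embY (evX a R)) \<star> P) = 0"
    by (simp add: ore_smult_left evX_smult)
  then show ?thesis
    by (simp add: ore_diff_left evX_diff act_def)
qed

lemma act_act: "act a (act a v P) R = act a v (P \<star> R)"
  unfolding act_def[of a v] act_evX by (simp add: ore_assoc)

lemma act_add_left: "act a (v + w) P = act a v P + act a w P"
  and act_add_right: "act a v (P + R) = act a v P + act a v R"
  and act_smult_left: "act a (Polynomial.smult c v) P = Polynomial.smult c (act a v P)"
  and act_0_left [simp]: "act a 0 P = 0"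
  and act_0_right [simp]: "act a v 0 = 0"
  and act_const_left: "act a [:c:] P = Polynomial.smult c (evX a P)"
  by (simp_all add: act_def embY_add embY_smult ore_add_left ore_add_right ore_smult_left evX_add
      evX_smult embY_pCons)

lemma ore_smult_const_right: "P \<star> Polynomial.smult [:c:] R = Polynomial.smult [:c:] (P \<star> R)"
proof -
  have "P \<star> Polynomial.smult [:c:] R = P \<star> ([:[:c:]:] \<star> R)"
    by simp
  also have "\<dots> = Polynomial.smult [:c:] (P \<star> R)"
    by (simp only: ore_assoc[symmetric])
      (simp add: ore_const_right ore_smult_left pderiv_pCons)
  finally show ?thesis .
qed

lemma act_smult_right: "act a v (Polynomial.smult [:c:] P) = Polynomial.smult c (act a v P)"
  by (simp add: act_def ore_smult_const_right evX_smult)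

lemma act_sum_left: "act a (sum f A) P = (\<Sum>i\<in>A. act a (f i) P)"
  by (induction A rule: infinite_finite_induct) (auto simp: act_add_left)

lemma act_embY [simp]: "act a v (embY q) = v * q"
  by (simp add: act_def flip: embY_mult)

text \<open>Centrality of \<open>Q \<beta>\<close> makes its multiples in k[Y] a submodule, so the
  action descends to remainders modulo \<open>Q \<beta>\<close>.\<close>

lemma act_Q: "act a (v * Q \<beta>) P = act a v P * Q \<beta>"
proof -
  have "embY (v * Q \<beta>) \<star> P = embY v \<star> (embY (Q \<beta>) \<star> P)"
    by (simp only: ore_assoc[symmetric] ore_embY_right embY_mult)
  also have "\<dots> = embY v \<star> (P \<star> embY (Q \<beta>))"
    by (simp only: embY_Q_central ore_embY_right)
  also have "\<dots> = (embY v \<star> P) * embY (Q \<beta>)"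
    by (simp only: ore_assoc[symmetric]) (simp only: ore_embY_right)
  finally show ?thesis
    by (simp add: act_def evX_mult)
qed

lemma act_mod: "act a (v mod Q \<beta>) P mod Q \<beta> = act a v P mod Q \<beta>"
proof -
  have "act a v P = act a (v div Q \<beta> * Q \<beta> + v mod Q \<beta>) P"
    by simp
  also have "\<dots> = act a (v div Q \<beta>) P * Q \<beta> + act a (v mod Q \<beta>) P"
    by (simp only: act_add_left act_Q)
  finally show ?thesis by simp
qed

text \<open>Row i holds the image of Y^i. With images as rows, a right action is multiplicative
  without reversing the order of factors.\<close>

definition rep :: "'k \<Rightarrow> 'k \<Rightarrow> 'k poly poly \<Rightarrow> 'k mat" where
  "rep a \<beta> P = mat p p (\<lambda>(i, j). coeff (act a (monom 1 i) P mod Q \<beta>) j)"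

lemma rep_carrier [simp]: "rep a \<beta> P \<in> carrier_mat p p"
  "dim_row (rep a \<beta> P) = p" "dim_col (rep a \<beta> P) = p"
  by (simp_all add: rep_def)

lemma rep_index: "i < p \<Longrightarrow> j < p \<Longrightarrow> rep a \<beta> P $$ (i, j) = coeff (act a (monom 1 i) P mod Q \<beta>) j"
  by (simp add: rep_def)

lemma mod_Q_small: "degree v < p \<Longrightarrow> v mod Q \<beta> = v"
  by (simp add: mod_poly_less degree_Q)

lemma mod_Q_sum: "v mod Q \<beta> = (\<Sum>j\<in>{0..<p}. Polynomial.smult (coeff (v mod Q \<beta>) j) (monom 1 j))"
proof -
  have "degree (v mod Q \<beta>) \<le> p - 1"
    using degree_mod_less[of "Q \<beta>" v] degree_Q[of \<beta>] p_pos by fastforce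
  then have "v mod Q \<beta> = (\<Sum>j\<le>p - 1. monom (coeff (v mod Q \<beta>) j) j)"
    by (rule poly_as_sum_of_monoms'[symmetric])
  also have "{..p - 1} = {0..<p}" using p_pos by auto
  finally show ?thesis by (simp add: smult_monom)
qed

lemma mod_sum_poly: "sum f A mod (m::'k poly) = (\<Sum>i\<in>A. f i mod m)"
  by (induction A rule: infinite_finite_induct) (auto simp: poly_mod_add_left)

lemma rep_mult: "rep a \<beta> (P \<star> R) = rep a \<beta> P * rep a \<beta> R"
proof (rule eq_matI)
  fix i l assume "i < dim_row (rep a \<beta> P * rep a \<beta> R)" "l < dim_col (rep a \<beta> P * rep a \<beta> R)"
  then have il: "i < p" "l < p" by simp_all
  define w where "w = act a (monom 1 i) P mod Q \<beta>"
  have "act a (monom 1 i) (P \<star> R) mod Q \<beta> = act a w R mod Q \<beta>"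
    by (simp add: w_def act_mod act_act)
  also have "\<dots> = (\<Sum>j\<in>{0..<p}. Polynomial.smult (coeff w j) (act a (monom 1 j) R mod Q \<beta>))"
    unfolding w_def by (subst (1) mod_Q_sum) (simp only: act_sum_left act_smult_left mod_sum_poly mod_smult_left)
  finally show "rep a \<beta> (P \<star> R) $$ (i, l) = (rep a \<beta> P * rep a \<beta> R) $$ (i, l)"
    using il by (simp add: rep_index scalar_prod_def coeff_sum w_def)
qed auto

lemma rep_one: "rep a \<beta> 1 = 1\<^sub>m p"
proof (rule eq_matI)
  fix i j assume "i < dim_row (1\<^sub>m p :: 'k mat)" "j < dim_col (1\<^sub>m p :: 'k mat)"
  then show "rep a \<beta> 1 $$ (i, j) = 1\<^sub>m p $$ (i, j)"
    by (simp add: rep_index act_def mod_Q_small degree_monom_eq)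
qed auto

lemma rep_add: "rep a \<beta> (P + R) = rep a \<beta> P + rep a \<beta> R"
  by (rule eq_matI) (auto simp: rep_index act_add_right poly_mod_add_left)

lemma rep_smult: "rep a \<beta> (Polynomial.smult [:c:] P) = c \<cdot>\<^sub>m rep a \<beta> P"
  by (rule eq_matI) (auto simp: rep_index act_smult_right mod_smult_left)

lemma rep_0: "rep a \<beta> 0 = 0\<^sub>m p p"
  by (rule eq_matI) (auto simp: rep_index)

lemma rep_fib_ideal:
  assumes "a ^ p = \<alpha>" "P \<in> fib_ideal \<alpha> \<beta>"
  shows "rep a \<beta> P = 0\<^sub>m p p"
proof -
  obtain A B where P: "P = A \<star> [:monom 1 p - [:\<alpha>:]:] + B \<star> embY (Q \<beta>)"
    using assms(2) unfolding fib_ideal_def ore_const_p ore_embY_right by blast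
  have "act a v P mod Q \<beta> = 0" for v
  proof -
    have "act a v (A \<star> [:monom 1 p - [:\<alpha>:]:]) = evX a ((embY v \<star> A) * [:monom 1 p - [:\<alpha>:]:])"
      unfolding act_def by (simp only: ore_assoc[symmetric]) (simp only: ore_const_p)
    also have "\<dots> = 0"
      using assms(1) by (simp add: evX_smult poly_monom)
    finally have 1: "act a v (A \<star> [:monom 1 p - [:\<alpha>:]:]) = 0" .
    have "act a v (B \<star> embY (Q \<beta>)) = act a v B * Q \<beta>"
      by (simp only: act_act[symmetric] act_embY)
    with 1 show ?thesis
      by (simp add: P act_add_right del: ore_embY_right)
  qed
  then show ?thesis
    by (intro eq_matI) (auto simp: rep_index)
qed

text \<open>The nilpotent \<open>X\<^sub>1 - a\<close> acts as \<open>D(a)\<close> times a difference operator, which lowers degrees by one.\<close>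

lemma act_linear_power:
  assumes "degree v \<le> i"
  shows "act a v [:[:- a, 1:] ^ i:] = [:poly D a ^ i * of_nat (fact i) * coeff v i:]"
  using assms
proof (induction i arbitrary: v)
  case 0
  then obtain c where v: "v = [:c:]"
    by (metis degree_0_id le_zero_eq)
  have "[:[:- a, 1:] ^ 0:] = (1 :: 'k poly poly)" "evX a 1 = 1"
    using evX_embY[of a 1] by (simp_all add: one_pCons[symmetric])
  then show ?case
    by (simp add: v act_const_left one_pCons[symmetric])
next
  case (Suc i)
  define w where "w = evX a (commX1 (embY v))"
  have "act a v [:[:- a, 1:]:] = Polynomial.smult (poly D a) w"
  proof -
    have "embY v \<star> [:[:- a, 1:]:] = embY v \<star> (X1 - [:[:a:]:])"
      by (simp add: X1_def)
    also have "\<dots> = Polynomial.smult [:- a, 1:] (embY v) + Polynomial.smult D (commX1 (embY v))"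
      by (simp add: ore_diff_right ore_X1_right ore_const_right pderiv_pCons) (simp flip: smult_diff_left)
    finally show ?thesis
      by (simp add: act_def evX_add evX_smult w_def)
  qed
  moreover have "degree w \<le> i"
  proof (rule degree_le, intro allI impI)
    fix j assume "i < j"
    then show "coeff w j = 0"
      using Suc.prems by (simp add: w_def coeff_commX1_eq_0)
  qed
  moreover have "coeff w i = of_nat (Suc i) * coeff v (Suc i)"
  proof (cases "degree v = Suc i")
    case True
    then show ?thesis
      using coeff_commX1[of "embY v" i] by (simp add: w_def of_nat_poly del: of_nat_Suc)
  next
    case False
    then have "degree v \<le> i" using Suc.prems by simp
    then show ?thesis
      by (simp add: w_def coeff_commX1_eq_0 coeff_eq_0)
  qed
  ultimately have "act a (act a v [:[:- a, 1:]:]) [:[:- a, 1:] ^ i:] =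
      [:poly D a ^ Suc i * of_nat (fact (Suc i)) * coeff v (Suc i):]"
    by (simp add: act_smult_left Suc.IH algebra_simps)
  then show ?case
    by (simp only: act_act ore_const_left) (simp only: smult_pCons smult_0_right power_Suc)
qed

section \<open>Faithfulness and density when D does not vanish at a\<close>

lemma fact_nonzero: "i < p \<Longrightarrow> of_nat (fact i) \<noteq> (0::'k)"
  unfolding of_nat_eq_0_iff_p prime_dvd_fact_iff[OF prime_p] by (simp only: not_le)

text \<open>Extracts the largest common power of X - a from the coefficients. The bound by the
  degree of the leading coefficient gives i < p for a normal form.\<close>

lemma factor_linear_power:
  assumes "R \<noteq> 0"
  shows "\<exists>i S. R = Polynomial.smult ([:- a, 1:] ^ i) S \<and> evX a S \<noteq> 0 \<and> i \<le> degree (lead_coeff R)"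
  using assms
proof (induction "degree (lead_coeff R)" arbitrary: R rule: less_induct)
  case less
  show ?case
  proof (cases "evX a R = 0")
    case False
    then show ?thesis by (intro exI[of _ 0] exI[of _ R]) simp
  next
    case True
    then obtain T where T: "R = Polynomial.smult [:- a, 1:] T"
      using evX_eq_0_imp by blast
    then have T0: "T \<noteq> 0" using less.prems by auto
    have deg: "degree (lead_coeff R) = Suc (degree (lead_coeff T))"
      using T0 unfolding T by (simp add: lead_coeff_smult degree_mult_eq del: mult_pCons_left)
    then obtain i S where "T = Polynomial.smult ([:- a, 1:] ^ i) S" "evX a S \<noteq> 0" "i \<le> degree (lead_coeff T)"
      using less.hyps[OF _ T0] by auto
    then show ?thesis
      using T deg by (intro exI[of _ "Suc i"] exI[of _ S]) (simp del: mult_pCons_left)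
  qed
qed

text \<open>For R = (X - a)^i S, the factor (X - a)^i sends Y^i to the nonzero scalar i! D(a)^i, so
  R sends Y^i to that multiple of S(a, Y). This is nonzero of degree below p and survives reduction
  modulo \<open>Q \<beta>\<close>.\<close>

lemma rep_nf_inj:
  assumes e: "poly D a \<noteq> 0" and R: "nf R" "rep a \<beta> R = 0\<^sub>m p p"
  shows "R = 0"
proof (rule ccontr)
  assume "R \<noteq> 0"
  then obtain i S where RS: "R = Polynomial.smult ([:- a, 1:] ^ i) S" and S: "evX a S \<noteq> 0"
    and i: "i \<le> degree (lead_coeff R)"
    using factor_linear_power by blast
  have ip: "i < p" using i R(1) unfolding nf_def by (meson le_less_trans)
  define c where "c = poly D a ^ i * of_nat (fact i)"
  have c: "c \<noteq> 0" using e fact_nonzero[OF ip] by (simp add: c_def)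
  have "R = [:[:- a, 1:] ^ i:] \<star> S" by (simp add: RS)
  then have "act a (monom 1 i) R = act a (act a (monom 1 i) [:[:- a, 1:] ^ i:]) S"
    by (simp only: act_act)
  also have "\<dots> = Polynomial.smult c (evX a S)"
    by (simp add: act_linear_power degree_monom_le act_const_left c_def)
  finally have *: "act a (monom 1 i) R = Polynomial.smult c (evX a S)" .
  have "degree R = degree S" by (simp add: RS)
  then have "degree (evX a S) < p"
    using R(1) degree_map_poly_le[of "\<lambda>f. poly f a" S] by (simp add: nf_def evX_def)
  then have "act a (monom 1 i) R mod Q \<beta> = Polynomial.smult c (evX a S)"
    using * c by (simp add: mod_Q_small)
  moreover have "coeff (act a (monom 1 i) R mod Q \<beta>) j = 0" if "j < p" for j
    using rep_index[OF ip that, of a \<beta> R] R(2) ip that by simp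
  ultimately have "coeff (evX a S) j = 0" if "j < p" for j
    using c that by simp
  then have "lead_coeff (evX a S) = 0"
    using \<open>degree (evX a S) < p\<close> .
  with S show False by (simp only: leading_coeff_0_iff)
qed

text \<open>Elimination by rows: matrices whose first m rows vanish are treated by descending
  induction on m, starting from the zero matrix at m = p.\<close>

lemma rep_surj:
  assumes e: "poly D a \<noteq> 0" and T: "T \<in> carrier_mat p p"
  shows "\<exists>P. rep a \<beta> P = T"
proof -
  have "\<exists>P. rep a \<beta> P = T"
    if "m \<le> p" "T \<in> carrier_mat p p" "\<forall>i<m. \<forall>j<p. T $$ (i, j) = 0" for m T
    using that
  proof (induction m arbitrary: T rule: inc_induct)
    case base
    then have "rep a \<beta> 0 = T"
      by (intro eq_matI) (auto simp: rep_0)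
    then show ?case by blast
  next
    case (step m)
    define c where "c = poly D a ^ m * of_nat (fact m)"
    have c: "c \<noteq> 0" using e fact_nonzero[OF step.hyps(2)] by (simp add: c_def)
    define q where "q = (\<Sum>j\<in>{0..<p}. monom (T $$ (m, j)) j)"
    have coeff_q: "coeff q j = (if j < p then T $$ (m, j) else 0)" for j
      by (simp add: q_def coeff_sum)
    have "degree q \<le> p - 1"
      by (rule degree_le) (auto simp: coeff_q)
    then have deg_q: "degree q < p" using p_pos by linarith
    \<comment> \<open>(X - a)^m kills Y^i for i < m and sends Y^m to the scalar c. Hence P leaves
      the rows above m zero and produces exactly row m of T.\<close>
    define P where "P = [:[:- a, 1:] ^ m:] \<star> embY (Polynomial.smult (1 / c) q)"
    have act: "act a (monom 1 i) P = (if i = m then q else 0)" if "i \<le> m" for i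
    proof -
      have "act a (monom 1 i) P =
          act a (act a (monom 1 i) [:[:- a, 1:] ^ m:]) (embY (Polynomial.smult (1 / c) q))"
        by (simp only: P_def act_act)
      also have "act a (monom 1 i) [:[:- a, 1:] ^ m:] = [:if i = m then c else 0:]"
        using that by (subst act_linear_power) (auto simp: c_def intro: order.trans[OF degree_monom_le])
      finally show ?thesis using c by (auto simp only: act_embY) auto
    qed
    have "\<exists>P'. rep a \<beta> P' = T - rep a \<beta> P"
    proof (rule step.IH)
      show "T - rep a \<beta> P \<in> carrier_mat p p" by (rule minus_carrier_mat) simp
      show "\<forall>i<Suc m. \<forall>j<p. (T - rep a \<beta> P) $$ (i, j) = 0"
        using step act deg_q by (auto simp: less_Suc_eq rep_index mod_Q_small coeff_q)
    qed
    then obtain P' where "rep a \<beta> P' = T - rep a \<beta> P" by blast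
    then have "rep a \<beta> (P + P') = T"
      using step.prems by (intro eq_matI) (auto simp: rep_add)
    then show ?case by blast
  qed
  from this[of 0 T] T show ?thesis by simp
qed

lemma azumaya_fibre:
  assumes a: "a ^ p = \<alpha>" and e: "poly D a \<noteq> 0"
  shows "quot_alg H (fib_ideal \<alpha> \<beta>) \<cong>\<^sub>k module_mat TYPE('k) p p"
proof -
  have "\<exists>\<phi>\<in>alg_iso (quot_alg H (fib_ideal \<alpha> \<beta>)) (module_mat TYPE('k) p p).
      \<forall>x\<in>carrier H. \<phi> (fib_ideal \<alpha> \<beta> +> x) = rep a \<beta> x"
  proof (rule first_isomorphism(2)[OF ring_module_mat])
    show "rep a \<beta> \<in> Ring.ring_hom H (module_mat TYPE('k) p p)"
      by (auto simp: Ring.ring_hom_def module_mat_simps rep_mult rep_add rep_one)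
    show "rep a \<beta> ` carrier H = carrier (module_mat TYPE('k) p p)"
      using rep_surj[OF e, of _ \<beta>] by (force simp: module_mat_simps image_iff)
    show "rep a \<beta> x = \<zero>\<^bsub>module_mat TYPE('k) p p\<^esub> \<longleftrightarrow> x \<in> fib_ideal \<alpha> \<beta>" for x
    proof
      assume 0: "rep a \<beta> x = \<zero>\<^bsub>module_mat TYPE('k) p p\<^esub>"
      obtain R where R: "nf R" "x - R \<in> fib_ideal \<alpha> \<beta>"
        using nf_exists by blast
      have "rep a \<beta> ((x - R) + R) = rep a \<beta> (x - R) + rep a \<beta> R"
        by (rule rep_add)
      then have "rep a \<beta> R = 0\<^sub>m p p"
        using 0 rep_fib_ideal[OF a R(2)] by (simp add: module_mat_simps)
      then have "R = 0" using rep_nf_inj[OF e R(1)] by blast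
      then show "x \<in> fib_ideal \<alpha> \<beta>" using R(2) by simp
    qed (simp add: rep_fib_ideal[OF a] module_mat_simps)
  qed (auto simp: rep_smult module_mat_simps)
  then show ?thesis
    by (auto simp: alg_isomorphic_def)
qed

section \<open>Failure of the Azumaya property at the roots of D\<close>

lemma ore_smult_dvd:
  assumes "f dvd ore_deriv p d f"
  shows "\<exists>S. P \<star> Polynomial.smult f R = Polynomial.smult f S"
proof (induction P arbitrary: R)
  case 0
  then show ?case by (intro exI[of _ 0]) simp
next
  case (pCons g P)
  obtain h where h: "ore_deriv p d f = f * h" using assms by blast
  have "shift (Polynomial.smult f R) = Polynomial.smult f (shift R + Polynomial.smult h R)"
    by (simp add: shift_smult h smult_add_right)
  with pCons.IH obtain S where "P \<star> shift (Polynomial.smult f R) = Polynomial.smult f S"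
    by metis
  then have "pCons g P \<star> Polynomial.smult f R = Polynomial.smult f (Polynomial.smult g R + S)"
    by (simp add: ore_pCons smult_add_right mult.commute)
  then show ?case by blast
qed

text \<open>X - a divides D, which restores the factor lost by differentiation. By
  \<open>ore_smult_dvd\<close> the powers f of X_1 - a then satisfy H f \<subseteq> f H.\<close>

lemma linear_power_dvd_deriv:
  assumes "poly D a = 0"
  shows "[:- a, 1:] ^ m dvd ore_deriv p d ([:- a, 1:] ^ m)"
proof (cases m)
  case (Suc n)
  obtain h where "D = [:- a, 1:] * h"
    using assms by (metis poly_eq_0_iff_dvd dvdE)
  moreover have "pderiv ([:- a, 1:] ^ m) = [:- a, 1:] ^ n * [:of_nat m:]"
    unfolding Suc pderiv_power_Suc by (simp add: pderiv_pCons del: of_nat_Suc)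
  ultimately have "ore_deriv p d ([:- a, 1:] ^ m) = [:- a, 1:] ^ m * (h * [:of_nat m:])"
    unfolding ore_deriv_eq by (simp only: Suc power_Suc mult_ac)
  then show ?thesis by (metis dvd_triv_left)
qed simp

text \<open>f = (X - a)^{p-1} is a nonzero normal form, but h f lies in f H, so f h f is a multiple
  of f^2 and vanishes in the fibre. This contradicts primeness of the matrix algebra.\<close>

lemma not_azumaya_fibre:
  assumes a: "a ^ p = \<alpha>" and e: "poly D a = 0"
  shows "\<not> quot_alg H (fib_ideal \<alpha> \<beta>) \<cong>\<^sub>k module_mat TYPE('k) p p"
proof
  let ?F = "quot_alg H (fib_ideal \<alpha> \<beta>)" and ?c = "\<lambda>x. fib_ideal \<alpha> \<beta> +> x"
  assume "?F \<cong>\<^sub>k module_mat TYPE('k) p p"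
  then obtain \<phi> where "\<phi> \<in> ring_iso ?F (module_mat TYPE('k) p p)"
    by (auto simp: alg_isomorphic_def alg_iso_def)
  then have hom: "\<phi> \<in> Ring.ring_hom ?F (module_mat TYPE('k) p p)"
    and bij: "bij_betw \<phi> (carrier ?F) (carrier_mat p p)"
    by (auto simp: ring_iso_def module_mat_simps)
  have mem: "?c x \<in> carrier ?F" for x
    by (auto simp: carrier_quot_alg)
  have mult: "\<phi> (?c (x \<star> y)) = \<phi> (?c x) * \<phi> (?c y)" for x y
    using ring_hom_mult[OF hom mem mem, of x y]
    by (simp add: quot_alg_mult[OF ideal_fib] module_mat_simps)
  have zero: "\<phi> (?c x) = 0\<^sub>m p p \<longleftrightarrow> x \<in> fib_ideal \<alpha> \<beta>" for x
  proof -
    interpret F: ring ?F by (rule ring_quot_alg[OF ideal_fib])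
    interpret hom: ring_hom_ring ?F "module_mat TYPE('k) p p" \<phi>
      by (rule ring_hom_ringI2[OF F.ring_axioms ring_module_mat hom])
    have "\<phi> (?c 0) = 0\<^sub>m p p"
      using hom.hom_zero quot_alg_zero[OF ideal_fib] by (simp add: module_mat_simps)
    then have "\<phi> (?c x) = 0\<^sub>m p p \<longleftrightarrow> ?c x = ?c 0"
      using bij mem by (metis bij_betw_inv_into_left)
    also have "\<dots> \<longleftrightarrow> x \<in> fib_ideal \<alpha> \<beta>"
      using coeff_0 by (subst coset_eq_iff[OF ideal_fib]) auto
    finally show ?thesis .
  qed
  define f where "f = [:- a, 1:] ^ (p - 1)"
  have "nf [:f:]"
    using p_pos by (auto simp: nf_def f_def degree_power_eq coeff_pCons split: nat.splits)
  moreover have "f \<noteq> 0" by (simp add: f_def)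
  ultimately have "[:f:] \<notin> fib_ideal \<alpha> \<beta>"
    using nf_unique by fastforce
  then have "\<phi> (?c [:f:]) \<noteq> 0\<^sub>m p p" using zero by blast
  moreover have carr: "\<phi> (?c [:f:]) \<in> carrier_mat p p"
    using bij mem by (auto simp: bij_betw_def)
  ultimately obtain B where B: "B \<in> carrier_mat p p" "\<phi> (?c [:f:]) * B * \<phi> (?c [:f:]) \<noteq> 0\<^sub>m p p"
    using mat_prime by blast
  obtain h where h: "B = \<phi> (?c h)"
    using B(1) bij by (auto simp: bij_betw_def carrier_quot_alg)
  obtain S where "h \<star> [:f:] = Polynomial.smult f S"
    using ore_smult_dvd[OF linear_power_dvd_deriv[OF e], of h "p - 1" 1] by (auto simp: f_def)
  then have "[:f:] \<star> h \<star> [:f:] = S * [:f * f:]"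
    unfolding ore_assoc by simp
  \<comment> \<open>The exponent 2(p - 1) is at least p because p \<ge> 2, so X^p - \<alpha> splits
    off.\<close>
  also have "f * f = (monom 1 p - [:\<alpha>:]) * [:- a, 1:] ^ (p - 2)"
  proof -
    have "p - 1 + (p - 1) = p + (p - 2)" using p_ge_2 by simp
    then show ?thesis
      unfolding f_def power_add[symmetric] by (simp only: power_add linear_power_p a)
  qed
  also have "S * [:(monom 1 p - [:\<alpha>:]) * [:- a, 1:] ^ (p - 2):] =
      (S * [:[:- a, 1:] ^ (p - 2):]) * [:monom 1 p - [:\<alpha>:]:]"
    by (simp add: mult.commute)
  finally have "[:f:] \<star> h \<star> [:f:] \<in> fib_ideal \<alpha> \<beta>"
    by (metis fib_ideal_I(1))
  then have "\<phi> (?c [:f:]) * B * \<phi> (?c [:f:]) = 0\<^sub>m p p"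
    unfolding h by (simp only: mult[symmetric] zero)
  with B show False by simp
qed

lemma exists_root_p: "\<exists>a. a ^ p = (\<alpha>::'k)"
  using alg_closed_imp_poly_has_root[of "monom 1 p - [:\<alpha>:]"] p_pos
  by (auto simp: degree_pm poly_monom)

lemma poly_D_power: "a ^ p = \<alpha> \<Longrightarrow> poly D a ^ p = d 0 ^ p * \<alpha> + poly dp \<alpha> ^ p"
  by (simp add: poly_D frobenius_add power_mult_distrib)

lemma fibre_azumaya_iff:
  "quot_alg H (fib_ideal \<alpha> \<beta>) \<cong>\<^sub>k module_mat TYPE('k) p p \<longleftrightarrow> d 0 ^ p * \<alpha> + poly dp \<alpha> ^ p \<noteq> 0"
proof -
  obtain a where a: "a ^ p = \<alpha>" using exists_root_p by blast
  show ?thesis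
    using azumaya_fibre[OF a, of \<beta>] not_azumaya_fibre[OF a, of \<beta>] p_pos
    unfolding poly_D_power[OF a, symmetric] by (cases "poly D a = 0") auto
qed

end

section \<open>Fibres outside the Azumaya locus\<close>

lemma poly2_simps [simp]:
  "carrier poly2_alg = UNIV" "mult poly2_alg = (*)" "one poly2_alg = 1" "zero poly2_alg = 0"
  "add poly2_alg = (+)" "Module.smult poly2_alg = (\<lambda>a. Polynomial.smult [:a:])"
  by (simp_all add: poly2_alg_def)

lemma ideal_poly2_iff: "ideal J poly2_alg \<longleftrightarrow> poly_ideal (J :: 'k::field poly poly set)"
proof -
  interpret kalg "poly2_alg :: ('k, 'k poly poly) module" by (rule kalg_poly2)
  have inv: "\<ominus>\<^bsub>poly2_alg\<^esub> x = - (x :: 'k poly poly)" for x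
    by (rule minus_equality) auto
  show ?thesis
  proof
    assume "ideal J poly2_alg"
    then interpret ideal J "poly2_alg :: ('k, 'k poly poly) module" .
    show "poly_ideal J"
      unfolding poly_ideal_def using zero_closed a_closed I_l_closed by auto
  next
    assume J: "poly_ideal J"
    show "ideal J poly2_alg"
    proof (rule idealI)
      show "ring (poly2_alg :: ('k, 'k poly poly) module)" by (rule ring_axioms)
      show "subgroup J (add_monoid poly2_alg)"
      proof
        fix x assume "x \<in> J"
        then show "inv\<^bsub>add_monoid poly2_alg\<^esub> x \<in> J"
          using inv[of x] poly_ideal_minus[OF J] by (simp add: a_inv_def)
      qed (use J in \<open>auto simp: poly_ideal_def\<close>)
    qed (use J in \<open>auto simp: poly_ideal_def mult.commute\<close>)
  qed
qed

lemma Idl_poly2_span: "Idl\<^bsub>poly2_alg\<^esub> {F, G} = {A * F + B * G |A B. True}"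
proof -
  interpret kalg "poly2_alg :: ('a, 'a poly poly) module" by (rule kalg_poly2)
  show ?thesis
  proof
    have "F \<in> {A * F + B * G |A B. True}" "G \<in> {A * F + B * G |A B. True}"
      by (auto intro: exI[of _ 0] exI[of _ 1])
    moreover have "ideal {A * F + B * G |A B. True} poly2_alg"
      unfolding ideal_poly2_iff by (rule poly_ideal_span)
    ultimately show "Idl\<^bsub>poly2_alg\<^esub> {F, G} \<subseteq> {A * F + B * G |A B. True}"
      by (intro genideal_minimal) auto
    have "poly_ideal (Idl\<^bsub>poly2_alg\<^esub> {F, G})"
      using genideal_ideal[of "{F, G}"] by (simp add: ideal_poly2_iff)
    moreover have "F \<in> Idl\<^bsub>poly2_alg\<^esub> {F, G}" "G \<in> Idl\<^bsub>poly2_alg\<^esub> {F, G}"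
      using genideal_self[of "{F, G}"] by auto
    ultimately show "{A * F + B * G |A B. True} \<subseteq> Idl\<^bsub>poly2_alg\<^esub> {F, G}"
      unfolding poly_ideal_def by blast
  qed
qed

lemma pcompose_power: "(f ^ n) \<circ>\<^sub>p g = (f \<circ>\<^sub>p g :: 'a::comm_semiring_1 poly) ^ n"
  by (induction n) (simp_all add: pcompose_1 pcompose_mult)

text \<open>P(X + a, b + c Y). It is an automorphism of k[X, Y] for c \<noteq> 0; on the Ore
  extension it serves as a linear bijection carrying the ideal of the fibre to one with simpler
  generators.\<close>

definition affine :: "'k::field \<Rightarrow> 'k \<Rightarrow> 'k \<Rightarrow> 'k poly poly \<Rightarrow> 'k poly poly" where
  "affine a b c P = map_poly (\<lambda>f. f \<circ>\<^sub>p [:a, 1:]) P \<circ>\<^sub>p [:[:b:], [:c:]:]"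

lemma affine_add: "affine a b c (P + R) = affine a b c P + affine a b c R"
  by (simp add: affine_def map_poly_hom_add pcompose_add)

lemma affine_mult: "affine a b c (P * R) = affine a b c P * affine a b c R"
  by (simp add: affine_def map_poly_hom_mult pcompose_add pcompose_mult)

lemma affine_0 [simp]: "affine a b c 0 = 0"
  by (simp add: affine_def)

lemma affine_const: "affine a b c [:f:] = [:f \<circ>\<^sub>p [:a, 1:]:]"
  by (simp add: affine_def map_poly_pCons)

lemma affine_1 [simp]: "affine a b c 1 = 1"
  using affine_const[of a b c 1] by (simp add: one_pCons[symmetric] pcompose_1)

lemma affine_pCons: "affine a b c (pCons f P) = [:f \<circ>\<^sub>p [:a, 1:]:] + [:[:b:], [:c:]:] * affine a b c P"
  by (simp add: affine_def map_poly_pCons pcompose_pCons)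

lemma affine_embY: "affine a b c (embY q) = embY (q \<circ>\<^sub>p [:b, c:])"
proof (induction q)
  case (pCons r q)
  have "[:[:b:], [:c:]:] = embY [:b, c:]"
    by (simp add: embY_pCons)
  then have "affine a b c (embY (pCons r q)) = embY [:r:] + embY [:b, c:] * embY (q \<circ>\<^sub>p [:b, c:])"
    by (simp only: embY_pCons[of r] affine_pCons pcompose_const pCons.IH embY_0)
  then show ?case
    by (simp only: pcompose_pCons embY_add embY_mult)
qed simp

lemma affine_inverse:
  assumes "c \<noteq> 0"
  shows "affine a b c (affine (- a) (- b / c) (1 / c) P) = P"
proof (induction P)
  case (pCons f P)
  have "f \<circ>\<^sub>p [:- a, 1:] \<circ>\<^sub>p [:a, 1:] = f"
    by (simp add: pcompose_assoc[symmetric] pcompose_pCons)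
  moreover have "affine a b c [:[:- b / c:], [:1 / c:]:] = [:0, 1:]"
    using assms by (simp add: affine_pCons one_pCons[symmetric])
  ultimately have "affine a b c (affine (- a) (- b / c) (1 / c) (pCons f P)) = [:f:] + [:0, 1:] * P"
    by (simp only: affine_pCons[of "- a"] affine_add affine_mult affine_const pCons.IH)
  then show ?case by simp
qed simp

context ore_hopf
begin

text \<open>Modulo X^p - \<alpha> the part of D in k[X^p] becomes the constant dp(\<alpha>), which
  equals -d_0 a because D(a) = 0. In the fibre D is therefore d_0 (X - a).\<close>

lemma D_decomp:
  assumes "a ^ p = \<alpha>" "poly D a = 0"
  shows "\<exists>h. D = [:d 0:] * [:- a, 1:] + (monom 1 p - [:\<alpha>:]) * h"
proof -
  have "poly (dp - [:poly dp \<alpha>:]) \<alpha> = 0" by simp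
  then obtain g where g: "dp - [:poly dp \<alpha>:] = [:- \<alpha>, 1:] * g"
    by (metis poly_eq_0_iff_dvd dvdE)
  then have "frob dp - [:poly dp \<alpha>:] = frob [:- \<alpha>, 1:] * frob g"
    by (metis frob_mult frob_const frob_def pcompose_diff)
  moreover have "frob [:- \<alpha>, 1:] = monom 1 p - [:\<alpha>:]"
    by (simp add: frob_def pcompose_pCons)
  moreover have "poly dp \<alpha> = - (d 0 * a)"
    using assms poly_D[of a] by (simp add: eq_neg_iff_add_eq_0 add.commute)
  ultimately have "frob dp = [:- (d 0 * a):] + (monom 1 p - [:\<alpha>:]) * frob g"
    by (simp add: algebra_simps)
  then have "D = [:d 0:] * [:- a, 1:] + (monom 1 p - [:\<alpha>:]) * frob g"
    unfolding D_def frob_def[symmetric] by simp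
  then show ?thesis by blast
qed

lemma Q_linear_power:
  assumes "d 0 = 0" "b ^ p = \<beta>"
  shows "Q \<beta> = [:- b, 1:] ^ p"
  using assms p_ge_2 by (simp add: Q_def Q0_def linear_power_p power_0_left)

text \<open>For d_0 = 0 the element D lies in the ideal, so the Ore product agrees with the
  commutative one in the fibre. Translation by p-th roots a of \<alpha> and b of \<beta> turns the
  two generators into p-th powers of the variables.\<close>

lemma fibre_truncated_polynomials:
  assumes a: "a ^ p = \<alpha>" and e: "poly D a = 0" and d0: "d 0 = 0"
  shows "quot_alg H (fib_ideal \<alpha> \<beta>) \<cong>\<^sub>k quot_alg poly2_alg (Idl\<^bsub>poly2_alg\<^esub> {varX ^ p, varY ^ p})"
proof -
  interpret P: kalg "poly2_alg :: ('k, 'k poly poly) module" by (rule kalg_poly2)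
  obtain b where b: "b ^ p = \<beta>" using exists_root_p by blast
  define J where "J = {A * varX ^ p + B * varY ^ p |A B :: 'k poly poly. True}"
  have pJ: "poly_ideal J" unfolding J_def by (rule poly_ideal_span)
  then have J: "ideal J poly2_alg" by (simp add: ideal_poly2_iff)
  have JI: "A * varX ^ p + B * varY ^ p \<in> J" for A B by (auto simp: J_def)
  have varX_p: "varX ^ p = [:[:0, 1:] ^ p:]" and varY_p: "varY ^ p = embY ([:0, 1::'k:] ^ p)"
  proof -
    have "embY (q ^ n) = embY q ^ n" for q :: "'k poly" and n
      by (induction n) (simp_all add: embY_mult)
    then show "varY ^ p = embY ([:0, 1::'k:] ^ p)"
      by (simp add: varY_def embY_pCons one_pCons[symmetric])
    show "varX ^ p = [:[:0, 1:] ^ p:]"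
      by (simp add: varX_def poly_const_pow)
  qed
  have m: "monom 1 p - [:\<alpha>:] = [:- a, 1:] ^ p"
    using linear_power_p[of a] a by simp
  have tm: "affine a b 1 [:monom 1 p - [:\<alpha>:]:] = varX ^ p"
    unfolding m by (simp add: affine_const pcompose_power varX_p pcompose_pCons)
  have tQ: "affine a b 1 (embY (Q \<beta>)) = varY ^ p"
    unfolding Q_linear_power[OF d0 b] by (simp add: affine_embY pcompose_power varY_p pcompose_pCons)
  have tm': "affine (- a) (- b) 1 (varX ^ p) = [:monom 1 p - [:\<alpha>:]:]"
    unfolding m by (simp add: affine_const pcompose_power varX_p pcompose_pCons)
  have tQ': "affine (- a) (- b) 1 (varY ^ p) = embY (Q \<beta>)"
    unfolding Q_linear_power[OF d0 b] by (simp add: affine_embY pcompose_power varY_p pcompose_pCons)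
  have ker: "affine a b 1 P \<in> J \<longleftrightarrow> P \<in> fib_ideal \<alpha> \<beta>" for P
  proof
    assume "P \<in> fib_ideal \<alpha> \<beta>"
    then obtain A B where "P = A * [:monom 1 p - [:\<alpha>:]:] + B * embY (Q \<beta>)"
      by (auto simp: fib_ideal_def)
    then have "affine a b 1 P = affine a b 1 A * varX ^ p + affine a b 1 B * varY ^ p"
      by (simp only: affine_add affine_mult tm tQ)
    then show "affine a b 1 P \<in> J" using JI by simp
  next
    assume "affine a b 1 P \<in> J"
    then obtain A B where "affine a b 1 P = A * varX ^ p + B * varY ^ p"
      by (auto simp: J_def)
    then have "affine (- a) (- b) 1 (affine a b 1 P) =
        affine (- a) (- b) 1 A * [:monom 1 p - [:\<alpha>:]:] + affine (- a) (- b) 1 B * embY (Q \<beta>)"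
      by (simp only: affine_add affine_mult tm' tQ')
    moreover have "affine (- a) (- b) 1 (affine a b 1 P) = P"
      using affine_inverse[of 1 "- a" "- b" P] by simp
    ultimately show "P \<in> fib_ideal \<alpha> \<beta>"
      by (simp only: fib_ideal_add fib_ideal_I)
  qed
  have diff: "x \<ominus>\<^bsub>poly2_alg\<^esub> y = x - y" for x y :: "'k poly poly"
  proof -
    have "\<ominus>\<^bsub>poly2_alg\<^esub> y = - y" by (rule P.minus_equality) auto
    then show ?thesis by (simp add: a_minus_def)
  qed
  let ?c = "\<lambda>x. J +>\<^bsub>poly2_alg\<^esub> x"
  have c_eq: "?c x = ?c y \<longleftrightarrow> x - y \<in> J" for x y
    using P.coset_eq_iff[OF J, of x y] by (simp add: diff)
  have "\<exists>\<phi>\<in>alg_iso (quot_alg H (fib_ideal \<alpha> \<beta>)) (quot_alg poly2_alg J).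
      \<forall>x\<in>carrier H. \<phi> (fib_ideal \<alpha> \<beta> +> x) = ?c (affine a b 1 x)"
  proof (rule first_isomorphism(2)[OF P.ring_quot_alg[OF J]])
    have mult: "?c (affine a b 1 (x \<star> y)) = ?c (affine a b 1 x * affine a b 1 y)" for x y
    proof -
      obtain h where h: "D = (monom 1 p - [:\<alpha>:]) * h"
        using D_decomp[OF a e] d0 by auto
      obtain R where "x \<star> y = x * y + Polynomial.smult D R"
        using ore_eq_mult_mod by blast
      then have "x \<star> y - x * y = (R * [:h:]) * [:monom 1 p - [:\<alpha>:]:]"
        by (simp add: h mult.commute)
      then have "x \<star> y - x * y \<in> fib_ideal \<alpha> \<beta>"
        by (metis fib_ideal_I(1))
      then have "affine a b 1 (x \<star> y - x * y) \<in> J" by (simp add: ker)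
      moreover have "affine a b 1 (x \<star> y - x * y) = affine a b 1 (x \<star> y) - affine a b 1 x * affine a b 1 y"
        using affine_add[of a b 1 "x \<star> y - x * y" "x * y"] by (simp add: affine_mult)
      ultimately show ?thesis by (simp add: c_eq)
    qed
    show "(\<lambda>x. ?c (affine a b 1 x)) \<in> Ring.ring_hom H (quot_alg poly2_alg J)"
      by (auto simp: Ring.ring_hom_def P.carrier_quot_alg P.quot_alg_mult[OF J] P.quot_alg_add[OF J]
          P.quot_alg_one mult affine_add J)
    show "(\<lambda>x. ?c (affine a b 1 x)) ` carrier H = carrier (quot_alg poly2_alg J)"
      by (auto simp: P.carrier_quot_alg) (metis rangeI affine_inverse[OF one_neq_zero])
    show "?c (affine a b 1 x) = \<zero>\<^bsub>quot_alg poly2_alg J\<^esub> \<longleftrightarrow> x \<in> fib_ideal \<alpha> \<beta>" for x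
      by (simp add: P.quot_alg_zero[OF J] c_eq ker)
    show "?c (affine a b 1 (r \<odot> x)) = r \<odot>\<^bsub>quot_alg poly2_alg J\<^esub> ?c (affine a b 1 x)" for r x
      using affine_mult[of a b 1 "[:[:r:]:]" x] by (simp add: P.quot_alg_smult[OF J] affine_const)
  qed auto
  moreover have "J = Idl\<^bsub>poly2_alg\<^esub> {varX ^ p, varY ^ p}"
    unfolding Idl_poly2_span J_def ..
  ultimately show ?thesis
    by (auto simp: alg_isomorphic_def)
qed

section \<open>Roots of the polynomial \<open>Q \<beta>\<close>\<close>

lemma of_nat_power_p: "(of_nat i :: 'k) ^ p = of_nat i"
  by (induction i) (use p_pos in \<open>simp_all add: frobenius_add\<close>)

lemma poly_Q: "poly (Q \<beta>) \<rho> = \<rho> ^ p - d 0 ^ (p - 1) * \<rho> - \<beta>"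
  by (simp add: Q_def Q0_def poly_monom)

lemma Q_nonzero: "Q \<beta> \<noteq> 0"
  using degree_Q[of \<beta>] p_pos by auto

lemma Q_roots_d0: "d 0 = 0 \<Longrightarrow> b ^ p = \<beta> \<Longrightarrow> poly (Q \<beta>) \<rho> = 0 \<longleftrightarrow> \<rho> = b"
  using p_pos by (simp add: Q_linear_power)

text \<open>Translation by d_0 preserves the roots, and the p distinct translates of one root
  already exhaust the degree.\<close>

lemma Q_roots:
  assumes d0: "d 0 \<noteq> 0" and \<rho>: "poly (Q \<beta>) \<rho> = 0"
  shows "inj_on (\<lambda>i. \<rho> + of_nat i * d 0) {..<p}"
    and "{\<sigma>. poly (Q \<beta>) \<sigma> = 0} = (\<lambda>i. \<rho> + of_nat i * d 0) ` {..<p}"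
proof -
  show inj: "inj_on (\<lambda>i. \<rho> + of_nat i * d 0) {..<p}"
  proof (rule linorder_inj_onI)
    fix i j :: nat assume ij: "i < j" "i \<in> {..<p}" "j \<in> {..<p}"
    show "\<rho> + of_nat i * d 0 \<noteq> \<rho> + of_nat j * d 0"
    proof
      assume "\<rho> + of_nat i * d 0 = \<rho> + of_nat j * d 0"
      then have "of_nat (j - i) = (0::'k)"
        using d0 ij by (simp add: of_nat_diff)
      then have "p dvd j - i" by (simp only: of_nat_eq_0_iff_p)
      then show False using ij by (auto dest: dvd_imp_le)
    qed
  qed auto
  have sub: "(\<lambda>i. \<rho> + of_nat i * d 0) ` {..<p} \<subseteq> {\<sigma>. poly (Q \<beta>) \<sigma> = 0}"
  proof -
    have "d 0 ^ p = d 0 ^ (p - 1) * d 0"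
      using p_pos by (simp add: power_eq_if)
    then show ?thesis
      using \<rho> by (auto simp: poly_Q frobenius_add power_mult_distrib of_nat_power_p algebra_simps)
  qed
  have "card {\<sigma>. poly (Q \<beta>) \<sigma> = 0} \<le> p"
    using card_poly_roots_bound[OF Q_nonzero[of \<beta>]] by (simp add: degree_Q)
  then show "{\<sigma>. poly (Q \<beta>) \<sigma> = 0} = (\<lambda>i. \<rho> + of_nat i * d 0) ` {..<p}"
    using sub poly_roots_finite[OF Q_nonzero[of \<beta>]] inj
    by (intro card_seteq[symmetric]) (auto simp: card_image)
qed

lemma Q_has_root: "\<exists>\<rho>. poly (Q \<beta>) \<rho> = 0"
  using alg_closed_imp_poly_has_root[of "Q \<beta>"] degree_Q[of \<beta>] p_pos by auto

text \<open>The determination of the center of H repeated in the fibre. For a normal form, commuting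
  with X_2 makes the coefficients polynomials in X^p, hence constants since their degrees are below
  p; commuting with X_1 makes p divide a Y-degree below p, which is then 0.\<close>

lemma central_mod_fib_ideal:
  assumes a: "a ^ p = \<alpha>" and e: "poly D a = 0" and d0: "d 0 \<noteq> 0"
    and comm: "\<And>R. P \<star> R - R \<star> P \<in> fib_ideal \<alpha> \<beta>"
  shows "\<exists>c. P - [:[:c:]:] \<in> fib_ideal \<alpha> \<beta>"
proof -
  obtain P' where P': "nf P'" "P - P' \<in> fib_ideal \<alpha> \<beta>"
    using nf_exists by blast
  have comm': "P' \<star> R - R \<star> P' \<in> fib_ideal \<alpha> \<beta>" for R
  proof -
    have "P' \<star> R - R \<star> P' = (P \<star> R - R \<star> P) - ((P - P') \<star> R - R \<star> (P - P'))"
      by (simp add: ore_diff_left ore_diff_right)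
    also have "\<dots> \<in> fib_ideal \<alpha> \<beta>"
      by (intro fib_ideal_diff comm fib_ideal_ore_left fib_ideal_ore_right P')
    finally show ?thesis .
  qed
  obtain h where h: "D = [:d 0:] * [:- a, 1:] + (monom 1 p - [:\<alpha>:]) * h"
    using D_decomp[OF a e] by blast
  \<comment> \<open>In the fibre D is d_0 (X - a), which raises X-degree by one. With X-degrees
    below p - 1 the product is still a normal form, so D can be cancelled.\<close>
  have D0: "R = 0" if R: "Polynomial.smult D R \<in> fib_ideal \<alpha> \<beta>" "degree R < p" "\<And>j. degree (coeff R j) < p - 1" for R
  proof -
    have "Polynomial.smult D R - (R * [:h:]) * [:monom 1 p - [:\<alpha>:]:] \<in> fib_ideal \<alpha> \<beta>"
      by (intro fib_ideal_diff R fib_ideal_I)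
    also have "Polynomial.smult D R - (R * [:h:]) * [:monom 1 p - [:\<alpha>:]:] =
        Polynomial.smult ([:d 0:] * [:- a, 1:]) R"
      unfolding h smult_add_left by (simp add: mult.commute)
    finally have "Polynomial.smult ([:d 0:] * [:- a, 1:]) R \<in> fib_ideal \<alpha> \<beta>" .
    moreover have "nf (Polynomial.smult ([:d 0:] * [:- a, 1:]) R)"
      unfolding nf_def
    proof (intro conjI allI)
      show "degree (Polynomial.smult ([:d 0:] * [:- a, 1:]) R) < p"
        using R(2) degree_smult_le le_less_trans by blast
      fix j
      have "degree ([:d 0:] * [:- a, 1:] * coeff R j) \<le> 1 + degree (coeff R j)"
        by (rule order.trans[OF degree_mult_le]) (simp add: d0)
      then show "degree (coeff (Polynomial.smult ([:d 0:] * [:- a, 1:]) R) j) < p"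
        using R(3)[of j] unfolding coeff_smult by linarith
    qed
    ultimately have "Polynomial.smult ([:d 0:] * [:- a, 1:]) R = 0"
      by (rule nf_unique)
    then show "R = 0"
      using d0 by simp
  qed
  have "P' \<star> X2 - X2 \<star> P' = - Polynomial.smult D (map_poly pderiv P')"
  proof -
    have "map_poly (ore_deriv p d) P' = Polynomial.smult D (map_poly pderiv P')"
      by (rule poly_eqI) (simp add: coeff_map_poly ore_deriv_eq)
    then show ?thesis
      by (simp add: ore_X2_left ore_X2_right shift_def)
  qed
  then have "Polynomial.smult D (map_poly pderiv P') \<in> fib_ideal \<alpha> \<beta>"
    using fib_ideal_minus[OF comm'[of X2]] by simp
  then have "map_poly pderiv P' = 0"
  proof (rule D0)
    show "degree (map_poly pderiv P') < p"
      using P'(1) degree_map_poly_le[of pderiv P'] by (simp add: nf_def)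
    show "degree (coeff (map_poly pderiv P') j) < p - 1" for j
    proof -
      have "degree (coeff P' j) < p" using P'(1) by (simp add: nf_def)
      then have "degree (pderiv (coeff P' j)) \<le> p - 2"
        by (intro degree_le) (auto simp: coeff_pderiv coeff_eq_0)
      then show ?thesis using p_ge_2 by (simp add: coeff_map_poly)
    qed
  qed
  then have pd: "pderiv (coeff P' j) = 0" for j
    by (metis coeff_0 coeff_map_poly pderiv_0)
  have const: "degree (coeff P' j) = 0" for j
  proof -
    obtain g where g: "coeff P' j = frob g"
      using pderiv_eq_0_imp_frob[OF pd] by blast
    have "degree (frob g) = degree g * p"
      by (simp add: frob_def degree_pcompose degree_monom_eq)
    moreover have "degree (coeff P' j) < p"
      using P'(1) by (simp add: nf_def)
    ultimately show ?thesis using g by (cases "degree g") auto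
  qed
  define q where "q = map_poly (\<lambda>f. coeff f 0) P'"
  have P'q: "P' = embY q"
    by (rule poly_eqI) (simp add: q_def coeff_map_poly, metis const degree_0_id)
  have "P' \<star> X1 - X1 \<star> P' = Polynomial.smult D (commX1 P')"
    by (simp add: ore_X1_right ore_X1_left)
  then have "Polynomial.smult D (commX1 P') \<in> fib_ideal \<alpha> \<beta>"
    using comm'[of X1] by simp
  then have c0: "commX1 P' = 0"
  proof (rule D0)
    have "degree (commX1 P') \<le> degree P'"
      by (rule degree_le) (simp add: coeff_commX1_eq_0)
    then show "degree (commX1 P') < p"
      using P'(1) by (simp add: nf_def)
    show "degree (coeff (commX1 P') j) < p - 1" for j
      unfolding P'q commX1_embY using p_ge_2 by simp
  qed
  have "degree P' = 0"
  proof (cases "degree P'")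
    case (Suc n)
    have "of_nat (Suc n) * lead_coeff P' = 0"
      using coeff_commX1[OF Suc] c0 by simp
    moreover have "P' \<noteq> 0" using Suc by auto
    ultimately have "of_nat (Suc n) = (0::'k)"
      by (simp add: of_nat_poly del: of_nat_Suc)
    then have "p dvd Suc n" by (simp only: of_nat_eq_0_iff_p)
    moreover have "Suc n < p" using P'(1) Suc by (simp add: nf_def)
    ultimately show ?thesis by (auto dest: dvd_imp_le)
  qed
  then obtain c where "P' = [:[:c:]:]"
    using P'q degree_0_id[of q] by (metis degree_embY embY_pCons embY_0)
  then show ?thesis using P'(2) by blast
qed

text \<open>Modulo the ideal every central element is a scalar, so 0 and 1 are the only central
  idempotents.\<close>

lemma blocks_fibre:
  assumes a: "a ^ p = \<alpha>" and e: "poly D a = 0" and d0: "d 0 \<noteq> 0"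
  shows "blocks (quot_alg H (fib_ideal \<alpha> \<beta>)) = {\<one>\<^bsub>quot_alg H (fib_ideal \<alpha> \<beta>)\<^esub>}"
proof -
  let ?F = "quot_alg H (fib_ideal \<alpha> \<beta>)" and ?c = "\<lambda>x. fib_ideal \<alpha> \<beta> +> x"
  interpret F: ring ?F by (rule ring_quot_alg[OF ideal_fib])
  have c_eq: "?c x = ?c y \<longleftrightarrow> x - y \<in> fib_ideal \<alpha> \<beta>" for x y
    using coset_eq_iff[OF ideal_fib, of x y] by simp
  have one: "\<one>\<^bsub>?F\<^esub> = ?c 1" and zero: "\<zero>\<^bsub>?F\<^esub> = ?c 0"
    using quot_alg_one[OF ideal_fib] quot_alg_zero[OF ideal_fib] by simp_all
  have mult: "?c x \<otimes>\<^bsub>?F\<^esub> ?c y = ?c (x \<star> y)" for x y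
    using quot_alg_mult[OF ideal_fib, of x y] by simp
  have const: "[:[:c:]:] \<in> fib_ideal \<alpha> \<beta> \<longleftrightarrow> c = 0" for c
  proof
    assume "[:[:c:]:] \<in> fib_ideal \<alpha> \<beta>"
    moreover have "nf [:[:c:]:]"
      using p_pos by (auto simp: nf_def coeff_pCons split: nat.splits)
    ultimately show "c = 0" using nf_unique by fastforce
  qed simp
  have ne: "\<one>\<^bsub>?F\<^esub> \<noteq> \<zero>\<^bsub>?F\<^esub>"
    unfolding one zero c_eq using const[of 1] by (simp add: one_pCons[symmetric])
  have idem: "x = \<zero>\<^bsub>?F\<^esub> \<or> x = \<one>\<^bsub>?F\<^esub>" if x: "x \<in> central_idempotents ?F" for x
  proof -
    from x obtain P where P: "x = ?c P"
      by (auto simp: central_idempotents_def alg_center_def carrier_quot_alg)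
    have "?c P \<otimes>\<^bsub>?F\<^esub> ?c R = ?c R \<otimes>\<^bsub>?F\<^esub> ?c P" for R
      using x unfolding P central_idempotents_def alg_center_def carrier_quot_alg by auto
    then have "P \<star> R - R \<star> P \<in> fib_ideal \<alpha> \<beta>" for R
      by (simp only: mult c_eq)
    then obtain c where c: "P - [:[:c:]:] \<in> fib_ideal \<alpha> \<beta>"
      using central_mod_fib_ideal[OF a e d0] by blast
    then have xc: "x = ?c [:[:c:]:]" by (simp add: P c_eq)
    have "x \<otimes>\<^bsub>?F\<^esub> x = x" using x by (simp add: central_idempotents_def)
    then have "[:[:c * c - c:]:] \<in> fib_ideal \<alpha> \<beta>"
      unfolding xc mult c_eq by simp
    then have "c * (c - 1) = 0"
      unfolding const by (simp add: algebra_simps)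
    then have "c = 0 \<or> c = 1" by simp
    then show ?thesis
      by (auto simp: xc one zero one_pCons[symmetric])
  qed
  have "\<one>\<^bsub>?F\<^esub> \<in> central_idempotents ?F"
    by (simp add: central_idempotents_def alg_center_def)
  moreover have "\<not> (\<exists>f\<in>central_idempotents ?F. \<exists>g\<in>central_idempotents ?F. f \<noteq> \<zero>\<^bsub>?F\<^esub> \<and> g \<noteq> \<zero>\<^bsub>?F\<^esub> \<and>
      f \<otimes>\<^bsub>?F\<^esub> g = \<zero>\<^bsub>?F\<^esub> \<and> \<one>\<^bsub>?F\<^esub> = f \<oplus>\<^bsub>?F\<^esub> g)"
    using idem ne F.l_one[OF F.one_closed] by metis
  ultimately have "\<one>\<^bsub>?F\<^esub> \<in> blocks ?F"
    using ne by (simp add: blocks_def)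
  moreover have "x = \<one>\<^bsub>?F\<^esub>" if "x \<in> blocks ?F" for x
    using that idem[of x] unfolding blocks_def by blast
  ultimately show ?thesis by blast
qed

end

section \<open>Simple modules\<close>

context left_module
begin

lemma act_zero_right:
  assumes "a \<in> carrier A"
  shows "a \<odot>\<^bsub>M\<^esub> \<zero>\<^bsub>M\<^esub> = \<zero>\<^bsub>M\<^esub>"
  using act_r_distr[OF assms M.zero_closed M.zero_closed] act_closed[OF assms M.zero_closed]
  by (metis M.add.r_cancel_one M.r_zero M.zero_closed)

lemma act_zero_left:
  assumes "x \<in> carrier M"
  shows "\<zero>\<^bsub>A\<^esub> \<odot>\<^bsub>M\<^esub> x = \<zero>\<^bsub>M\<^esub>"
  using act_l_distr[OF A.zero_closed A.zero_closed assms] act_closed[OF A.zero_closed assms]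
  by (metis A.r_zero A.zero_closed M.add.r_cancel_one)

lemma act_minus_one:
  assumes "x \<in> carrier M"
  shows "(\<ominus>\<^bsub>A\<^esub> \<one>\<^bsub>A\<^esub>) \<odot>\<^bsub>M\<^esub> x = \<ominus>\<^bsub>M\<^esub> x"
proof (rule M.minus_equality[symmetric])
  have "(\<ominus>\<^bsub>A\<^esub> \<one>\<^bsub>A\<^esub> \<oplus>\<^bsub>A\<^esub> \<one>\<^bsub>A\<^esub>) \<odot>\<^bsub>M\<^esub> x = \<zero>\<^bsub>M\<^esub>"
    using act_zero_left[OF assms] by (simp add: A.l_neg)
  then show "(\<ominus>\<^bsub>A\<^esub> \<one>\<^bsub>A\<^esub>) \<odot>\<^bsub>M\<^esub> x \<oplus>\<^bsub>M\<^esub> x = \<zero>\<^bsub>M\<^esub>"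
    using assms by (simp add: act_l_distr act_one)
qed (use assms in \<open>auto intro: act_closed\<close>)

text \<open>Closure under negation is not asked for, as it comes from the action of -1.\<close>

lemma left_submoduleI:
  assumes "N \<subseteq> carrier M" "\<zero>\<^bsub>M\<^esub> \<in> N" "\<And>x y. x \<in> N \<Longrightarrow> y \<in> N \<Longrightarrow> x \<oplus>\<^bsub>M\<^esub> y \<in> N"
    and act: "\<And>a x. a \<in> carrier A \<Longrightarrow> x \<in> N \<Longrightarrow> a \<odot>\<^bsub>M\<^esub> x \<in> N"
  shows "left_submodule A M N"
  unfolding left_submodule_def
proof (intro conjI ballI)
  show "additive_subgroup N M"
  proof (rule additive_subgroup.intro, rule subgroup.intro)
    fix x assume x: "x \<in> N"
    then have "\<ominus>\<^bsub>M\<^esub> x \<in> N"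
      using act[of "\<ominus>\<^bsub>A\<^esub> \<one>\<^bsub>A\<^esub>" x] act_minus_one[of x] assms(1) by auto
    then show "inv\<^bsub>add_monoid M\<^esub> x \<in> N"
      by (simp add: a_inv_def)
  qed (use assms in auto)
qed (rule act)

end

lemma has_dim_one:
  fixes A :: "('k::field, 'b, 'x) module_scheme" and M :: "('b, 'k, 'y) module_scheme"
  assumes "carrier M = UNIV" "zero M = 0" "add M = (+)"
    and sm: "\<And>c m. (c \<odot>\<^bsub>A\<^esub> \<one>\<^bsub>A\<^esub>) \<odot>\<^bsub>M\<^esub> m = c * m"
  shows "has_dim A M 1"
proof -
  let ?V = "underlying_space A M"
  have V: "carrier ?V = UNIV" "zero ?V = 0" "add ?V = (+)" "Module.smult ?V = (*)"
    using assms by (simp_all add: underlying_space_def fun_eq_iff)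
  have ab: "abelian_group ?V"
  proof (rule abelian_groupI)
    fix x assume "x \<in> carrier ?V"
    show "\<exists>y\<in>carrier ?V. y \<oplus>\<^bsub>?V\<^esub> x = \<zero>\<^bsub>?V\<^esub>"
      by (intro bexI[of _ "- x"]) (auto simp: V)
  qed (auto simp: V)
  interpret vectorspace class_ring ?V
    by (intro vectorspace.intro Module.module.intro Module.module_axioms.intro class_field ab)
      (auto simp: V algebra_simps intro: fieldE(1)[OF class_field])
  have span: "x \<in> span {1}" for x
  proof -
    have "lincomb (\<lambda>_. x) {1} = x"
      by (simp add: lincomb_def V)
    then have "x = lincomb (\<lambda>_. x) {1}" by (rule sym)
    then show ?thesis
      by (subst finite_span) (simp_all add: V, blast)
  qed
  then have gen: "gen_set {1}"
    by (auto simp: V)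
  have "dim = 1"
    by (rule dim1I[OF gen]) (auto simp: V)
  moreover have "fin_dim"
    unfolding fin_dim_def using gen by (intro exI[of _ "{1}"]) (auto simp: V)
  ultimately show ?thesis
    by (simp add: has_dim_def)
qed

text \<open>The field k with P acting as P(a, \<rho>). The value is taken on an arbitrary
  representative of the coset; \<open>char_mod_act\<close> shows independence of the choice when
  \<rho> is a root of \<open>Q \<beta>\<close>.\<close>

definition char_mod :: "'k::field \<Rightarrow> 'k \<Rightarrow> ('k poly poly set, 'k) module" where
  "char_mod a \<rho> = \<lparr>carrier = UNIV, mult = (*), one = 1, zero = 0, add = (+),
     smult = (\<lambda>X m. eval_xy a \<rho> (SOME P. P \<in> X) * m)\<rparr>"

lemma char_mod_simps [simp]:
  "carrier (char_mod a \<rho>) = UNIV" "zero (char_mod a \<rho>) = 0" "add (char_mod a \<rho>) = (+)"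
  by (simp_all add: char_mod_def)

section \<open>Characters and simple modules of a fibre outside the Azumaya locus\<close>

locale ore_hopf_fibre = ore_hopf H p d
  for H :: "('k::alg_closed_field, 'k poly poly, 'x) module_scheme" (structure)
    and p :: nat and d :: "nat \<Rightarrow> 'k" +
  fixes a \<alpha> \<beta> :: 'k
  assumes a: "a ^ p = \<alpha>" and e: "poly D a = 0"
begin

abbreviation "I \<equiv> fib_ideal \<alpha> \<beta>"
abbreviation "F \<equiv> quot_alg H I"
abbreviation "cls P \<equiv> I +> P"

sublocale F: kalg F by (rule kalg_quot_alg[OF ideal_fib])

lemma cls_eq: "cls x = cls y \<longleftrightarrow> x - y \<in> I"
  using coset_eq_iff[OF ideal_fib, of x y] by simp

lemma one_F: "\<one>\<^bsub>F\<^esub> = cls 1" and zero_F: "\<zero>\<^bsub>F\<^esub> = cls 0"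
  using quot_alg_one[OF ideal_fib[of \<alpha> \<beta>]] quot_alg_zero[OF ideal_fib[of \<alpha> \<beta>]] by simp_all

lemma mult_F: "cls x \<otimes>\<^bsub>F\<^esub> cls y = cls (x \<star> y)"
  and add_F: "cls x \<oplus>\<^bsub>F\<^esub> cls y = cls (x + y)"
  and smult_F: "r \<odot>\<^bsub>F\<^esub> cls x = cls (Polynomial.smult [:r:] x)"
  using quot_alg_mult[OF ideal_fib[of \<alpha> \<beta>], of x y]
    quot_alg_add[OF ideal_fib[of \<alpha> \<beta>], of x y] quot_alg_smult[OF ideal_fib[of \<alpha> \<beta>], of x r]
  by simp_all

lemma cls_carrier: "cls x \<in> carrier F"
  by (auto simp: carrier_quot_alg)

lemma carrier_F: "X \<in> carrier F \<longleftrightarrow> (\<exists>x. X = cls x)"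
  by (auto simp: carrier_quot_alg)

text \<open>The correction term of the product is divisible by D, which vanishes at a.\<close>

lemma eval_ore: "eval_xy a \<rho> (P \<star> R) = eval_xy a \<rho> P * eval_xy a \<rho> R"
proof -
  obtain S where "P \<star> R = P * R + Polynomial.smult D S"
    using ore_eq_mult_mod by blast
  then show ?thesis using e by simp
qed

lemma linear_power_in_I: "[:[:- a, 1:] ^ p:] \<in> I"
  using fib_ideal_I(1)[of 1] linear_power_p[of a] a by simp

context
  fixes \<rho> assumes \<rho>: "poly (Q \<beta>) \<rho> = 0"
begin

lemma eval_I: "P \<in> I \<Longrightarrow> eval_xy a \<rho> P = 0"
  using \<rho> a by (auto simp: fib_ideal_def poly_monom simp del: mult_pCons_right mult_pCons_left)

lemma char_mod_act: "cls P \<odot>\<^bsub>char_mod a \<rho>\<^esub> m = eval_xy a \<rho> P * m"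
proof -
  have "P \<in> cls P"
    by (simp add: a_r_coset_def')
  then have "(SOME P'. P' \<in> cls P) \<in> cls P" by (rule someI)
  then obtain i where "i \<in> I" "(SOME P'. P' \<in> cls P) = i + P"
    by (auto simp: a_r_coset_def')
  then show ?thesis
    by (simp add: char_mod_def eval_I)
qed

lemma left_module_char_mod: "left_module F (char_mod a \<rho>)"
proof (rule left_module.intro)
  show "ring F" by (rule F.ring_axioms)
  show "abelian_group (char_mod a \<rho>)"
  proof (rule abelian_groupI)
    fix x assume "x \<in> carrier (char_mod a \<rho>)"
    show "\<exists>y\<in>carrier (char_mod a \<rho>). y \<oplus>\<^bsub>char_mod a \<rho>\<^esub> x = \<zero>\<^bsub>char_mod a \<rho>\<^esub>"
      by (intro bexI[of _ "- x"]) auto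
  qed auto
  show "left_module_axioms F (char_mod a \<rho>)"
    by (rule left_module_axioms.intro)
      (auto simp: carrier_F add_F mult_F one_F char_mod_act eval_ore algebra_simps)
qed

lemma simple_char_mod: "simple_module F (char_mod a \<rho>)"
  unfolding simple_module_def
proof (intro conjI allI impI)
  show "left_module F (char_mod a \<rho>)" by (rule left_module_char_mod)
  show "carrier (char_mod a \<rho>) \<noteq> {\<zero>\<^bsub>char_mod a \<rho>\<^esub>}"
    by (simp add: set_eq_iff) (metis one_neq_zero)
  fix N assume N: "left_submodule F (char_mod a \<rho>) N"
  show "N = {\<zero>\<^bsub>char_mod a \<rho>\<^esub>} \<or> N = carrier (char_mod a \<rho>)"
  proof (cases "\<exists>n\<in>N. n \<noteq> 0")
    case True
    then obtain n where n: "n \<in> N" "n \<noteq> 0" by blast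
    have "x \<in> N" for x
    proof -
      have "cls [:[:x / n:]:] \<odot>\<^bsub>char_mod a \<rho>\<^esub> n \<in> N"
        using N n cls_carrier unfolding left_submodule_def by blast
      then show ?thesis using n by (simp add: char_mod_act)
    qed
    then show ?thesis by auto
  next
    case False
    moreover have "0 \<in> N"
      using N additive_subgroup.zero_closed[of N "char_mod a \<rho>"] by (simp add: left_submodule_def)
    ultimately show ?thesis by auto
  qed
qed

lemma has_dim_char_mod: "has_dim F (char_mod a \<rho>) 1"
  by (rule has_dim_one) (simp_all add: one_F smult_F char_mod_act)

end

text \<open>X_2 - \<rho> acts as zero on one module and as \<sigma> - \<rho> on the other.\<close>

lemma char_mod_not_isomorphic:
  assumes "poly (Q \<beta>) \<rho> = 0" "poly (Q \<beta>) \<sigma> = 0" "\<rho> \<noteq> \<sigma>"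
  shows "\<not> module_isomorphic F (char_mod a \<rho>) (char_mod a \<sigma>)"
proof
  assume "module_isomorphic F (char_mod a \<rho>) (char_mod a \<sigma>)"
  then obtain f where f: "bij f" "\<And>x y. f (x + y) = f x + f y"
    "\<And>X x. X \<in> carrier F \<Longrightarrow> f (X \<odot>\<^bsub>char_mod a \<rho>\<^esub> x) = X \<odot>\<^bsub>char_mod a \<sigma>\<^esub> f x"
    unfolding module_isomorphic_def by auto
  have f0: "f 0 = 0" using f(2)[of 0 0] by (metis add.right_neutral add_left_cancel)
  have "f (cls (embY [:- \<rho>, 1:]) \<odot>\<^bsub>char_mod a \<rho>\<^esub> 1) = cls (embY [:- \<rho>, 1:]) \<odot>\<^bsub>char_mod a \<sigma>\<^esub> f 1"
    by (rule f(3)[OF cls_carrier])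
  then have "(\<sigma> - \<rho>) * f 1 = 0"
    using assms by (simp add: char_mod_act f0)
  then have "f 1 = f 0" using assms f0 by simp
  then have "1 = (0::'k)" by (rule injD[OF bij_is_inj[OF f(1)]])
  then show False by simp
qed

text \<open>The nilpotent normal element \<open>X\<^sub>1 - a\<close> annihilates every simple module; an eigenvector of
  \<open>X\<^sub>2\<close> then spans it.\<close>

lemma simple_module_char:
  assumes "simple_module F M"
  shows "\<exists>\<rho>. poly (Q \<beta>) \<rho> = 0 \<and> module_isomorphic F M (char_mod a \<rho>)"
proof -
  interpret M: left_module F M
    using assms by (simp add: simple_module_def)
  have nz: "carrier M \<noteq> {\<zero>\<^bsub>M\<^esub>}"
    and sub: "\<And>N. left_submodule F M N \<Longrightarrow> N = {\<zero>\<^bsub>M\<^esub>} \<or> N = carrier M"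
    using assms by (auto simp: simple_module_def)
  define act where "act P m = cls P \<odot>\<^bsub>M\<^esub> m" for P m
  have act_closed: "act P m \<in> carrier M" if "m \<in> carrier M" for P m
    unfolding act_def using that by (intro M.act_closed cls_carrier)
  have act_add: "act (P + R) m = act P m \<oplus>\<^bsub>M\<^esub> act R m" if "m \<in> carrier M" for P R m
    unfolding act_def add_F[symmetric] by (rule M.act_l_distr[OF cls_carrier cls_carrier that])
  have act_plus: "act P (m \<oplus>\<^bsub>M\<^esub> n) = act P m \<oplus>\<^bsub>M\<^esub> act P n" if "m \<in> carrier M" "n \<in> carrier M" for P m n
    unfolding act_def by (rule M.act_r_distr[OF cls_carrier that])
  have act_mult: "act (P \<star> R) m = act P (act R m)" if "m \<in> carrier M" for P R m
    unfolding act_def mult_F[symmetric] by (rule M.act_assoc[OF cls_carrier cls_carrier that])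
  have act_one: "act 1 m = m" if "m \<in> carrier M" for m
    unfolding act_def one_F[symmetric] by (rule M.act_one[OF that])
  have act_I: "act P m = \<zero>\<^bsub>M\<^esub>" if "P \<in> I" "m \<in> carrier M" for P m
  proof -
    have "cls P = cls 0" using that by (simp add: cls_eq)
    then show ?thesis
      unfolding act_def using M.act_zero_left[OF that(2)] by (simp add: zero_F)
  qed
  have act_0: "act P \<zero>\<^bsub>M\<^esub> = \<zero>\<^bsub>M\<^esub>" for P
    unfolding act_def by (rule M.act_zero_right[OF cls_carrier])
  have submod: "left_submodule F M N"
    if "N \<subseteq> carrier M" "\<zero>\<^bsub>M\<^esub> \<in> N" "\<And>x y. x \<in> N \<Longrightarrow> y \<in> N \<Longrightarrow> x \<oplus>\<^bsub>M\<^esub> y \<in> N"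
      "\<And>P x. x \<in> N \<Longrightarrow> act P x \<in> N" for N
    using that by (intro M.left_submoduleI) (auto simp: carrier_F act_def)
  define X where "X = [:[:- a, 1:]:]"
  have X0: "act X m = \<zero>\<^bsub>M\<^esub>" if m: "m \<in> carrier M" for m
  proof -
    let ?N = "act X ` carrier M"
    have "left_submodule F M ?N"
    proof (rule submod)
      show "?N \<subseteq> carrier M" using act_closed by auto
      show "\<zero>\<^bsub>M\<^esub> \<in> ?N" using act_0[of X] M.M.zero_closed by force
      show "x \<oplus>\<^bsub>M\<^esub> y \<in> ?N" if xy: "x \<in> ?N" "y \<in> ?N" for x y
      proof -
        obtain m n where "m \<in> carrier M" "n \<in> carrier M" "x = act X m" "y = act X n"
          using xy by blast
        then show ?thesis
          by (intro image_eqI[of _ _ "m \<oplus>\<^bsub>M\<^esub> n"]) (auto simp: act_plus)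
      qed
      show "act P x \<in> ?N" if x: "x \<in> ?N" for P x
      proof -
        obtain m where m: "m \<in> carrier M" "x = act X m" using x by blast
        have "\<exists>S. P \<star> X = X \<star> S"
          using ore_smult_dvd[OF linear_power_dvd_deriv[OF e], of P 1 1] by (auto simp: X_def)
        then obtain S where "P \<star> X = X \<star> S" by blast
        then have "act P x = act X (act S m)"
          using m by (simp add: act_mult[symmetric])
        then show ?thesis using act_closed[OF m(1)] by blast
      qed
    qed
    then have "?N = {\<zero>\<^bsub>M\<^esub>} \<or> ?N = carrier M" by (rule sub)
    moreover have "?N \<noteq> carrier M"
    proof
      \<comment> \<open>Iterating X M = M writes every m as (X_1 - a)^p m', which is zero because
        (X_1 - a)^p lies in the ideal.\<close>
      assume eq: "?N = carrier M"
      have ex: "\<exists>m'\<in>carrier M. m = act [:[:- a, 1:] ^ n:] m'" if "m \<in> carrier M" for m n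
        using that
      proof (induction n arbitrary: m)
        case 0
        then show ?case
          using act_one[of m] by (intro bexI[of _ m]) (auto simp: one_pCons[symmetric])
      next
        case (Suc n)
        then obtain m' where m': "m' \<in> carrier M" "m = act X m'" using eq by blast
        then obtain m'' where "m'' \<in> carrier M" "m' = act [:[:- a, 1:] ^ n:] m''"
          using Suc.IH by blast
        moreover from this have "act X m' = act (X \<star> [:[:- a, 1:] ^ n:]) m''"
          by (simp only: act_mult)
        moreover have "X \<star> [:[:- a, 1:] ^ n:] = [:[:- a, 1:] ^ Suc n:]"
          by (simp add: X_def)
        ultimately show ?case
          using m'(2) by auto
      qed
      have "m = \<zero>\<^bsub>M\<^esub>" if "m \<in> carrier M" for m
        using ex[OF that, of p] act_I[OF linear_power_in_I] by (elim bexE) (simp only:)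
      then show False using nz M.M.zero_closed by blast
    qed
    ultimately show ?thesis using m by blast
  qed
  obtain m1 where m1: "m1 \<in> carrier M" "m1 \<noteq> \<zero>\<^bsub>M\<^esub>"
    using nz M.M.zero_closed by blast
  \<comment> \<open>Linear factors of f are applied to m1 one at a time; the last nonzero vector
    before the product vanishes is an eigenvector of X_2. The starting point is f =
    \<open>Q \<beta>\<close>.\<close>
  have eigen: "\<exists>\<rho>. \<exists>m\<in>carrier M. m \<noteq> \<zero>\<^bsub>M\<^esub> \<and> act (embY [:- \<rho>, 1:]) m = \<zero>\<^bsub>M\<^esub>"
    if "act (embY f) m1 = \<zero>\<^bsub>M\<^esub>" "f \<noteq> 0" for f
    using that
  proof (induction "degree f" arbitrary: f)
    case 0
    then obtain c where c: "f = [:c:]" "c \<noteq> 0"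
      by (metis degree_0_id pCons_0_0)
    have "embY [:1 / c:] \<star> embY f = 1"
      using c by (simp add: embY_mult[symmetric] one_pCons[symmetric])
    then have "m1 = act (embY [:1 / c:]) (act (embY f) m1)"
      using m1 by (simp add: act_mult[symmetric] act_one del: ore_embY_right)
    then have False using 0(2) act_0 m1 by simp
    then show ?case ..
  next
    case (Suc n)
    obtain \<rho> where "poly f \<rho> = 0"
      using alg_closed_imp_poly_has_root[of f] Suc(2) by auto
    then obtain g where g: "f = [:- \<rho>, 1:] * g"
      by (metis dvdE poly_eq_0_iff_dvd)
    with Suc have g': "g \<noteq> 0" "degree g = n"
      by (auto simp: degree_mult_eq simp del: mult_pCons_left)
    show ?case
    proof (cases "act (embY g) m1 = \<zero>\<^bsub>M\<^esub>")
      case True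
      show ?thesis
        by (rule Suc.hyps(1)[OF g'(2)[symmetric] True g'(1)])
    next
      case False
      have "act (embY [:- \<rho>, 1:]) (act (embY g) m1) = act (embY f) m1"
        using m1 unfolding g embY_mult by (simp only: act_mult[symmetric] ore_embY_right)
      then show ?thesis
        using False Suc.prems(1)
        by (intro exI[of _ \<rho>] bexI[OF _ act_closed[OF m1(1), of "embY g"]] conjI) simp_all
    qed
  qed
  have "embY (Q \<beta>) \<in> I"
    using fib_ideal_I(2)[of 1] by simp
  then obtain \<rho> m where m: "m \<in> carrier M" "m \<noteq> \<zero>\<^bsub>M\<^esub>" "act (embY [:- \<rho>, 1:]) m = \<zero>\<^bsub>M\<^esub>"
    using eigen[OF act_I[OF _ m1(1)] Q_nonzero] by blast
  define g where "g c = act [:[:c:]:] m" for c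
  have char: "act P m = g (eval_xy a \<rho> P)" for P
  proof -
    \<comment> \<open>In the expansion of P at (a, \<rho>), the multiple of X - a can be written
      with X on the left and the multiple of Y - \<rho> with it on the right, so both kill
      m.\<close>
    obtain A B where P: "P = [:[:eval_xy a \<rho> P:]:] + A * [:[:- a, 1:]:] + B * embY [:- \<rho>, 1:]"
      using eval_xy_decomp by blast
    have "act P m = act ([:[:eval_xy a \<rho> P:]:] + X \<star> A + B \<star> embY [:- \<rho>, 1:]) m"
      by (subst (1) P) (simp add: X_def mult.commute)
    also have "\<dots> = g (eval_xy a \<rho> P)"
      using m act_closed by (simp add: act_add act_mult g_def X0 act_0 del: ore_embY_right)
    finally show ?thesis .
  qed
  have g_mult: "act P (g c) = g (eval_xy a \<rho> P * c)" for P c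
  proof -
    have "act P (g c) = act (P \<star> [:[:c:]:]) m"
      unfolding g_def by (rule act_mult[OF m(1), symmetric])
    also have "\<dots> = g (eval_xy a \<rho> P * c)"
      unfolding char eval_ore by simp
    finally show ?thesis .
  qed
  have g_add: "g (c + c') = g c \<oplus>\<^bsub>M\<^esub> g c'" for c c'
    using m act_add[of m "[:[:c:]:]" "[:[:c':]:]"] by (simp add: g_def)
  have g0: "g 0 = \<zero>\<^bsub>M\<^esub>"
    using m act_I[of 0 m] by (simp add: g_def)
  have g1: "g 1 = m"
    using act_one[OF m(1)] by (simp add: g_def one_pCons[symmetric])
  have g_nz: "c = 0" if "g c = \<zero>\<^bsub>M\<^esub>" for c
  proof (rule ccontr)
    assume "c \<noteq> 0"
    then have "m = act [:[:1 / c:]:] (g c)"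
      by (simp add: g_mult g1)
    then show False using that act_0 m by simp
  qed
  have closed: "g c \<in> carrier M" for c
    using act_closed[OF m(1)] by (simp add: g_def)
  have inj: "inj g"
  proof (rule injI)
    fix c c' assume eq: "g c = g c'"
    have "g (c - c') \<oplus>\<^bsub>M\<^esub> g c' = \<zero>\<^bsub>M\<^esub> \<oplus>\<^bsub>M\<^esub> g c'"
      using g_add[of "c - c'" c'] eq closed by simp
    then have "g (c - c') = \<zero>\<^bsub>M\<^esub>"
      using M.M.add.right_cancel[of "g c'" "g (c - c')" "\<zero>\<^bsub>M\<^esub>"] closed by simp
    then show "c = c'" using g_nz by fastforce
  qed
  have surj: "range g = carrier M"
  proof -
    have "left_submodule F M (range g)"
    proof (rule submod)
      show "\<zero>\<^bsub>M\<^esub> \<in> range g" using g0 by (metis rangeI)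
    qed (auto simp: closed g_mult simp flip: g_add)
    then have "range g = {\<zero>\<^bsub>M\<^esub>} \<or> range g = carrier M" by (rule sub)
    then show ?thesis using g1 m by (metis rangeI singletonD)
  qed
  \<comment> \<open>\<open>Q \<beta>\<close> lies in the ideal and acts on m as its value at \<rho>,
    which must then be zero.\<close>
  have root: "poly (Q \<beta>) \<rho> = 0"
    using act_I[OF \<open>embY (Q \<beta>) \<in> I\<close> m(1)] char[of "embY (Q \<beta>)"] g_nz by simp
  define f where "f = inv_into UNIV g"
  have fg: "f (g c) = c" for c by (simp add: f_def inj)
  have "bij_betw f (carrier M) UNIV"
    unfolding f_def surj[symmetric] using inj by (simp add: bij_betw_inv_into inj_imp_bij_betw_inv)
  moreover have "f (x \<oplus>\<^bsub>M\<^esub> y) = f x + f y" if "x \<in> carrier M" "y \<in> carrier M" for x y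
    using that unfolding surj[symmetric] by (auto simp: fg simp flip: g_add)
  moreover have "f (Y \<odot>\<^bsub>M\<^esub> x) = Y \<odot>\<^bsub>char_mod a \<rho>\<^esub> f x" if Yx: "Y \<in> carrier F" "x \<in> carrier M" for Y x
  proof -
    obtain P where "Y = cls P"
      using Yx(1) by (auto simp: carrier_F)
    moreover obtain c where "x = g c"
      using Yx(2) surj by blast
    ultimately show ?thesis
      using g_mult[of P c] by (simp add: act_def fg char_mod_act[OF root])
  qed
  ultimately have "module_isomorphic F M (char_mod a \<rho>)"
    unfolding module_isomorphic_def by (intro exI[of _ f]) auto
  with root show ?thesis by blast
qed

end

section \<open>The free algebra\<close>

definition word :: "'x list \<Rightarrow> 'x list \<Rightarrow> 'k::field" where
  "word w = (\<lambda>v. if v = w then 1 else 0)"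

lemma free_simps [simp]:
  "carrier free_alg = {f. finite {w. f w \<noteq> 0}}" "one free_alg = word []" "zero free_alg = (\<lambda>w. 0)"
  "add free_alg = (\<lambda>f g w. f w + g w)" "Module.smult free_alg = (\<lambda>a f w. a * f w)"
  by (simp_all add: free_alg_def word_def)

lemma free_mult: "(f \<otimes>\<^bsub>free_alg\<^esub> g) w = (\<Sum>i\<le>length w. f (take i w) * g (drop i w))"
  by (simp add: free_alg_def)

lemma free_gen_word: "free_gen x = word [x]"
  by (simp add: free_gen_def word_def)

lemma finite_word [simp]: "finite {w. word u w \<noteq> (0::'k::field)}"
  by (rule finite_subset[of _ "{u}"]) (auto simp: word_def)

lemma support_free_mult:
  "{w. (f \<otimes>\<^bsub>free_alg\<^esub> g) w \<noteq> 0} \<subseteq> (\<lambda>(u, v). u @ v) ` ({w. f w \<noteq> 0} \<times> {w. g w \<noteq> 0})"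
proof
  fix w assume "w \<in> {w. (f \<otimes>\<^bsub>free_alg\<^esub> g) w \<noteq> 0}"
  then have "(\<Sum>i\<le>length w. f (take i w) * g (drop i w)) \<noteq> 0"
    by (simp add: free_mult)
  then obtain i where "f (take i w) * g (drop i w) \<noteq> 0"
    by (rule sum.not_neutral_contains_not_neutral)
  then show "w \<in> (\<lambda>(u, v). u @ v) ` ({w. f w \<noteq> 0} \<times> {w. g w \<noteq> 0})"
    by (intro image_eqI[of _ _ "(take i w, drop i w)"]) auto
qed

lemma kalg_free: "kalg (free_alg :: ('k::field, 'x list \<Rightarrow> 'k) module)"
proof -
  let ?F = "free_alg :: ('k, 'x list \<Rightarrow> 'k) module"
  have fin_add: "finite {w. f w + g w \<noteq> 0}" if "finite {w. f w \<noteq> 0}" "finite {w. g w \<noteq> 0}"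
    for f g :: "'x list \<Rightarrow> 'k"
    by (rule finite_subset[OF _ finite_UnI[OF that]]) auto
  have ab: "abelian_group ?F"
  proof (rule abelian_groupI)
    fix f assume "f \<in> carrier ?F"
    then show "\<exists>g\<in>carrier ?F. g \<oplus>\<^bsub>?F\<^esub> f = \<zero>\<^bsub>?F\<^esub>"
      by (intro bexI[of _ "\<lambda>w. - f w"]) auto
  qed (auto simp: fin_add algebra_simps)
  have closed: "f \<otimes>\<^bsub>?F\<^esub> g \<in> carrier ?F" if "f \<in> carrier ?F" "g \<in> carrier ?F" for f g
    using that by (auto intro!: finite_subset[OF support_free_mult])
  have assoc: "f \<otimes>\<^bsub>?F\<^esub> g \<otimes>\<^bsub>?F\<^esub> h = f \<otimes>\<^bsub>?F\<^esub> (g \<otimes>\<^bsub>?F\<^esub> h)" for f g h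
  proof
    fix w :: "'x list"
    let ?n = "length w"
    \<comment> \<open>The word is cut into pieces of lengths j, k and the remainder; both
      bracketings sum over the same pairs of cuts.\<close>
    let ?G = "\<lambda>j k. f (take j w) * g (take k (drop j w)) * h (drop (j + k) w)"
    have "(f \<otimes>\<^bsub>?F\<^esub> g \<otimes>\<^bsub>?F\<^esub> h) w = (\<Sum>i\<le>?n. \<Sum>j\<le>i. ?G j (i - j))"
      unfolding free_mult
    proof (intro sum.cong refl)
      fix i assume i: "i \<in> {..?n}"
      have "(\<Sum>j\<le>length (take i w). f (take j (take i w)) * g (drop j (take i w)) * h (drop i w)) =
          (\<Sum>j\<le>i. ?G j (i - j))"
        using i by (intro sum.cong) (auto simp: drop_take min_absorb1)
      then show "(\<Sum>j\<le>length (take i w). f (take j (take i w)) * g (drop j (take i w))) * h (drop i w) =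
          (\<Sum>j\<le>i. ?G j (i - j))"
        by (simp only: sum_distrib_right)
    qed
    also have "\<dots> = (\<Sum>(j, k)\<in>{(j, k). j + k \<le> ?n}. ?G j k)"
      by (rule sum.triangle_reindex_eq[symmetric])
    also have "{(j, k). j + k \<le> ?n} = (SIGMA j:{..?n}. {..?n - j})"
      by auto
    also have "(\<Sum>(j, k)\<in>(SIGMA j:{..?n}. {..?n - j}). ?G j k) = (\<Sum>j\<le>?n. \<Sum>k\<le>?n - j. ?G j k)"
      by (rule sum.Sigma[symmetric]) auto
    also have "\<dots> = (f \<otimes>\<^bsub>?F\<^esub> (g \<otimes>\<^bsub>?F\<^esub> h)) w"
      by (simp add: free_mult sum_distrib_left mult.assoc add.commute)
    finally show "(f \<otimes>\<^bsub>?F\<^esub> g \<otimes>\<^bsub>?F\<^esub> h) w = (f \<otimes>\<^bsub>?F\<^esub> (g \<otimes>\<^bsub>?F\<^esub> h)) w" .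
  qed
  have l_one: "\<one>\<^bsub>?F\<^esub> \<otimes>\<^bsub>?F\<^esub> f = f" for f
  proof
    fix w :: "'x list"
    have "(\<one>\<^bsub>?F\<^esub> \<otimes>\<^bsub>?F\<^esub> f) w = (\<Sum>i\<le>length w. if i = 0 then f w else 0)"
      unfolding free_mult by (intro sum.cong) (auto simp: word_def)
    then show "(\<one>\<^bsub>?F\<^esub> \<otimes>\<^bsub>?F\<^esub> f) w = f w" by simp
  qed
  have r_one: "f \<otimes>\<^bsub>?F\<^esub> \<one>\<^bsub>?F\<^esub> = f" for f
  proof
    fix w :: "'x list"
    have "(f \<otimes>\<^bsub>?F\<^esub> \<one>\<^bsub>?F\<^esub>) w = (\<Sum>i\<le>length w. if i = length w then f w else 0)"
      unfolding free_mult by (intro sum.cong) (auto simp: word_def)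
    then show "(f \<otimes>\<^bsub>?F\<^esub> \<one>\<^bsub>?F\<^esub>) w = f w" by simp
  qed
  interpret ring ?F
  proof (rule ringI[OF ab])
    show "Group.monoid ?F"
      by (rule monoidI) (use closed assoc l_one r_one in \<open>simp_all del: free_simps(1)\<close>, simp)
  qed (auto simp: fun_eq_iff free_mult algebra_simps sum.distrib)
  show ?thesis
  proof
    show "a \<odot>\<^bsub>?F\<^esub> f \<in> carrier ?F" if "f \<in> carrier ?F" for a f
      using that by (auto intro: finite_subset[of _ "{w. f w \<noteq> 0}"])
  qed (auto simp: fun_eq_iff free_mult algebra_simps sum_distrib_left)
qed

interpretation free: kalg "free_alg :: ('k::field, 'x list \<Rightarrow> 'k) module"
  by (rule kalg_free)

lemma free_minus:
  assumes "f \<in> carrier free_alg" "g \<in> carrier free_alg"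
  shows "f \<ominus>\<^bsub>free_alg\<^esub> g = (\<lambda>w. f w - g w)"
proof -
  have "\<ominus>\<^bsub>free_alg\<^esub> g = (\<lambda>w. - g w)"
    using assms by (intro free.minus_equality) auto
  then show ?thesis
    by (simp add: a_minus_def)
qed

lemma free_minus2:
  assumes "f \<in> carrier free_alg" "g \<in> carrier free_alg" "h \<in> carrier free_alg"
  shows "f \<ominus>\<^bsub>free_alg\<^esub> g \<ominus>\<^bsub>free_alg\<^esub> h = (\<lambda>w. f w - g w - h w)"
  by (subst free_minus[OF free.minus_closed[OF assms(1,2)] assms(3)]) (simp only: free_minus[OF assms(1,2)])

lemma word_mult: "word u \<otimes>\<^bsub>free_alg\<^esub> word v = (word (u @ v) :: 'x list \<Rightarrow> 'k::field)"
proof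
  fix w :: "'x list"
  have "(word u \<otimes>\<^bsub>free_alg\<^esub> word v :: 'x list \<Rightarrow> 'k) w =
      (\<Sum>i\<le>length w. if i = length u then (if w = u @ v then 1 else 0) else 0)"
    unfolding free_mult
  proof (intro sum.cong refl)
    fix i assume "i \<in> {..length w}"
    then have "take i w = u \<and> drop i w = v \<longleftrightarrow> i = length u \<and> w = u @ v"
      by (auto simp: append_eq_conv_conj)
    moreover have "word u (take i w) * word v (drop i w) =
        (if take i w = u \<and> drop i w = v then 1 else (0::'k))"
      by (simp add: word_def)
    ultimately show "word u (take i w) * word v (drop i w) =
        (if i = length u then (if w = u @ v then 1 else 0) else (0::'k))"
      by simp
  qed
  also have "\<dots> = word (u @ v) w"
    by (simp add: word_def)
  finally show "(word u \<otimes>\<^bsub>free_alg\<^esub> word v :: 'x list \<Rightarrow> 'k) w = word (u @ v) w" .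
qed

lemma word_power: "word [x] [^]\<^bsub>free_alg\<^esub> (n::nat) = word (replicate n x)"
  by (induction n) (simp_all add: word_mult replicate_append_same del: replicate_Suc,
      simp add: word_mult replicate_append_same)

lemma free_alg_induct [consumes 1, case_names zero word add]:
  assumes "f \<in> carrier (free_alg :: ('k::field, 'x list \<Rightarrow> 'k) module)"
    and "P (\<lambda>w. 0)" "\<And>c w. P (c \<odot>\<^bsub>free_alg\<^esub> word w)"
    and "\<And>f g. f \<in> carrier free_alg \<Longrightarrow> g \<in> carrier free_alg \<Longrightarrow> P f \<Longrightarrow> P g \<Longrightarrow> P (f \<oplus>\<^bsub>free_alg\<^esub> g)"
  shows "P f"
proof -
  have "P f" if "finite S" "{w. f w \<noteq> 0} \<subseteq> S" for S f
    using that
  proof (induction S arbitrary: f rule: finite_induct)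
    case empty
    then have "f = (\<lambda>w. 0)" by auto
    then show ?case using assms(2) by simp
  next
    case (insert u S)
    have S: "{w. (f(u := 0)) w \<noteq> 0} \<subseteq> S" using insert.prems by auto
    then have "P (f(u := 0))" by (rule insert.IH)
    moreover have "f(u := 0) \<in> carrier free_alg"
      using finite_subset[OF S insert.hyps(1)] by simp
    moreover have "f u \<odot>\<^bsub>free_alg\<^esub> word u \<in> carrier free_alg"
      by (rule free.smult_closed) simp
    ultimately have "P (f(u := 0) \<oplus>\<^bsub>free_alg\<^esub> f u \<odot>\<^bsub>free_alg\<^esub> word u)"
      by (intro assms)
    also have "f(u := 0) \<oplus>\<^bsub>free_alg\<^esub> f u \<odot>\<^bsub>free_alg\<^esub> word u = f"
      by (auto simp: word_def fun_eq_iff)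
    finally show ?case .
  qed
  then show ?thesis using assms(1) by auto
qed

lemma poly_poly_induct [case_names zero monom add]:
  assumes "Pr 0" "\<And>c i j. Pr (monom (monom c i) j)" "\<And>P R. Pr P \<Longrightarrow> Pr R \<Longrightarrow> Pr (P + R)"
  shows "Pr (P :: 'k::field poly poly)"
proof -
  have sum: "Pr (sum f A)" if "\<And>i. i \<in> A \<Longrightarrow> Pr (f i)" for f and A :: "nat set"
    using that by (induction A rule: infinite_finite_induct) (auto simp: assms)
  have "Pr (monom f j)" for f j
  proof -
    have "monom f j = (\<Sum>i\<le>degree f. monom (monom (coeff f i) i) j)"
      by (rule poly_eqI) (simp add: coeff_sum poly_as_sum_of_monoms)
    also have "Pr \<dots>"
      by (rule sum) (rule assms(2))
    finally show ?thesis .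
  qed
  then have "Pr (\<Sum>j\<le>degree P. monom (coeff P j) j)"
    by (intro sum)
  then show ?thesis by (simp add: poly_as_sum_of_monoms)
qed

text \<open>\<open>lift\<close> sends \<open>X\<^sup>i Y\<^sup>j\<close> to the word \<open>U\<^sup>i W\<^sup>j\<close>.\<close>

definition lift :: "'k::field poly poly \<Rightarrow> uw list \<Rightarrow> 'k" where
  "lift P w = (let i = length (takeWhile (\<lambda>x. x = U) w); j = length w - i in
     if w = replicate i U @ replicate j W then coeff (coeff P j) i else 0)"

abbreviation uword :: "nat \<Rightarrow> nat \<Rightarrow> uw list" where
  "uword i j \<equiv> replicate i U @ replicate j W"

lemma takeWhile_uword: "takeWhile (\<lambda>x. x = U) (uword i j) = replicate i U"
  by (induction i) (simp, cases j, auto)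

lemma lift_add: "lift (P + R) = lift P \<oplus>\<^bsub>free_alg\<^esub> lift R"
  by (auto simp: lift_def Let_def fun_eq_iff)

lemma lift_0: "lift 0 = (\<lambda>w. 0)"
  by (auto simp: lift_def Let_def fun_eq_iff)

lemma lift_monom: "lift (monom (monom c i) j) = c \<odot>\<^bsub>free_alg\<^esub> word (uword i j)"
proof
  fix w :: "uw list"
  show "lift (monom (monom c i) j) w = (c \<odot>\<^bsub>free_alg\<^esub> word (uword i j)) w"
  proof (cases "w = uword i j")
    case True
    then show ?thesis
      by (simp add: lift_def Let_def takeWhile_uword word_def)
  next
    case False
    then show ?thesis
      by (auto simp: lift_def Let_def word_def)
  qed
qed

lemma lift_carrier: "lift P \<in> carrier free_alg"
proof (induction P rule: poly_poly_induct)
  case zero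
  then show ?case by (simp add: lift_0)
next
  case (monom c i j)
  then show ?case
    unfolding lift_monom by (rule free.smult_closed) simp
next
  case (add P R)
  then show ?case
    unfolding lift_add by (rule free.a_closed)
qed

section \<open>The presentation of a fibre\<close>

lemma pcompose_monom: "monom c i \<circ>\<^sub>p q = Polynomial.smult c (q ^ i)"
  by (induction i) (simp_all add: monom_0 monom_Suc pcompose_pCons)

lemma linear_monom_power: "[:0, c:] ^ n = monom (c ^ n) n"
  by (induction n) (simp_all add: monom_0 monom_Suc smult_monom one_pCons[symmetric])

lemma lift_smult: "lift (Polynomial.smult [:c:] P) = c \<odot>\<^bsub>free_alg\<^esub> lift P"
  by (auto simp: lift_def Let_def fun_eq_iff)

lemma free_mult_smult_right:
  "f \<otimes>\<^bsub>free_alg\<^esub> (c \<odot>\<^bsub>free_alg\<^esub> g) = c \<odot>\<^bsub>free_alg\<^esub> (f \<otimes>\<^bsub>free_alg\<^esub> g)"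
  by (auto simp: fun_eq_iff free_mult sum_distrib_left mult_ac)

lemma word_closed: "word w \<in> carrier free_alg"
  by simp

lemma smult_word_closed: "c \<odot>\<^bsub>free_alg\<^esub> word w \<in> carrier free_alg"
  by (rule free.smult_closed[OF word_closed])

context ore_hopf_fibre
begin

section \<open>Evaluation of words in the fibre\<close>

context
  assumes d0: "d 0 \<noteq> 0"
begin

text \<open>u = X_1 - a and w = X_2 / d_0. The scaling normalises the commutator: [X_2, u] = D
  equals d_0 u in the fibre, so [w, u] = u.\<close>

definition gen_val :: "uw \<Rightarrow> 'k poly poly" where
  "gen_val = case_uw [:[:- a, 1:]:] (embY [:0, 1 / d 0:])"

definition word_val :: "uw list \<Rightarrow> 'k poly poly" where
  "word_val w = foldr (\<lambda>x P. gen_val x \<star> P) w 1"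

lemma word_val_append: "word_val (u @ v) = word_val u \<star> word_val v"
  by (induction u) (simp_all add: word_val_def ore_assoc)

lemma word_val_U: "word_val (replicate i U) = [:[:- a, 1:] ^ i:]"
  by (induction i) (simp_all add: word_val_def gen_val_def one_pCons[symmetric])

lemma word_val_W: "word_val (replicate j W) = embY ([:0, 1 / d 0:] ^ j)"
  by (induction j) (simp_all add: word_val_def gen_val_def embY_mult[symmetric])

definition ev :: "(uw list \<Rightarrow> 'k) \<Rightarrow> 'k poly poly" where
  "ev f = (\<Sum>w | f w \<noteq> 0. Polynomial.smult [:f w:] (word_val w))"

lemma ev_superset:
  "finite S \<Longrightarrow> {w. f w \<noteq> 0} \<subseteq> S \<Longrightarrow> ev f = (\<Sum>w\<in>S. Polynomial.smult [:f w:] (word_val w))"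
  unfolding ev_def by (rule sum.mono_neutral_left) auto

lemma ev_add:
  assumes "f \<in> carrier free_alg" "g \<in> carrier free_alg"
  shows "ev (f \<oplus>\<^bsub>free_alg\<^esub> g) = ev f + ev g"
proof -
  let ?S = "{w. f w \<noteq> 0} \<union> {w. g w \<noteq> 0}"
  have S: "finite ?S" using assms by simp
  have "ev (f \<oplus>\<^bsub>free_alg\<^esub> g) = (\<Sum>w\<in>?S. Polynomial.smult [:f w + g w:] (word_val w))"
    by (subst ev_superset[OF S]) auto
  also have "\<dots> = (\<Sum>w\<in>?S. Polynomial.smult [:f w:] (word_val w)) + (\<Sum>w\<in>?S. Polynomial.smult [:g w:] (word_val w))"
    by (simp flip: sum.distrib smult_add_left)
  also have "\<dots> = ev f + ev g"
    by (subst (1 2) ev_superset[OF S, symmetric]) auto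
  finally show ?thesis .
qed

lemma ev_smult: "ev (c \<odot>\<^bsub>free_alg\<^esub> f) = Polynomial.smult [:c:] (ev f)"
proof (cases "c = 0")
  case False
  then show ?thesis by (simp add: ev_def poly_smult_sum_right mult.commute)
qed (simp add: ev_def)

lemma ev_word: "ev (word w) = word_val w"
proof -
  have "{v. word w v \<noteq> (0::'k)} = {w}" by (auto simp: word_def)
  then show ?thesis by (simp add: ev_def word_def one_pCons[symmetric])
qed

lemma ev_zero: "ev (\<lambda>w. 0) = 0"
  by (simp add: ev_def)

lemma ev_minus:
  assumes "f \<in> carrier free_alg" "g \<in> carrier free_alg"
  shows "ev (f \<ominus>\<^bsub>free_alg\<^esub> g) = ev f - ev g"
proof -
  have "ev ((f \<ominus>\<^bsub>free_alg\<^esub> g) \<oplus>\<^bsub>free_alg\<^esub> g) = ev (f \<ominus>\<^bsub>free_alg\<^esub> g) + ev g"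
    using assms by (intro ev_add free.minus_closed)
  moreover have "(f \<ominus>\<^bsub>free_alg\<^esub> g) \<oplus>\<^bsub>free_alg\<^esub> g = f"
    by (simp add: free_minus[OF assms])
  ultimately show ?thesis by simp
qed

lemma ev_mult:
  assumes f: "f \<in> carrier free_alg" and g: "g \<in> carrier free_alg"
  shows "ev (f \<otimes>\<^bsub>free_alg\<^esub> g) = ev f \<star> ev g"
  using f
proof (induction f rule: free_alg_induct)
  case zero
  then show ?case
    using free.l_null[OF g] by (simp add: ev_zero)
next
  case (word c u)
  have c: "c \<odot>\<^bsub>free_alg\<^esub> word u \<in> carrier free_alg"
    by (rule free.smult_closed) simp
  show ?case
    using g
  proof (induction g rule: free_alg_induct)
    case zero
    then show ?case
      using free.r_null[OF c] by (simp add: ev_zero)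
  next
    case (word c' v)
    have "(c \<odot>\<^bsub>free_alg\<^esub> word u) \<otimes>\<^bsub>free_alg\<^esub> (c' \<odot>\<^bsub>free_alg\<^esub> word v) =
        c \<odot>\<^bsub>free_alg\<^esub> (c' \<odot>\<^bsub>free_alg\<^esub> word (u @ v))"
      by (simp only: free.smult_mult_left[OF word_closed smult_word_closed]) (simp only: free_mult_smult_right word_mult)
    then show ?case
      by (simp only: ev_smult ev_word word_val_append ore_smult_left ore_smult_const_right)
        (simp add: mult.commute)
  next
    case (add g h)
    then show ?case
      using c by (simp only: free.r_distr free.m_closed ev_add ore_add_right)
  qed
next
  case (add f h)
  then show ?case
    using g by (simp only: free.l_distr free.m_closed ev_add ore_add_left)
qed

text \<open>In a word U^i W^j the powers of X_1 - a stand to the left of those of X_2, so its value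
  is an ordinary product. Hence evaluation after \<open>lift\<close> is a commutative substitution,
  in particular bijective.\<close>

lemma ev_lift: "ev (lift P) = affine (- a) 0 (1 / d 0) P"
proof (induction P rule: poly_poly_induct)
  case zero
  then show ?case by (simp add: lift_0 ev_zero)
next
  case (monom c i j)
  have "monom (monom c i) j = [:monom c i:] * embY (monom 1 j)"
    by (simp add: embY_monom smult_monom one_pCons[symmetric])
  then have "affine (- a) 0 (1 / d 0) (monom (monom c i) j) =
      [:monom c i \<circ>\<^sub>p [:- a, 1:]:] * embY (monom 1 j \<circ>\<^sub>p [:0, 1 / d 0:])"
    by (simp only: affine_mult affine_const affine_embY)
  then show ?case
    by (simp add: lift_monom ev_smult[simplified] ev_word word_val_append word_val_U word_val_W pcompose_monom
        del: free_simps)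
      (simp add: ev_smult ev_word word_val_append word_val_U word_val_W del: free_simps)
next
  case (add P R)
  then show ?case
    by (simp only: lift_add ev_add lift_carrier affine_add)
qed

lemma ev_lift_affine: "ev (lift (affine a 0 (d 0) P)) = P"
  using affine_inverse[of "1 / d 0" "- a" 0 P] d0 by (simp add: ev_lift)

section \<open>The relators and the kernel of evaluation\<close>

abbreviation (input) "r1 \<equiv> word (replicate p U) :: uw list \<Rightarrow> 'k"
abbreviation (input) "r2 \<equiv> (word [W, U] \<ominus>\<^bsub>free_alg\<^esub> word [U, W] \<ominus>\<^bsub>free_alg\<^esub> word [U]) :: uw list \<Rightarrow> 'k"
abbreviation (input) "r3 \<equiv> (word (replicate p W) \<ominus>\<^bsub>free_alg\<^esub> word [W] \<ominus>\<^bsub>free_alg\<^esub>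
  ((\<beta> * inverse (d 0 ^ p)) \<odot>\<^bsub>free_alg\<^esub> word [])) :: uw list \<Rightarrow> 'k"

definition J :: "(uw list \<Rightarrow> 'k) set" where
  "J = Idl\<^bsub>free_alg\<^esub> {r1, r2, r3}"

lemma relators_closed: "r1 \<in> carrier free_alg" "r2 \<in> carrier free_alg" "r3 \<in> carrier free_alg"
  by (intro free.minus_closed word_closed smult_word_closed)+

lemma ideal_J: "ideal J free_alg"
  unfolding J_def using relators_closed by (intro free.genideal_ideal) blast

lemma relators_in_J: "r1 \<in> J" "r2 \<in> J" "r3 \<in> J"
  using free.genideal_self[of "{r1, r2, r3}"] relators_closed unfolding J_def by blast+

interpretation J: ideal J free_alg by (rule ideal_J)

lemma ev_r1: "ev r1 \<in> I"
  unfolding ev_word word_val_U by (rule linear_power_in_I)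

lemma ev_r2: "ev r2 \<in> I"
proof -
  let ?u = "[:[:- a, 1:]:] :: 'k poly poly"
  have w: "embY [:0, 1 / d 0:] = Polynomial.smult [:1 / d 0:] X2"
    by (simp add: X2_def embY_pCons)
  have "ev r2 = word_val ([W] @ [U]) - word_val ([U] @ [W]) - word_val [U]"
    by (simp only: ev_minus ev_word word_closed free.minus_closed append.simps)
  also have "\<dots> = Polynomial.smult [:1 / d 0:] (X2 \<star> ?u - ?u \<star> X2) - ?u"
    by (simp only: word_val_append)
      (simp add: word_val_def gen_val_def w ore_smult_left ore_smult_const_right smult_diff_right mult.commute)
  also have "X2 \<star> ?u - ?u \<star> X2 = [:D:]"
    by (simp add: ore_X2_left ore_X2_right shift_def ore_deriv_eq pderiv_pCons)
  finally have *: "ev r2 = Polynomial.smult [:1 / d 0:] [:D:] - ?u" .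
  obtain h where "D = [:d 0:] * [:- a, 1:] + (monom 1 p - [:\<alpha>:]) * h"
    using D_decomp[OF a e] by blast
  then have "ev r2 = [:[:1 / d 0:] * h:] * [:monom 1 p - [:\<alpha>:]:]"
    unfolding * using d0 by (simp add: smult_add_right mult.commute)
  then show ?thesis
    by (simp only: fib_ideal_I)
qed

text \<open>Substituting Y / d_0 turns Y^p - Y - \<beta> d_0^{-p} into d_0^{-p}
  \<open>Q \<beta>\<close>; this fixes the constant in the third relation.\<close>

lemma ev_r3: "ev r3 \<in> I"
proof -
  have "ev r3 = word_val (replicate p W) - word_val (replicate 1 W) -
      Polynomial.smult [:\<beta> * inverse (d 0 ^ p):] (word_val (replicate 0 W))"
    by (simp only: ev_minus ev_smult ev_word word_closed smult_word_closed free.minus_closed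
        replicate.simps One_nat_def)
  also have "\<dots> = embY ([:0, 1 / d 0:] ^ p - [:0, 1 / d 0:] - [:\<beta> * inverse (d 0 ^ p):])"
    unfolding word_val_W by (simp add: embY_diff embY_pCons[of _ 0])
  also have "[:0, 1 / d 0:] ^ p - [:0, 1 / d 0:] - [:\<beta> * inverse (d 0 ^ p):] =
      Polynomial.smult (inverse (d 0 ^ p)) (Q \<beta>)"
  proof -
    have "[:0, 1 / d 0:] ^ p = monom (inverse (d 0 ^ p)) p"
      by (simp add: linear_monom_power power_one_over inverse_eq_divide)
    moreover have "[:0, 1 / d 0:] = monom (inverse (d 0 ^ p) * d 0 ^ (p - 1)) 1"
    proof -
      have "d 0 ^ p = d 0 * d 0 ^ (p - 1)"
        using p_pos by (cases p) auto
      then show ?thesis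
        using d0 by (simp add: monom_Suc monom_0) (simp add: field_simps)
    qed
    moreover have "[:\<beta> * inverse (d 0 ^ p):] = Polynomial.smult (inverse (d 0 ^ p)) [:\<beta>:]"
      by simp
    ultimately show ?thesis
      by (simp only: Q_def Q0_def smult_diff_right smult_monom mult.right_neutral)
  qed
  finally have "ev r3 = [:[:inverse (d 0 ^ p):]:] * embY (Q \<beta>)"
    by (simp add: embY_smult)
  then show ?thesis
    by (simp only: fib_ideal_I)
qed

lemma ev_surj_hom:
  "(\<lambda>f. cls (ev f)) \<in> Ring.ring_hom free_alg F" "(\<lambda>f. cls (ev f)) ` carrier free_alg = carrier F"
proof -
  show "(\<lambda>f. cls (ev f)) \<in> Ring.ring_hom free_alg F"
  proof (rule ring_hom_memI)
    show "cls (ev \<one>\<^bsub>free_alg\<^esub>) = \<one>\<^bsub>F\<^esub>"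
      using ev_word[of "[]"] by (simp add: word_val_def one_F)
  qed (simp_all only: ev_mult ev_add mult_F add_F cls_carrier)
  show "(\<lambda>f. cls (ev f)) ` carrier free_alg = carrier F"
  proof (intro equalityI subsetI)
    fix X assume "X \<in> carrier F"
    then obtain P where "X = cls P" by (auto simp: carrier_F)
    then show "X \<in> (\<lambda>f. cls (ev f)) ` carrier free_alg"
      by (intro image_eqI[of _ _ "lift (affine a 0 (d 0) P)"]) (simp_all only: ev_lift_affine lift_carrier)
  qed (auto simp only: cls_carrier)
qed

lemma J_subset_kernel: "f \<in> J \<Longrightarrow> ev f \<in> I"
proof -
  interpret hom: ring_hom_ring free_alg F "\<lambda>f. cls (ev f)"
    by (rule ring_hom_ringI2[OF free.ring_axioms F.ring_axioms ev_surj_hom(1)])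
  have ker: "f \<in> a_kernel free_alg F (\<lambda>f. cls (ev f)) \<longleftrightarrow> f \<in> carrier free_alg \<and> ev f \<in> I" for f
    unfolding a_kernel_def' zero_F cls_eq by simp
  have "J \<subseteq> a_kernel free_alg F (\<lambda>f. cls (ev f))"
    unfolding J_def
  proof (rule free.genideal_minimal[OF hom.kernel_is_ideal], rule subsetI)
    fix r assume "r \<in> {r1, r2, r3}"
    then show "r \<in> a_kernel free_alg F (\<lambda>f. cls (ev f))"
      unfolding ker using relators_closed ev_r1 ev_r2 ev_r3 by blast
  qed
  then show "f \<in> J \<Longrightarrow> ev f \<in> I"
    using ker by blast
qed

text \<open>Congruent modulo the relators to a combination of words U^i W^j. This is the spanning
  half of the presentation.\<close>

definition reducible :: "(uw list \<Rightarrow> 'k) \<Rightarrow> bool" where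
  "reducible f \<longleftrightarrow> (\<exists>P. \<exists>j\<in>J. f = lift P \<oplus>\<^bsub>free_alg\<^esub> j)"

lemma reducible_lift: "reducible (lift P)"
  unfolding reducible_def using J.zero_closed by (intro exI[of _ P] bexI[of _ "\<lambda>w. 0"]) auto

lemma reducible_J: "j \<in> J \<Longrightarrow> reducible j"
  unfolding reducible_def by (intro exI[of _ 0] bexI[of _ j]) (auto simp: lift_0)

lemma reducible_add:
  assumes "reducible f" "reducible g"
  shows "reducible (f \<oplus>\<^bsub>free_alg\<^esub> g)"
proof -
  obtain P j R k where "j \<in> J" "f = lift P \<oplus>\<^bsub>free_alg\<^esub> j" "k \<in> J" "g = lift R \<oplus>\<^bsub>free_alg\<^esub> k"
    using assms unfolding reducible_def by blast
  then have "f \<oplus>\<^bsub>free_alg\<^esub> g = lift (P + R) \<oplus>\<^bsub>free_alg\<^esub> (j \<oplus>\<^bsub>free_alg\<^esub> k)" "j \<oplus>\<^bsub>free_alg\<^esub> k \<in> J"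
    by (simp_all only: lift_add J.a_closed) (simp add: fun_eq_iff)
  then show ?thesis
    unfolding reducible_def by blast
qed

lemma reducible_smult:
  assumes "reducible f"
  shows "reducible (c \<odot>\<^bsub>free_alg\<^esub> f)"
proof -
  obtain P j where j: "j \<in> J" "f = lift P \<oplus>\<^bsub>free_alg\<^esub> j"
    using assms unfolding reducible_def by blast
  then have "c \<odot>\<^bsub>free_alg\<^esub> f = lift (Polynomial.smult [:c:] P) \<oplus>\<^bsub>free_alg\<^esub> c \<odot>\<^bsub>free_alg\<^esub> j"
    by (simp only: lift_smult free.smult_r_distr lift_carrier J.Icarr)
  moreover have "c \<odot>\<^bsub>free_alg\<^esub> j \<in> J"
    by (rule free.smult_ideal[OF ideal_J j(1)])
  ultimately show ?thesis
    unfolding reducible_def by blast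
qed

lemma reducible_mult:
  assumes "\<And>i j. reducible (word x \<otimes>\<^bsub>free_alg\<^esub> word (uword i j))" and f: "reducible f"
  shows "reducible (word x \<otimes>\<^bsub>free_alg\<^esub> f)"
proof -
  have lift: "reducible (word x \<otimes>\<^bsub>free_alg\<^esub> lift P)" for P
  proof (induction P rule: poly_poly_induct)
    case zero
    have "word x \<otimes>\<^bsub>free_alg\<^esub> lift 0 = lift 0"
      using free.r_null[OF word_closed[of x]] by (simp add: lift_0)
    then show ?case using reducible_lift by metis
  next
    case (monom c i j)
    then show ?case
      unfolding lift_monom free_mult_smult_right by (intro reducible_smult assms)
  next
    case (add P R)
    then show ?case
      unfolding lift_add free.r_distr[OF lift_carrier lift_carrier word_closed] by (rule reducible_add)
  qed
  obtain P j where j: "j \<in> J" "f = lift P \<oplus>\<^bsub>free_alg\<^esub> j"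
    using f unfolding reducible_def by blast
  then have "word x \<otimes>\<^bsub>free_alg\<^esub> f = word x \<otimes>\<^bsub>free_alg\<^esub> lift P \<oplus>\<^bsub>free_alg\<^esub> word x \<otimes>\<^bsub>free_alg\<^esub> j"
    by (simp only: free.r_distr lift_carrier J.Icarr word_closed)
  then show ?thesis
    using reducible_add[OF lift reducible_J[OF J.I_l_closed[OF j(1) word_closed]]] by simp
qed

lemma reducible_uword: "reducible (word (uword i j))"
proof -
  have "lift (monom (monom 1 i) j) = (word (uword i j) :: uw list \<Rightarrow> 'k)"
    unfolding lift_monom by simp
  then show ?thesis using reducible_lift by metis
qed

lemma reducible_U: "reducible f \<Longrightarrow> reducible (word [U] \<otimes>\<^bsub>free_alg\<^esub> f)"
proof (rule reducible_mult)
  show "reducible (word [U] \<otimes>\<^bsub>free_alg\<^esub> word (uword i j))" for i j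
    unfolding word_mult using reducible_uword[of "Suc i" j] by simp
qed

text \<open>The second relator rewrites W U as U W + U. Induction on the number of letters U moves W
  to the right past all of them.\<close>

lemma reducible_W: "reducible f \<Longrightarrow> reducible (word [W] \<otimes>\<^bsub>free_alg\<^esub> f)"
proof (rule reducible_mult)
  show "reducible (word [W] \<otimes>\<^bsub>free_alg\<^esub> word (uword i j))" for i j
  proof (induction i)
    case 0
    then show ?case
      unfolding word_mult using reducible_uword[of 0 "Suc j"] by simp
  next
    case (Suc i)
    let ?v = "uword i j"
    have "word [W] \<otimes>\<^bsub>free_alg\<^esub> word (uword (Suc i) j) =
        r2 \<otimes>\<^bsub>free_alg\<^esub> word ?v \<oplus>\<^bsub>free_alg\<^esub>
        (word [U] \<otimes>\<^bsub>free_alg\<^esub> (word [W] \<otimes>\<^bsub>free_alg\<^esub> word ?v) \<oplus>\<^bsub>free_alg\<^esub> word (uword (Suc i) j))"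
    proof -
      have sub: "(\<lambda>w. f w - g w) \<otimes>\<^bsub>free_alg\<^esub> h = (\<lambda>w. (f \<otimes>\<^bsub>free_alg\<^esub> h) w - (g \<otimes>\<^bsub>free_alg\<^esub> h) w)"
        for f g h :: "uw list \<Rightarrow> 'k"
        by (simp add: fun_eq_iff free_mult left_diff_distrib sum_subtractf)
      show ?thesis
        unfolding free_minus2[OF word_closed word_closed word_closed] sub word_mult
        by (simp add: fun_eq_iff)
    qed
    moreover have "r2 \<otimes>\<^bsub>free_alg\<^esub> word ?v \<in> J"
      by (rule J.I_r_closed[OF relators_in_J(2) word_closed])
    ultimately show ?case
      by (simp only: reducible_add reducible_J reducible_U Suc reducible_uword)
  qed
qed

lemma all_reducible: "f \<in> carrier free_alg \<Longrightarrow> reducible f"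
proof (induction f rule: free_alg_induct)
  case zero
  show ?case using reducible_lift[of 0] by (simp add: lift_0)
next
  case (word c w)
  have "reducible (word w)"
  proof (induction w)
    case Nil
    then show ?case using reducible_uword[of 0 0] by simp
  next
    case (Cons x w)
    have "word (x # w) = word [x] \<otimes>\<^bsub>free_alg\<^esub> (word w :: uw list \<Rightarrow> 'k)"
      by (simp add: word_mult)
    with Cons show ?case
      using reducible_U reducible_W by (cases x) simp_all
  qed
  then show ?case by (rule reducible_smult)
next
  case (add f g)
  then show ?case by (intro reducible_add)
qed

lemma lift_in_J:
  assumes "affine (- a) 0 (1 / d 0) P \<in> I"
  shows "lift P \<in> J"
proof -
  define r where "r = monom 1 p - monom 1 1 - [:\<beta> * inverse (d 0 ^ p):]"
  have 1: "lift (A * [:[:0, 1:] ^ p:]) \<in> J" for A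
  proof (induction A rule: poly_poly_induct)
    case zero
    then show ?case using J.zero_closed by (simp add: lift_0)
  next
    case (monom c i j)
    have "monom (monom c i) j * [:[:0, 1:] ^ p:] = monom (monom c (p + i)) j"
      by (simp add: smult_monom mult_monom flip: monom_altdef[of 1, simplified])
    moreover have "word (uword (p + i) j) = r1 \<otimes>\<^bsub>free_alg\<^esub> word (uword i j)"
      by (simp only: word_mult replicate_add append_assoc)
    ultimately have "lift (monom (monom c i) j * [:[:0, 1:] ^ p:]) =
        c \<odot>\<^bsub>free_alg\<^esub> (r1 \<otimes>\<^bsub>free_alg\<^esub> word (uword i j))"
      by (simp only: lift_monom)
    also have "\<dots> \<in> J"
      by (intro free.smult_ideal[OF ideal_J] J.I_r_closed relators_in_J word_closed)
    finally show ?case .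
  next
    case (add A B)
    then show ?case
      unfolding distrib_right lift_add by (rule J.a_closed)
  qed
  have 2: "lift (B * embY r) \<in> J" for B
  proof (induction B rule: poly_poly_induct)
    case zero
    then show ?case using J.zero_closed by (simp add: lift_0)
  next
    case (monom c i j)
    let ?\<gamma> = "\<beta> * inverse (d 0 ^ p)"
    have "monom (monom c i) j * embY r + monom (monom c i) (j + 1) + monom (monom (c * ?\<gamma>) i) j =
        monom (monom c i) (j + p)"
      by (simp add: r_def embY_diff embY_monom embY_pCons mult_monom right_diff_distrib
          one_pCons[symmetric] smult_monom mult.commute) (simp add: add.commute)
    then have eq: "lift (monom (monom c i) j * embY r) \<oplus>\<^bsub>free_alg\<^esub> lift (monom (monom c i) (j + 1)) \<oplus>\<^bsub>free_alg\<^esub>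
        lift (monom (monom (c * ?\<gamma>) i) j) = lift (monom (monom c i) (j + p))"
      by (simp only: lift_add[symmetric])
    have r3: "word (uword i j) \<otimes>\<^bsub>free_alg\<^esub> r3 = (\<lambda>w. word (uword i (j + p)) w - word (uword i (j + 1)) w -
        ?\<gamma> * word (uword i j) w)"
    proof -
      have sub: "h \<otimes>\<^bsub>free_alg\<^esub> (\<lambda>w. f w - g w) = (\<lambda>w. (h \<otimes>\<^bsub>free_alg\<^esub> f) w - (h \<otimes>\<^bsub>free_alg\<^esub> g) w)"
        for f g h :: "uw list \<Rightarrow> 'k"
        by (simp add: fun_eq_iff free_mult right_diff_distrib sum_subtractf)
      have "replicate (j + 1) W = replicate j W @ [W]"
        by (simp add: replicate_append_same)
      then show ?thesis
        unfolding free_minus2[OF word_closed word_closed smult_word_closed] sub free_mult_smult_right word_mult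
        by (simp add: replicate_add replicate_append_same)
    qed
    have "lift (monom (monom c i) j * embY r) = c \<odot>\<^bsub>free_alg\<^esub> (word (uword i j) \<otimes>\<^bsub>free_alg\<^esub> r3)"
    proof
      fix w
      show "lift (monom (monom c i) j * embY r) w = (c \<odot>\<^bsub>free_alg\<^esub> (word (uword i j) \<otimes>\<^bsub>free_alg\<^esub> r3)) w"
        using fun_cong[OF eq, of w] unfolding r3 lift_monom by (simp add: algebra_simps)
    qed
    also have "\<dots> \<in> J"
      by (intro free.smult_ideal[OF ideal_J] J.I_l_closed relators_in_J word_closed)
    finally show ?case .
  next
    case (add A B)
    then show ?case
      unfolding distrib_right lift_add by (rule J.a_closed)
  qed
  obtain A B where AB: "affine (- a) 0 (1 / d 0) P = A * [:monom 1 p - [:\<alpha>:]:] + B * embY (Q \<beta>)"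
    using assms by (auto simp: fib_ideal_def)
  have "P = affine a 0 (d 0) (affine (- a) 0 (1 / d 0) P)"
    using affine_inverse[OF d0, of a 0 P] by simp
  also have "\<dots> = affine a 0 (d 0) A * affine a 0 (d 0) [:monom 1 p - [:\<alpha>:]:] +
      affine a 0 (d 0) B * affine a 0 (d 0) (embY (Q \<beta>))"
    unfolding AB by (simp only: affine_add affine_mult)
  also have "affine a 0 (d 0) [:monom 1 p - [:\<alpha>:]:] = [:[:0, 1:] ^ p:]"
  proof -
    have "monom 1 p - [:\<alpha>:] = [:- a, 1:] ^ p"
      using linear_power_p[of a] a by simp
    then show ?thesis
      by (simp add: affine_const pcompose_power pcompose_pCons)
  qed
  also have "affine a 0 (d 0) (embY (Q \<beta>)) = [:[:d 0 ^ p:]:] * embY r"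
  proof -
    have "Q \<beta> \<circ>\<^sub>p [:0, d 0:] = Polynomial.smult (d 0 ^ p) r"
    proof (rule poly_eqI)
      fix n
      have "d 0 ^ (p - 1) * d 0 = d 0 ^ p"
        using p_pos by (cases p) auto
      then show "coeff (Q \<beta> \<circ>\<^sub>p [:0, d 0:]) n = coeff (Polynomial.smult (d 0 ^ p) r) n"
        using d0 by (auto simp: coeff_pcompose_linear Q_def Q0_def r_def coeff_pCons algebra_simps
            power_add split: nat.splits)
    qed
    then show ?thesis
      by (simp add: affine_embY embY_smult)
  qed
  finally have "P = affine a 0 (d 0) A * [:[:0, 1:] ^ p:] + (affine a 0 (d 0) B * [:[:d 0 ^ p:]:]) * embY r"
    by (simp only: mult.assoc)
  then have "lift P = lift (affine a 0 (d 0) A * [:[:0, 1:] ^ p:]) \<oplus>\<^bsub>free_alg\<^esub>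
      lift ((affine a 0 (d 0) B * [:[:d 0 ^ p:]:]) * embY r)"
    by (metis lift_add)
  also have "\<dots> \<in> J"
    by (intro J.a_closed 1 2)
  finally show ?thesis .
qed

text \<open>Modulo J the element is some \<open>lift P\<close>, whose value is an affine
  substitution of P; this reduces the kernel to the commutative computation in
  \<open>lift_in_J\<close>.\<close>

lemma kernel_ev:
  assumes f: "f \<in> carrier free_alg" "ev f \<in> I"
  shows "f \<in> J"
proof -
  obtain P j where j: "j \<in> J" "f = lift P \<oplus>\<^bsub>free_alg\<^esub> j"
    using all_reducible[OF f(1)] unfolding reducible_def by blast
  have "ev f = ev (lift P) + ev j"
    unfolding j(2) by (intro ev_add lift_carrier J.Icarr[OF j(1)])
  then have "ev (lift P) = ev f - ev j" by simp
  then have "affine (- a) 0 (1 / d 0) P \<in> I"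
    using fib_ideal_diff[OF f(2) J_subset_kernel[OF j(1)]] by (simp only: ev_lift)
  then show ?thesis
    unfolding j(2) by (intro J.a_closed lift_in_J j(1))
qed

lemma fibre_presentation:
  "presented_by F (case_uw (cls [:[:- a, 1:]:]) (cls (embY [:0, 1 / d 0:]))) {r1, r2, r3}"
proof -
  have iso: "\<exists>\<phi>\<in>alg_iso (quot_alg free_alg J) F. \<forall>f\<in>carrier free_alg. \<phi> (J +>\<^bsub>free_alg\<^esub> f) = cls (ev f)"
  proof (rule free.first_isomorphism(2)[OF F.ring_axioms ev_surj_hom])
    show "cls (ev (c \<odot>\<^bsub>free_alg\<^esub> f)) = c \<odot>\<^bsub>F\<^esub> cls (ev f)" for c f
      by (simp only: ev_smult smult_F)
    show "cls (ev f) = \<zero>\<^bsub>F\<^esub> \<longleftrightarrow> f \<in> J" if "f \<in> carrier free_alg" for f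
      unfolding zero_F cls_eq using kernel_ev[OF that] J_subset_kernel by auto
    show "J \<subseteq> carrier free_alg" by (rule J.a_subset)
  qed
  have gen: "cls (ev (word [x])) = case_uw (cls [:[:- a, 1:]:]) (cls (embY [:0, 1 / d 0:])) x" for x
    unfolding ev_word by (cases x) (simp_all add: word_val_def gen_val_def)
  obtain \<phi> where \<phi>: "\<phi> \<in> alg_iso (quot_alg free_alg J) F"
    "\<forall>f\<in>carrier free_alg. \<phi> (J +>\<^bsub>free_alg\<^esub> f) = cls (ev f)"
    using iso by (elim bexE)
  show ?thesis
    unfolding presented_by_def J_def[symmetric] free_gen_word
  proof (intro bexI[OF _ \<phi>(1)] allI)
    show "\<phi> (J +>\<^bsub>free_alg\<^esub> word [x]) =
        case_uw (cls [:[:- a, 1:]:]) (cls (embY [:0, 1 / d 0:])) x" for x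
      unfolding gen[symmetric] by (rule bspec[OF \<phi>(2) word_closed])
  qed
qed

end

end

section \<open>The non-Azumaya locus\<close>

context ore_hopf
begin

section \<open>The polynomial that cuts out the non-Azumaya locus\<close>

lemma eval_xy_eq_poly_evX: "eval_xy a \<rho> P = poly (evX a P) \<rho>"
  by (induction P) (simp_all add: eval_xy_def evX_def map_poly_pCons)

lemma evX_eq_0_iff: "evX a P = 0 \<longleftrightarrow> (\<forall>\<rho>. eval_xy a \<rho> P = 0)"
  using exists_poly_nonzero[of "evX a P"] by (auto simp: eval_xy_eq_poly_evX)

lemma finsum_H: "finite A \<Longrightarrow> finsum H f A = sum f A"
  by (induction A rule: finite_induct) simp_all

text \<open>D(a)^p written as a polynomial in \<alpha> = a^p.\<close>

definition disc :: "'k poly" where "disc = [:0, d 0 ^ p:] + dp ^ p"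

lemma poly_disc: "poly disc \<alpha> = d 0 ^ p * \<alpha> + poly dp \<alpha> ^ p"
  by (simp add: disc_def poly_power mult.commute)

lemma disc_nonzero: "disc \<noteq> 0"
proof -
  obtain t where "poly D t \<noteq> 0"
    using exists_poly_nonzero[OF D_nz] by blast
  then have "poly D t ^ p \<noteq> 0" by simp
  then have "poly disc (t ^ p) \<noteq> 0"
    unfolding poly_disc poly_D_power[OF refl] .
  then show ?thesis by auto
qed

lemma disc_element:
  "(d 0 ^ p \<odot> z1 H p) \<oplus> (alg_eval H (d_poly p d) (z1 H p) [^] p) = center_emb [:disc:]"
proof -
  have "alg_eval H (d_poly p d) (z1 H p) =
      (\<Sum>i\<le>degree dp. Polynomial.smult [:coeff dp i:] [:monom 1 p ^ i:])"
    by (simp add: alg_eval_def dp_def z1_eq pow_const_H finsum_H)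
  also have "\<dots> = [:\<Sum>i\<le>degree dp. monom (coeff dp i) i \<circ>\<^sub>p monom 1 p:]"
    by (rule poly_eqI) (simp add: coeff_sum pcompose_monom coeff_pCons split: nat.splits)
  also have "\<dots> = [:frob dp:]"
    by (simp add: frob_def pcompose_sum[symmetric] poly_as_sum_of_monoms)
  finally have *: "alg_eval H (d_poly p d) (z1 H p) = center_emb [:dp:]" by simp
  have "d 0 ^ p \<odot> z1 H p = center_emb [:[:0, d 0 ^ p:]:]"
    by (simp add: z1_eq frob_def pcompose_pCons mult.commute)
  then show ?thesis
    by (simp only: * pow_H add_H center_emb_add[symmetric]) (simp add: disc_def poly_const_pow)
qed

text \<open>Each root of f, counted with multiplicity, is matched with one factor G, because G is
  divisible by the corresponding X - \<alpha>.\<close>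

lemma dvd_power_of_roots:
  assumes "f \<noteq> 0" "\<And>\<alpha>. poly f \<alpha> = 0 \<Longrightarrow> evX \<alpha> G = 0"
  shows "\<exists>B. G ^ degree f = Polynomial.smult f B"
  using assms
proof (induction "degree f" arbitrary: f)
  case 0
  then obtain c where "f = [:c:]" "c \<noteq> 0"
    by (metis degree_0_id pCons_0_0)
  then show ?case
    by (intro exI[of _ "[:[:1 / c:]:]"]) (simp add: one_pCons[symmetric])
next
  case (Suc n)
  obtain \<alpha> where \<alpha>: "poly f \<alpha> = 0"
    using alg_closed_imp_poly_has_root[of f] Suc(2) by auto
  then obtain g where g: "f = [:- \<alpha>, 1:] * g"
    by (metis dvdE poly_eq_0_iff_dvd)
  with Suc have g': "g \<noteq> 0" "n = degree g"
    by (auto simp: degree_mult_eq simp del: mult_pCons_left)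
  have "evX \<sigma> G = 0" if "poly g \<sigma> = 0" for \<sigma>
    using that Suc.prems(2) by (simp add: g)
  then obtain B where "G ^ degree g = Polynomial.smult g B"
    using Suc.hyps(1)[OF g'(2,1)] by blast
  moreover obtain S where "G = Polynomial.smult [:- \<alpha>, 1:] S"
    using evX_eq_0_imp[OF Suc.prems(2)[OF \<alpha>]] by blast
  moreover have "degree f = Suc (degree g)"
    using Suc(2) g'(2) by simp
  ultimately have "G ^ degree f = Polynomial.smult f (S * B)"
    unfolding g by (metis mult_smult_left mult_smult_right power_Suc smult_smult)
  then show ?case by blast
qed

section \<open>The locus as a closed set and its decomposition into lines\<close>

lemma fibre_iff:
  "fibre H (pt \<alpha> \<beta>) \<cong>\<^sub>k module_mat TYPE('k) p p \<longleftrightarrow> poly disc \<alpha> \<noteq> 0"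
  unfolding fibre_eq fibre_azumaya_iff poly_disc ..

lemma pt_in_non_azumaya_iff: "pt \<alpha> \<beta> \<in> non_azumaya_locus H p \<longleftrightarrow> poly disc \<alpha> = 0"
proof -
  have "pt \<alpha> \<beta> \<in> maxspec Z"
    using maximal_pt by (simp add: maxspec_def)
  then show ?thesis
    unfolding non_azumaya_locus_def azumaya_locus_def by (simp add: fibre_iff)
qed

lemma non_azumaya_eq: "non_azumaya_locus H p = {pt \<alpha> \<beta> |\<alpha> \<beta>. poly disc \<alpha> = 0}"
proof -
  have "non_azumaya_locus H p \<subseteq> {pt \<alpha> \<beta> |\<alpha> \<beta>. True}"
    unfolding maxspec_Z[symmetric] non_azumaya_locus_def by (rule Diff_subset)
  then have "non_azumaya_locus H p \<subseteq> {pt \<alpha> \<beta> |\<alpha> \<beta>. poly disc \<alpha> = 0}"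
    using pt_in_non_azumaya_iff by blast
  moreover have "{pt \<alpha> \<beta> |\<alpha> \<beta>. poly disc \<alpha> = 0} \<subseteq> non_azumaya_locus H p"
    using pt_in_non_azumaya_iff by blast
  ultimately show ?thesis by (rule equalityI)
qed

lemma pt_eq_iff: "pt \<alpha> \<beta> = pt \<alpha>' \<beta>' \<longleftrightarrow> \<alpha> = \<alpha>' \<and> \<beta> = \<beta>'"
proof
  assume eq: "pt \<alpha> \<beta> = pt \<alpha>' \<beta>'"
  have "center_emb [:[:- \<alpha>, 1:]:] \<in> pt \<alpha>' \<beta>'" "center_emb (embY [:- \<beta>, 1:]) \<in> pt \<alpha>' \<beta>'"
    unfolding eq[symmetric] by (simp_all only: center_emb_in_pt eval_xy_const eval_xy_embY) simp_all
  then show "\<alpha> = \<alpha>' \<and> \<beta> = \<beta>'"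
    unfolding center_emb_in_pt by simp
qed simp

lemma radical_disc:
  "radical Z (Idl\<^bsub>Z\<^esub> {center_emb [:disc:]}) = center_emb ` {G. \<forall>\<alpha>. poly disc \<alpha> = 0 \<longrightarrow> evX \<alpha> G = 0}"
proof -
  \<comment> \<open>The generator is listed twice so that the description of ideals with two
    generators applies.\<close>
  have Idl: "Idl\<^bsub>Z\<^esub> {center_emb [:disc:]} = center_emb ` {A * [:disc:] + B * [:disc:] |A B. True}"
    using Idl_Z_span[of "[:disc:]" "[:disc:]"] by simp
  have "center_emb G \<in> radical Z (Idl\<^bsub>Z\<^esub> {center_emb [:disc:]}) \<longleftrightarrow> (\<forall>\<alpha>. poly disc \<alpha> = 0 \<longrightarrow> evX \<alpha> G = 0)" for G
  proof
    assume "center_emb G \<in> radical Z (Idl\<^bsub>Z\<^esub> {center_emb [:disc:]})"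
    then obtain n where "center_emb (G ^ n) \<in> Idl\<^bsub>Z\<^esub> {center_emb [:disc:]}"
      by (auto simp: radical_def pow_Z)
    then obtain A B where AB: "G ^ n = A * [:disc:] + B * [:disc:]"
      unfolding Idl by auto
    show "\<forall>\<alpha>. poly disc \<alpha> = 0 \<longrightarrow> evX \<alpha> G = 0"
    proof (intro allI impI)
      fix \<alpha> assume \<alpha>: "poly disc \<alpha> = 0"
      have "eval_xy \<alpha> \<rho> G = 0" for \<rho>
      proof -
        have "eval_xy \<alpha> \<rho> (F ^ m) = eval_xy \<alpha> \<rho> F ^ m" for F and m :: nat
          by (induction m) simp_all
        then have "eval_xy \<alpha> \<rho> G ^ n = eval_xy \<alpha> \<rho> (A * [:disc:] + B * [:disc:])"
          by (metis AB)
        also have "\<dots> = 0"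
          using \<alpha> by simp
        finally show ?thesis by simp
      qed
      then show "evX \<alpha> G = 0" by (simp add: evX_eq_0_iff)
    qed
  next
    assume "\<forall>\<alpha>. poly disc \<alpha> = 0 \<longrightarrow> evX \<alpha> G = 0"
    then obtain B where "G ^ degree disc = Polynomial.smult disc B"
      using dvd_power_of_roots[OF disc_nonzero] by blast
    \<comment> \<open>One more factor G is inserted because \<open>radical\<close> requires a
      positive exponent and the degree may be 0.\<close>
    then have "G ^ Suc (degree disc) = (G * B) * [:disc:] + 0 * [:disc:]"
      by (simp add: mult.commute)
    then have "G ^ Suc (degree disc) \<in> {A * [:disc:] + B * [:disc:] |A B. True}"
      by blast
    then have "center_emb (G ^ Suc (degree disc)) \<in> Idl\<^bsub>Z\<^esub> {center_emb [:disc:]}"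
      unfolding Idl by (rule imageI)
    then show "center_emb G \<in> radical Z (Idl\<^bsub>Z\<^esub> {center_emb [:disc:]})"
      unfolding radical_def using pow_Z[of G "Suc (degree disc)"]
      by (intro CollectI conjI exI[of _ "Suc (degree disc)"]) (simp_all del: power_Suc)
  qed
  moreover have "radical Z (Idl\<^bsub>Z\<^esub> {center_emb [:disc:]}) \<subseteq> range center_emb"
    by (auto simp: radical_def)
  ultimately show ?thesis by blast
qed

lemma zero_locus_lines:
  assumes "\<And>\<alpha> \<beta>. K \<subseteq> pt \<alpha> \<beta> \<longleftrightarrow> P \<alpha>"
  shows "zero_locus Z K = {pt \<alpha> \<beta> |\<alpha> \<beta>. P \<alpha>}"
  unfolding zero_locus_def maxspec_Z using assms by auto

text \<open>Vanishing at all points with first coordinate \<alpha> means that G(\<alpha>, Y) has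
  every element of k as a root, hence is zero as k is infinite.\<close>

lemma vanishing_ideal_lines:
  "vanishing_ideal Z {pt \<alpha> \<beta> |\<alpha> \<beta>. P \<alpha>} = center_emb ` {G. \<forall>\<alpha>. P \<alpha> \<longrightarrow> evX \<alpha> G = 0}"
proof (intro equalityI subsetI)
  fix z assume z: "z \<in> vanishing_ideal Z {pt \<alpha> \<beta> |\<alpha> \<beta>. P \<alpha>}"
  then obtain G where G: "z = center_emb G" by (auto simp: vanishing_ideal_def)
  have "center_emb G \<in> pt \<alpha> \<beta>" if "P \<alpha>" for \<alpha> \<beta>
    using z that unfolding vanishing_ideal_def G by blast
  then have "G \<in> {G. \<forall>\<alpha>. P \<alpha> \<longrightarrow> evX \<alpha> G = 0}"
    unfolding center_emb_in_pt evX_eq_0_iff by blast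
  then show "z \<in> center_emb ` {G. \<forall>\<alpha>. P \<alpha> \<longrightarrow> evX \<alpha> G = 0}"
    unfolding G by (rule imageI)
next
  fix z assume "z \<in> center_emb ` {G. \<forall>\<alpha>. P \<alpha> \<longrightarrow> evX \<alpha> G = 0}"
  then obtain G where G: "z = center_emb G" "\<And>\<alpha>. P \<alpha> \<Longrightarrow> evX \<alpha> G = 0" by blast
  have "z \<in> m" if m: "m \<in> {pt \<alpha> \<beta> |\<alpha> \<beta>. P \<alpha>}" for m
  proof -
    obtain \<alpha> \<beta> where "m = pt \<alpha> \<beta>" "P \<alpha>" using m by blast
    then show ?thesis
      using G(2)[of \<alpha>] unfolding G(1) evX_eq_0_iff by simp
  qed
  then show "z \<in> vanishing_ideal Z {pt \<alpha> \<beta> |\<alpha> \<beta>. P \<alpha>}"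
    by (simp add: vanishing_ideal_def G(1))
qed

lemma defining_ideal_non_azumaya:
  "is_defining_ideal Z (non_azumaya_locus H p) (radical Z (Idl\<^bsub>Z\<^esub> {center_emb [:disc:]}))"
proof -
  let ?V = "{G. \<forall>\<alpha>. poly disc \<alpha> = 0 \<longrightarrow> evX \<alpha> G = 0}"
  have "center_emb ` ?V \<subseteq> pt \<alpha> \<beta> \<longleftrightarrow> poly disc \<alpha> = 0" for \<alpha> \<beta>
  proof
    assume sub: "center_emb ` ?V \<subseteq> pt \<alpha> \<beta>"
    have "[:disc:] \<in> ?V" by (simp add: evX_eq_0_iff)
    then have "center_emb [:disc:] \<in> pt \<alpha> \<beta>" using sub by blast
    then show "poly disc \<alpha> = 0" unfolding center_emb_in_pt by simp
  qed (auto simp: evX_eq_0_iff)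
  then have "non_azumaya_locus H p = zero_locus Z (center_emb ` ?V)"
    unfolding non_azumaya_eq by (rule zero_locus_lines[symmetric])
  moreover have "center_emb ` ?V = vanishing_ideal Z (non_azumaya_locus H p)"
    unfolding non_azumaya_eq by (rule vanishing_ideal_lines[symmetric])
  ultimately show ?thesis
    unfolding is_defining_ideal_def radical_disc by blast
qed

lemma ring_poly_alg: "ring (poly_alg :: ('k, 'k poly) module)"
proof (rule ringI)
  show "abelian_group (poly_alg :: ('k, 'k poly) module)"
  proof (rule abelian_groupI)
    fix x :: "'k poly"
    show "\<exists>y\<in>carrier poly_alg. y \<oplus>\<^bsub>poly_alg\<^esub> x = \<zero>\<^bsub>poly_alg\<^esub>"
      by (intro bexI[of _ "- x"]) (auto simp: poly_alg_def)
  qed (auto simp: poly_alg_def add_ac)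
  show "Group.monoid (poly_alg :: ('k, 'k poly) module)"
    by (rule monoidI) (auto simp: poly_alg_def mult_ac)
qed (auto simp: poly_alg_def algebra_simps)

text \<open>Restriction of a central element to X = \<alpha> is \<open>evX\<close> after the inverse
  of \<open>center_emb\<close>. It maps onto k[Y], the coordinate being X_2^p - d_0^{p-1} X_2, and
  its kernel is the vanishing ideal.\<close>

lemma affine_line_fibre: "is_affine_line Z {pt \<alpha> \<beta> |\<beta>. True}"
proof -
  let ?V = "{G. evX \<alpha> G = 0}"
  have mem: "center_emb ` ?V \<subseteq> pt \<alpha>' \<beta> \<longleftrightarrow> \<alpha>' = \<alpha>" for \<alpha>' \<beta>
  proof
    assume sub: "center_emb ` ?V \<subseteq> pt \<alpha>' \<beta>"
    have "[:[:- \<alpha>, 1:]:] \<in> ?V" by (simp add: evX_eq_0_iff)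
    then have "center_emb [:[:- \<alpha>, 1:]:] \<in> pt \<alpha>' \<beta>" using sub by blast
    then show "\<alpha>' = \<alpha>" unfolding center_emb_in_pt by simp
  qed (auto simp: evX_eq_0_iff)
  have pid: "poly_ideal ?V"
    by (auto simp: poly_ideal_def evX_add evX_mult)
  have closed: "zariski_closed Z {pt \<alpha> \<beta> |\<beta>. True}"
    unfolding zariski_closed_def
  proof (intro exI conjI)
    show "ideal (center_emb ` ?V) Z" using pid ideal_Z_iff by blast
    show "{pt \<alpha> \<beta> |\<beta>. True} = zero_locus Z (center_emb ` ?V)"
      using zero_locus_lines[of "center_emb ` ?V" "\<lambda>\<sigma>. \<sigma> = \<alpha>", OF mem] by simp
  qed
  have van: "vanishing_ideal Z {pt \<alpha> \<beta> |\<beta>. True} = center_emb ` ?V"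
    using vanishing_ideal_lines[of "\<lambda>\<sigma>. \<sigma> = \<alpha>"] by simp
  interpret Zk: kalg Z
  proof
    show "a \<odot>\<^bsub>Z\<^esub> x \<in> carrier Z" if "x \<in> carrier Z" for a x
      using that by (auto simp flip: center_emb_smult_const)
  qed (auto simp: ore_smult_left smult_add_right)
  define h where "h z = evX \<alpha> (inv_into UNIV center_emb z)" for z
  have h: "h (center_emb G) = evX \<alpha> G" for G
    by (simp add: h_def inv_into_f_f inj_def)
  have "\<exists>\<phi>\<in>alg_iso (quot_alg Z (center_emb ` ?V)) (poly_alg :: ('k, 'k poly) module).
      \<forall>x\<in>carrier Z. \<phi> (center_emb ` ?V +>\<^bsub>Z\<^esub> x) = h x"
  proof (rule Zk.first_isomorphism(2)[OF ring_poly_alg])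
    show "h \<in> Ring.ring_hom Z poly_alg"
    proof (rule ring_hom_memI)
      have "evX \<alpha> 1 = 1" using evX_embY[of \<alpha> 1] by simp
      then show "h \<one>\<^bsub>Z\<^esub> = \<one>\<^bsub>poly_alg\<^esub>"
        using h[of 1] by (simp add: poly_alg_def)
    qed (auto simp: poly_alg_def h center_emb_ore evX_mult evX_add simp flip: center_emb_add)
    have "h (center_emb (embY q)) = q" for q by (simp add: h)
    then show "h ` carrier Z = carrier poly_alg"
      by (auto simp: poly_alg_def image_iff) metis
    show "h (c \<odot>\<^bsub>Z\<^esub> x) = c \<odot>\<^bsub>poly_alg\<^esub> h x" if "x \<in> carrier Z" for c x
      using that by (auto simp: poly_alg_def h evX_smult simp flip: center_emb_smult_const)
    show "h x = \<zero>\<^bsub>poly_alg\<^esub> \<longleftrightarrow> x \<in> center_emb ` ?V" if "x \<in> carrier Z" for x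
      using that by (auto simp: poly_alg_def h)
  qed auto
  then show ?thesis
    unfolding is_affine_line_def van using closed by (auto simp: alg_isomorphic_def)
qed

text \<open>Frobenius applied termwise to D(t), with t a p-th root of x.\<close>

lemma disc_sum: "(\<Sum>s | d s \<noteq> 0. d s ^ p * x ^ (p ^ s)) = poly disc x"
proof -
  obtain t where t: "t ^ p = x" using exists_root_p by blast
  have "poly D t = (\<Sum>s | d s \<noteq> 0. d s * t ^ (p ^ s))"
    unfolding D_eq[symmetric] by (simp add: poly_sum poly_monom)
  then have "poly D t ^ p = (\<Sum>s | d s \<noteq> 0. (d s * t ^ (p ^ s)) ^ p)"
    using freshmans_dream_sum[where ?'a = 'k, of p] char_p prime_p by metis
  also have "\<dots> = (\<Sum>s | d s \<noteq> 0. d s ^ p * x ^ (p ^ s))"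
    unfolding t[symmetric] power_mult_distrib power_mult[symmetric] by (simp only: mult.commute)
  finally show ?thesis
    unfolding poly_disc poly_D_power[OF t] ..
qed

lemma non_azumaya_lines:
  assumes r: "r = card {x. poly disc x = 0}"
  shows "\<exists>L. (\<forall>i<r. is_affine_line Z (L i)) \<and>
     disjoint_family_on L {..<r} \<and>
     non_azumaya_locus H p = (\<Union>i<r. L i)"
proof -
  have "finite {x. poly disc x = 0}"
    by (rule poly_roots_finite[OF disc_nonzero])
  then obtain f where f: "bij_betw f {..<r} {x. poly disc x = 0}"
    unfolding r using ex_bij_betw_nat_finite by (metis atLeast0LessThan)
  define L where "L i = {pt (f i) \<beta> |\<beta>. True}" for i
  show ?thesis
  proof (intro exI[of _ L] conjI allI impI)
    show "is_affine_line Z (L i)" for i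
      unfolding L_def by (rule affine_line_fibre)
    show "disjoint_family_on L {..<r}"
      unfolding disjoint_family_on_def
    proof (intro ballI impI)
      fix i j assume "i \<in> {..<r}" "j \<in> {..<r}" "i \<noteq> j"
      then have "f i \<noteq> f j"
        using f by (metis bij_betw_def inj_onD)
      then show "L i \<inter> L j = {}"
        by (auto simp: L_def pt_eq_iff)
    qed
    have "{x. poly disc x = 0} = f ` {..<r}"
      using f by (simp add: bij_betw_def)
    then have *: "poly disc \<alpha> = 0 \<longleftrightarrow> (\<exists>i<r. \<alpha> = f i)" for \<alpha>
      by (simp add: set_eq_iff image_iff Bex_def)
    show "non_azumaya_locus H p = (\<Union>i<r. L i)"
      unfolding non_azumaya_eq L_def * by auto
  qed
qed

end

lemma ore_hopf_hopf_ore: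
  fixes d b :: "nat \<Rightarrow> 'k::alg_closed_field"
  assumes "CHAR('k) = p" "p > 0" "finite {s. d s \<noteq> 0}" "\<exists>s. d s \<noteq> 0"
  shows "ore_hopf (hopf_ore p d b c) p d"
  by (rule ore_hopf.intro) (use assms in \<open>simp_all add: hopf_ore_def ore_ext_def Let_def\<close>)

theorem proposition8p2:
  fixes p :: nat
    and d b :: "nat \<Rightarrow> 'k::alg_closed_field"
    and c :: "nat \<Rightarrow> nat \<Rightarrow> 'k"
  defines "H \<equiv> hopf_ore p d b c"
  defines "Z \<equiv> center_alg H"
  defines "\<mm> \<equiv> point_ideal H p d"
  defines "NA \<equiv> non_azumaya_locus H p"
  defines "F \<equiv> (free_alg :: ('k, uw list \<Rightarrow> 'k) module)"
  assumes "CHAR('k) = p" and "p > 0"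
    and "finite {s. d s \<noteq> 0}" and "finite {s. b s \<noteq> 0}"
    and "finite {(s, t). s < t \<and> c s t \<noteq> 0}"
    and "\<exists>s. d s \<noteq> 0"
  shows
    "(\<exists>x\<in>carrier H. \<exists>y\<in>carrier H. x \<otimes>\<^bsub>H\<^esub> y \<noteq> y \<otimes>\<^bsub>H\<^esub> x) \<and>
     (\<exists>\<phi> \<in> alg_iso poly2_alg Z. \<phi> varX = z1 H p \<and> \<phi> varY = z2 H p d) \<and>
     is_defining_ideal Z NA
       (radical Z (Idl\<^bsub>Z\<^esub> {(d 0 ^ p \<odot>\<^bsub>H\<^esub> z1 H p) \<oplus>\<^bsub>H\<^esub> (alg_eval H (d_poly p d) (z1 H p) [^]\<^bsub>H\<^esub> p)})) \<and>
     (\<forall>\<alpha> \<beta>. fibre H (\<mm> \<alpha> \<beta>) \<cong>\<^sub>k module_mat TYPE('k) p p \<longleftrightarrow>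
        d 0 ^ p * \<alpha> + poly (d_poly p d) \<alpha> ^ p \<noteq> 0) \<and>
     (\<forall>\<alpha> \<beta>. \<mm> \<alpha> \<beta> \<in> NA \<longleftrightarrow> d 0 ^ p * \<alpha> + poly (d_poly p d) \<alpha> ^ p = 0) \<and>
     (d 0 = 0 \<longrightarrow>
       (\<forall>\<alpha> \<beta>. \<mm> \<alpha> \<beta> \<in> NA \<longleftrightarrow> poly (d_poly p d) \<alpha> = 0) \<and>
       (\<forall>\<alpha> \<beta>. \<mm> \<alpha> \<beta> \<in> NA \<longrightarrow>
          fibre H (\<mm> \<alpha> \<beta>) \<cong>\<^sub>k
            quot_alg poly2_alg (Idl\<^bsub>poly2_alg :: ('k, 'k poly poly) module\<^esub> {varX ^ p, varY ^ p}) \<and>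
          (\<exists>S :: ('k poly poly set, 'k) module.
             simple_module (fibre H (\<mm> \<alpha> \<beta>)) S \<and> has_dim (fibre H (\<mm> \<alpha> \<beta>)) S 1 \<and>
             (\<forall>M :: ('k poly poly set, 'm) module. simple_module (fibre H (\<mm> \<alpha> \<beta>)) M \<longrightarrow>
                module_isomorphic (fibre H (\<mm> \<alpha> \<beta>)) M S)))) \<and>
     (d 0 \<noteq> 0 \<longrightarrow>
       (\<forall>\<alpha> \<beta>. \<mm> \<alpha> \<beta> \<in> NA \<longrightarrow>
          (\<exists>u \<in> carrier (fibre H (\<mm> \<alpha> \<beta>)). \<exists>w \<in> carrier (fibre H (\<mm> \<alpha> \<beta>)).
             presented_by (fibre H (\<mm> \<alpha> \<beta>)) (case_uw u w)
               {free_gen U [^]\<^bsub>F\<^esub> p,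
                (free_gen W \<otimes>\<^bsub>F\<^esub> free_gen U) \<ominus>\<^bsub>F\<^esub> (free_gen U \<otimes>\<^bsub>F\<^esub> free_gen W) \<ominus>\<^bsub>F\<^esub> free_gen U,
                (free_gen W [^]\<^bsub>F\<^esub> p) \<ominus>\<^bsub>F\<^esub> free_gen W \<ominus>\<^bsub>F\<^esub>
                  ((\<beta> * inverse (d 0 ^ p)) \<odot>\<^bsub>F\<^esub> \<one>\<^bsub>F\<^esub>)}) \<and>
          (\<exists>e. blocks (fibre H (\<mm> \<alpha> \<beta>)) = {e} \<and>
             (\<exists>S :: nat \<Rightarrow> ('k poly poly set, 'k) module.
                (\<forall>i<p. simple_module (fibre H (\<mm> \<alpha> \<beta>)) (S i) \<and> in_block (S i) e \<and>
                   has_dim (fibre H (\<mm> \<alpha> \<beta>)) (S i) 1) \<and>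
                (\<forall>i<p. \<forall>j<p. i \<noteq> j \<longrightarrow> \<not> module_isomorphic (fibre H (\<mm> \<alpha> \<beta>)) (S i) (S j)) \<and>
                (\<forall>M :: ('k poly poly set, 'm) module. simple_module (fibre H (\<mm> \<alpha> \<beta>)) M \<longrightarrow>
                   (\<exists>i<p. module_isomorphic (fibre H (\<mm> \<alpha> \<beta>)) M (S i))))))) \<and>
     (\<forall>r. r = card {x. (\<Sum>s | d s \<noteq> 0. d s ^ p * x ^ (p ^ s)) = 0} \<longrightarrow>
       (\<exists>L. (\<forall>i<r. is_affine_line Z (L i)) \<and> disjoint_family_on L {..<r} \<and> NA = (\<Union>i<r. L i)))"
proof -
  interpret H: ore_hopf H p d
    unfolding H_def using assms by (intro ore_hopf_hopf_ore) auto
  have m: "\<mm> \<alpha> \<beta> = H.pt \<alpha> \<beta>" for \<alpha> \<beta>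
    unfolding \<mm>_def by (rule H.point_ideal_eq)
  have NA_iff: "\<mm> \<alpha> \<beta> \<in> NA \<longleftrightarrow> d 0 ^ p * \<alpha> + poly (d_poly p d) \<alpha> ^ p = 0" for \<alpha> \<beta>
    unfolding m NA_def H.pt_in_non_azumaya_iff H.poly_disc H.dp_def ..
  have NA_fibre: "\<exists>a. ore_hopf_fibre H p d a \<alpha>" if "\<mm> \<alpha> \<beta> \<in> NA" for \<alpha> \<beta>
  proof -
    obtain a where a: "a ^ p = \<alpha>" using H.exists_root_p by blast
    have "poly H.D a ^ p = 0"
      using that unfolding NA_iff H.poly_D_power[OF a] H.dp_def .
    then have "ore_hopf_fibre H p d a \<alpha>"
      by unfold_locales (simp_all add: a)
    then show ?thesis by blast
  qed
  show ?thesis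
  proof (intro conjI impI allI)
    show "\<exists>x\<in>carrier H. \<exists>y\<in>carrier H. x \<otimes>\<^bsub>H\<^esub> y \<noteq> y \<otimes>\<^bsub>H\<^esub> x"
      using H.H_noncommutative by auto
    show "\<exists>\<phi>\<in>alg_iso poly2_alg Z. \<phi> varX = z1 H p \<and> \<phi> varY = z2 H p d"
      unfolding Z_def using H.center_emb_alg_iso H.center_emb_varX H.center_emb_varY by blast
    show "is_defining_ideal Z NA
       (radical Z (Idl\<^bsub>Z\<^esub> {(d 0 ^ p \<odot>\<^bsub>H\<^esub> z1 H p) \<oplus>\<^bsub>H\<^esub> (alg_eval H (d_poly p d) (z1 H p) [^]\<^bsub>H\<^esub> p)}))"
      unfolding H.disc_element Z_def NA_def by (rule H.defining_ideal_non_azumaya)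
    show "fibre H (\<mm> \<alpha> \<beta>) \<cong>\<^sub>k module_mat TYPE('k) p p \<longleftrightarrow>
        d 0 ^ p * \<alpha> + poly (d_poly p d) \<alpha> ^ p \<noteq> 0" for \<alpha> \<beta>
      unfolding m H.fibre_iff H.poly_disc H.dp_def ..
    show "\<mm> \<alpha> \<beta> \<in> NA \<longleftrightarrow> d 0 ^ p * \<alpha> + poly (d_poly p d) \<alpha> ^ p = 0" for \<alpha> \<beta>
      by (rule NA_iff)
    show "\<mm> \<alpha> \<beta> \<in> NA \<longleftrightarrow> poly (d_poly p d) \<alpha> = 0" if "d 0 = 0" for \<alpha> \<beta>
      unfolding NA_iff using that assms(7) by (simp add: zero_power)
  next
    fix \<alpha> \<beta> assume d0: "d 0 = 0" and "\<mm> \<alpha> \<beta> \<in> NA"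
    then obtain a where "ore_hopf_fibre H p d a \<alpha>" using NA_fibre by blast
    then interpret fib: ore_hopf_fibre H p d a \<alpha> \<beta> .
    show "fibre H (\<mm> \<alpha> \<beta>) \<cong>\<^sub>k
        quot_alg poly2_alg (Idl\<^bsub>poly2_alg :: ('k, 'k poly poly) module\<^esub> {varX ^ p, varY ^ p})"
      unfolding m H.fibre_eq by (rule H.fibre_truncated_polynomials[OF fib.a fib.e d0])
    \<comment> \<open>For d_0 = 0 the p-th root of \<beta> is the only root of
      \<open>Q \<beta>\<close>, hence there is a single character.\<close>
    obtain b' where b': "b' ^ p = \<beta>" using H.exists_root_p by blast
    have root: "poly (H.Q \<beta>) \<rho> = 0 \<longleftrightarrow> \<rho> = b'" for \<rho>
      by (rule H.Q_roots_d0[OF d0 b'])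
    show "\<exists>S :: ('k poly poly set, 'k) module.
        simple_module (fibre H (\<mm> \<alpha> \<beta>)) S \<and> has_dim (fibre H (\<mm> \<alpha> \<beta>)) S 1 \<and>
        (\<forall>M :: ('k poly poly set, 'm) module. simple_module (fibre H (\<mm> \<alpha> \<beta>)) M \<longrightarrow>
          module_isomorphic (fibre H (\<mm> \<alpha> \<beta>)) M S)"
      unfolding m H.fibre_eq
    proof (intro exI[of _ "char_mod a b'"] conjI allI impI)
      show "simple_module fib.F (char_mod a b')" "has_dim fib.F (char_mod a b') 1"
        by (rule fib.simple_char_mod fib.has_dim_char_mod, simp add: root)+
      show "module_isomorphic fib.F M (char_mod a b')" if M: "simple_module fib.F M"
        for M :: "('k poly poly set, 'm) module"
      proof -
        obtain \<rho> where "poly (H.Q \<beta>) \<rho> = 0" "module_isomorphic fib.F M (char_mod a \<rho>)"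
          using fib.simple_module_char[OF M] by (elim exE conjE)
        then show ?thesis by (simp only: root)
      qed
    qed
  next
    fix \<alpha> \<beta> assume d0: "d 0 \<noteq> 0" and "\<mm> \<alpha> \<beta> \<in> NA"
    then obtain a where "ore_hopf_fibre H p d a \<alpha>" using NA_fibre by blast
    then interpret fib: ore_hopf_fibre H p d a \<alpha> \<beta> .
    show "\<exists>u \<in> carrier (fibre H (\<mm> \<alpha> \<beta>)). \<exists>w \<in> carrier (fibre H (\<mm> \<alpha> \<beta>)).
        presented_by (fibre H (\<mm> \<alpha> \<beta>)) (case_uw u w)
          {free_gen U [^]\<^bsub>F\<^esub> p,
           (free_gen W \<otimes>\<^bsub>F\<^esub> free_gen U) \<ominus>\<^bsub>F\<^esub> (free_gen U \<otimes>\<^bsub>F\<^esub> free_gen W) \<ominus>\<^bsub>F\<^esub> free_gen U,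
           (free_gen W [^]\<^bsub>F\<^esub> p) \<ominus>\<^bsub>F\<^esub> free_gen W \<ominus>\<^bsub>F\<^esub>
             ((\<beta> * inverse (d 0 ^ p)) \<odot>\<^bsub>F\<^esub> \<one>\<^bsub>F\<^esub>)}"
      unfolding m H.fibre_eq
    proof (intro bexI)
      show "presented_by fib.F (case_uw (fib.cls [:[:- a, 1:]:]) (fib.cls (embY [:0, 1 / d 0:])))
          {free_gen U [^]\<^bsub>F\<^esub> p,
           (free_gen W \<otimes>\<^bsub>F\<^esub> free_gen U) \<ominus>\<^bsub>F\<^esub> (free_gen U \<otimes>\<^bsub>F\<^esub> free_gen W) \<ominus>\<^bsub>F\<^esub> free_gen U,
           (free_gen W [^]\<^bsub>F\<^esub> p) \<ominus>\<^bsub>F\<^esub> free_gen W \<ominus>\<^bsub>F\<^esub>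
             ((\<beta> * inverse (d 0 ^ p)) \<odot>\<^bsub>F\<^esub> \<one>\<^bsub>F\<^esub>)}"
        using fib.fibre_presentation[OF d0]
        unfolding F_def free_gen_word word_power word_mult append.simps free_simps(2) .
    qed (rule fib.cls_carrier)+
    obtain \<rho> where \<rho>: "poly (H.Q \<beta>) \<rho> = 0" using H.Q_has_root by blast
    let ?\<rho> = "\<lambda>i. \<rho> + of_nat i * d 0"
    have root: "poly (H.Q \<beta>) \<sigma> = 0 \<longleftrightarrow> (\<exists>i<p. \<sigma> = ?\<rho> i)" for \<sigma>
      using H.Q_roots(2)[OF d0 \<rho>] by (simp add: set_eq_iff image_iff Bex_def)
    have root': "poly (H.Q \<beta>) (?\<rho> i) = 0" if "i < p" for i
      using that unfolding root by (intro exI[of _ i] conjI refl)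
    show "\<exists>e. blocks (fibre H (\<mm> \<alpha> \<beta>)) = {e} \<and>
        (\<exists>S :: nat \<Rightarrow> ('k poly poly set, 'k) module.
          (\<forall>i<p. simple_module (fibre H (\<mm> \<alpha> \<beta>)) (S i) \<and> in_block (S i) e \<and>
             has_dim (fibre H (\<mm> \<alpha> \<beta>)) (S i) 1) \<and>
          (\<forall>i<p. \<forall>j<p. i \<noteq> j \<longrightarrow> \<not> module_isomorphic (fibre H (\<mm> \<alpha> \<beta>)) (S i) (S j)) \<and>
          (\<forall>M :: ('k poly poly set, 'm) module. simple_module (fibre H (\<mm> \<alpha> \<beta>)) M \<longrightarrow>
             (\<exists>i<p. module_isomorphic (fibre H (\<mm> \<alpha> \<beta>)) M (S i))))"
      unfolding m H.fibre_eq
    \<comment> \<open>The p translates of one root by multiples of d_0 label the simple modules; the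
      only block is given by the identity, which acts trivially on each of them.\<close>
    proof (intro exI[of _ "\<one>\<^bsub>fib.F\<^esub>"] exI[of _ "\<lambda>i. char_mod a (?\<rho> i)"] conjI allI impI)
      show "blocks fib.F = {\<one>\<^bsub>fib.F\<^esub>}"
        by (rule H.blocks_fibre[OF fib.a fib.e d0])
      fix i assume i: "i < p"
      show "simple_module fib.F (char_mod a (?\<rho> i))"
        by (rule fib.simple_char_mod[OF root'[OF i]])
      show "has_dim fib.F (char_mod a (?\<rho> i)) 1"
        by (rule fib.has_dim_char_mod[OF root'[OF i]])
      show "in_block (char_mod a (?\<rho> i)) \<one>\<^bsub>fib.F\<^esub>"
        unfolding in_block_def fib.one_F fib.char_mod_act[OF root'[OF i]] by simp
      fix j assume j: "j < p" "i \<noteq> j"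
      have "?\<rho> i \<noteq> ?\<rho> j"
        using inj_onD[OF H.Q_roots(1)[OF d0 \<rho>], of i j] i j by blast
      then show "\<not> module_isomorphic fib.F (char_mod a (?\<rho> i)) (char_mod a (?\<rho> j))"
        by (rule fib.char_mod_not_isomorphic[OF root'[OF i] root'[OF j(1)]])
    next
      fix M :: "('k poly poly set, 'm) module"
      assume M: "simple_module fib.F M"
      obtain \<sigma> where \<sigma>: "poly (H.Q \<beta>) \<sigma> = 0" "module_isomorphic fib.F M (char_mod a \<sigma>)"
        using fib.simple_module_char[OF M] by (elim exE conjE)
      obtain i where i: "i < p" "\<sigma> = ?\<rho> i"
        using \<sigma>(1) unfolding root by (elim exE conjE)
      show "\<exists>i<p. module_isomorphic fib.F M (char_mod a (?\<rho> i))"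
        using i(1) \<sigma>(2) unfolding i(2) by (intro exI[of _ i] conjI)
    qed
  next
    fix r assume "r = card {x. (\<Sum>s | d s \<noteq> 0. d s ^ p * x ^ (p ^ s)) = 0}"
    then have r: "r = card {x. poly H.disc x = 0}"
      by (simp only: H.disc_sum)
    show "\<exists>L. (\<forall>i<r. is_affine_line Z (L i)) \<and> disjoint_family_on L {..<r} \<and> NA = (\<Union>i<r. L i)"
      unfolding Z_def NA_def by (rule H.non_azumaya_lines[OF r])
  qed
qed

end
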